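(* Let $K$ be a field of characteristic zero, let $R=K[x_1,\dots,x_n]$ be the polynomial ring with the standard grading, and let $f_1,\dots,f_n\in R$ be quadrics (homogeneous polynomials of degree $2$) such that (1) $f_1,\dots,f_n$ form a regular sequence in $R$; (2) for every $\sigma\in S_n$ and every $i=1,\dots,n$, $f_i(x_{\sigma(1)},x_{\sigma(2)},\dots,x_{\sigma(n)})=f_{\sigma(i)}(x_1,x_2,\dots,x_n)$. Let $I=(f_1,\dots,f_n)$. Then $A:=R/I$ has the strong Lefschetz property. Moreover, let $e_1=x_1+x_2+\cdots+x_n$; if $e_1^2\notin I$, then (the image of) $e_1$ is a strong Lefschetz element for $A$.
   Context: Let $V=\bigoplus_{i\ge 0}V_i$ be a finite-dimensional graded vector space over $K$ and $L:V\to V$ a graded endomorphism of degree one (so $L(V_i)\subset V_{i+1}$). $L$ is a strong Lefschetz element if there is an integer $c$ such that $V_i=0$ for all $i\ge c+1$ and the restricted map $L^{c-2i}:V_i\to V_{c-i}$ is bijective for all $i=0,1,\dots,\lfloor c/2\rfloor$. For a graded Artinian $K$-algebra $A=\bigoplus_{i=0}^cA_i$ with $A_0=K$, an element $l\in A_1$ is a strong Lefschetz element for $A$ if multiplication by $l$, viewed as a graded endomorphism $A\to A$ of degree one, is a strong Lefschetz element; $A$ has the strong Lefschetz property if such an $l\in A_1$ exists. *)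

theory Defs
  imports
    "HOL-Algebra.QuotRing"
    "HOL-Algebra.Module"
    "HOL-Algebra.Algebraic_Closure_Type"
    "HOL-Library.Poly_Mapping"
    "HOL-Combinatorics.Permutations"
begin

section \<open>Graded vector spaces and strong Lefschetz elements\<close>

text \<open>The grading of \<open>V\<close> is a family \<open>G\<close> of subspaces such that every vector is, in exactly one
  way, a sum of finitely many components \<open>u i \<in> G i\<close>.\<close>

definition graded_vector_space ::
  "('k, 'c) ring_scheme \<Rightarrow> ('k, 'v, 'd) module_scheme \<Rightarrow> (nat \<Rightarrow> 'v set) \<Rightarrow> bool" where
  "graded_vector_space K V G \<longleftrightarrow>
     field K \<and> Module.module K V \<and>
     (\<forall>i. submodule (G i) K V) \<and>
     (\<forall>v \<in> carrier V. \<exists>!u. (\<forall>i. u i \<in> G i) \<and> finite {i. u i \<noteq> \<zero>\<^bsub>V\<^esub>} \<and>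
        v = finsum V u {i. u i \<noteq> \<zero>\<^bsub>V\<^esub>})"

definition finite_dim_space ::
  "('k, 'c) ring_scheme \<Rightarrow> ('k, 'v, 'd) module_scheme \<Rightarrow> bool" where
  "finite_dim_space K V \<longleftrightarrow>
     (\<exists>B \<subseteq> carrier V. finite B \<and>
        (\<forall>v \<in> carrier V. \<exists>a \<in> B \<rightarrow> carrier K. v = finsum V (\<lambda>b. a b \<odot>\<^bsub>V\<^esub> b) B))"

definition linear_endo ::
  "('k, 'c) ring_scheme \<Rightarrow> ('k, 'v, 'd) module_scheme \<Rightarrow> ('v \<Rightarrow> 'v) \<Rightarrow> bool" where
  "linear_endo K V L \<longleftrightarrow>
     L \<in> carrier V \<rightarrow> carrier V \<and>
     (\<forall>v \<in> carrier V. \<forall>w \<in> carrier V. L (v \<oplus>\<^bsub>V\<^esub> w) = L v \<oplus>\<^bsub>V\<^esub> L w) \<and>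
     (\<forall>a \<in> carrier K. \<forall>v \<in> carrier V. L (a \<odot>\<^bsub>V\<^esub> v) = a \<odot>\<^bsub>V\<^esub> L v)"

text \<open>The integer \<open>c\<close> may be taken to be a natural number: a negative \<open>c\<close> would force \<open>V = 0\<close>, and
  then \<open>c = 0\<close> works as well.\<close>

definition strong_Lefschetz_endo ::
  "('k, 'c) ring_scheme \<Rightarrow> ('k, 'v, 'd) module_scheme \<Rightarrow> (nat \<Rightarrow> 'v set) \<Rightarrow> ('v \<Rightarrow> 'v) \<Rightarrow> bool" where
  "strong_Lefschetz_endo K V G L \<longleftrightarrow>
     graded_vector_space K V G \<and> finite_dim_space K V \<and>
     linear_endo K V L \<and> (\<forall>i. L ` G i \<subseteq> G (Suc i)) \<and>
     (\<exists>c::nat. (\<forall>i \<ge> c + 1. G i = {\<zero>\<^bsub>V\<^esub>}) \<and>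
        (\<forall>i \<le> c div 2. bij_betw (L ^^ (c - 2 * i)) (G i) (G (c - i))))"

text \<open>A graded Artinian \<open>K\<close>-algebra \<open>A\<close> has finitely many nonzero components, all of finite
  dimension, and \<open>A\<^sub>0 = K\<close>; so being Artinian is expressed by finite dimensionality over \<open>K\<close>.\<close>

definition graded_artinian_algebra ::
  "('k, 'c) ring_scheme \<Rightarrow> ('k, 'v, 'd) module_scheme \<Rightarrow> (nat \<Rightarrow> 'v set) \<Rightarrow> bool" where
  "graded_artinian_algebra K A G \<longleftrightarrow>
     algebra K A \<and> graded_vector_space K A G \<and> finite_dim_space K A \<and>
     (\<forall>i j. \<forall>a \<in> G i. \<forall>b \<in> G j. a \<otimes>\<^bsub>A\<^esub> b \<in> G (i + j)) \<and>
     bij_betw (\<lambda>a. a \<odot>\<^bsub>A\<^esub> \<one>\<^bsub>A\<^esub>) (carrier K) (G 0)"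

definition strong_Lefschetz_element ::
  "('k, 'c) ring_scheme \<Rightarrow> ('k, 'v, 'd) module_scheme \<Rightarrow> (nat \<Rightarrow> 'v set) \<Rightarrow> 'v \<Rightarrow> bool" where
  "strong_Lefschetz_element K A G l \<longleftrightarrow>
     graded_artinian_algebra K A G \<and> l \<in> G 1 \<and>
     strong_Lefschetz_endo K A G (\<lambda>a. l \<otimes>\<^bsub>A\<^esub> a)"

definition strong_Lefschetz_property ::
  "('k, 'c) ring_scheme \<Rightarrow> ('k, 'v, 'd) module_scheme \<Rightarrow> (nat \<Rightarrow> 'v set) \<Rightarrow> bool" where
  "strong_Lefschetz_property K A G \<longleftrightarrow> (\<exists>l. strong_Lefschetz_element K A G l)"


section \<open>Quotient algebras and regular sequences\<close>

definition quot_algebra :: "('k, 'v, 'd) module_scheme \<Rightarrow> 'v set \<Rightarrow> ('k, 'v set) module" where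
  "quot_algebra R I =
     \<lparr>carrier = carrier (R Quot I), monoid.mult = monoid.mult (R Quot I),
      monoid.one = monoid.one (R Quot I),
      ring.zero = ring.zero (R Quot I), ring.add = ring.add (R Quot I),
      module.smult = (\<lambda>a Y. (I +>\<^bsub>R\<^esub> (a \<odot>\<^bsub>R\<^esub> \<one>\<^bsub>R\<^esub>)) \<otimes>\<^bsub>R Quot I\<^esub> Y)\<rparr>"

definition quot_grading ::
  "('k, 'v, 'd) module_scheme \<Rightarrow> (nat \<Rightarrow> 'v set) \<Rightarrow> 'v set \<Rightarrow> nat \<Rightarrow> 'v set set" where
  "quot_grading R G I d = (\<lambda>p. I +>\<^bsub>R\<^esub> p) ` G d"

definition regular_sequence :: "('v, 'd) ring_scheme \<Rightarrow> 'v list \<Rightarrow> bool" where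
  "regular_sequence R fs \<longleftrightarrow>
     set fs \<subseteq> carrier R \<and>
     (\<forall>k < length fs. \<forall>g \<in> carrier R.
        fs ! k \<otimes>\<^bsub>R\<^esub> g \<in> Idl\<^bsub>R\<^esub> (set (take k fs)) \<longrightarrow> g \<in> Idl\<^bsub>R\<^esub> (set (take k fs))) \<and>
     Idl\<^bsub>R\<^esub> (set fs) \<noteq> carrier R"


section \<open>The polynomial ring in the variables \<open>x\<^sub>1, \<dots>, x\<^sub>n\<close>\<close>

text \<open>A polynomial is a finitely supported map from monomials to coefficients, and a monomial is a
  finitely supported map from variable indices to exponents; ring operations are those of
  \<^theory>\<open>HOL-Library.Poly_Mapping\<close>.\<close>

type_synonym 'a mpoly = "(nat \<Rightarrow>\<^sub>0 nat) \<Rightarrow>\<^sub>0 'a"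

definition mconst :: "'a::comm_ring_1 \<Rightarrow> 'a mpoly" where
  "mconst a = Poly_Mapping.single 0 a"

definition mvar :: "nat \<Rightarrow> 'a::comm_ring_1 mpoly" where
  "mvar i = Poly_Mapping.single (Poly_Mapping.single i 1) 1"

definition poly_algebra :: "nat \<Rightarrow> ('a::comm_ring_1, 'a mpoly) module" where
  "poly_algebra n =
     \<lparr>carrier = {p. \<forall>m \<in> Poly_Mapping.keys p. Poly_Mapping.keys m \<subseteq> {1..n}},
      monoid.mult = (*), monoid.one = 1, ring.zero = 0, ring.add = (+),
      module.smult = (\<lambda>a p. mconst a * p)\<rparr>"

definition homogeneous_part :: "nat \<Rightarrow> nat \<Rightarrow> 'a::comm_ring_1 mpoly set" where
  "homogeneous_part n d =
     {p \<in> carrier (poly_algebra n). \<forall>m \<in> Poly_Mapping.keys p.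
        (\<Sum>i = 1..n. Poly_Mapping.lookup m i) = d}"

text \<open>\<open>msubst n g p\<close> is \<open>p(g 1, \<dots>, g n)\<close>.\<close>

definition msubst :: "nat \<Rightarrow> (nat \<Rightarrow> 'a::comm_ring_1 mpoly) \<Rightarrow> 'a mpoly \<Rightarrow> 'a mpoly" where
  "msubst n g p =
     (\<Sum>m \<in> Poly_Mapping.keys p.
        mconst (Poly_Mapping.lookup p m) * (\<Prod>i = 1..n. g i ^ Poly_Mapping.lookup m i))"

end

theory Submission
  imports Defs
begin

text \<open>
  By equivariance \<open>f\<^sub>i = \<alpha> y\<^sub>i\<^sup>2 + \<gamma> (y\<^sub>1\<^sup>2 + \<dots> + y\<^sub>n\<^sup>2) + \<delta> e\<^sup>2\<close> with \<open>e = x\<^sub>1 + \<dots> + x\<^sub>n\<close>,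
  \<open>y\<^sub>i = x\<^sub>i + b e\<close> and \<open>\<alpha> \<noteq> 0\<close>. Modulo the ideal, either all \<open>y\<^sub>i\<^sup>2\<close> equal \<open>\<kappa> e\<^sup>2\<close>, or \<open>e\<^sup>2 = 0\<close> and all
  \<open>y\<^sub>i\<^sup>2\<close> coincide. Let \<open>w\<close> be a product of \<open>k\<close> differences \<open>y\<^sub>a - y\<^sub>b\<close> with disjoint index pairs.
  In the first case every element of degree \<open>d\<close> is a combination of the \<open>e\<^bsup>d-k\<^esup> w\<close>. Since
  \<open>(y\<^sub>a + y\<^sub>b)(y\<^sub>a - y\<^sub>b) = 0\<close>, the sum of the remaining \<open>n - 2k\<close> elements \<open>y\<^sub>i\<close> acts on \<open>w\<close> as a
  scalar multiple of \<open>e\<close>; this sum has an explicit annihilating polynomial, which yields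
  \<open>e\<^bsup>n-2k+1\<^esup> w = 0\<close>, because a vanishing leading coefficient would produce a nontrivial common zero
  of the quadrics. Hence \<open>e\<^bsup>n-2i\<^esup> : A\<^sub>i \<rightarrow> A\<^bsub>n-i\<^esub>\<close> is surjective. In the second case \<open>n\<close> is odd, the same argument
  is carried out for \<open>y\<^sub>1, \<dots>, y\<^bsub>n-1\<^esub>\<close> over \<open>K[y\<^sub>n, e]\<close>, and \<open>y\<^sub>n + \<tau> e\<close> works for generic \<open>\<tau>\<close>. Finally,
  regularity forces \<open>dim A\<^sub>i\<close> to be the binomial coefficient, so the surjections are bijective.
\<close>

section \<open>Homogeneous polynomials\<close>

text \<open>Writing an element as a sum of \<open>e ^ (d - k) * h k\<close>, where
  \<open>e ^ (n - 2 * k + 1)\<close> kills \<open>h k\<close>, plays the part of a primitive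
  decomposition: in degree n - i the terms with k > i vanish and the others are divisible by
  \<open>e ^ (n - 2 * i)\<close>. Existence of such sums suffices, since injectivity comes from
  dimensions. The annihilating polynomial vanishes at the possible sums of m signed copies of one
  square root; at multiples of \<open>e\<close> it is a scalar times a power of \<open>e\<close>, so
  everything hinges on that scalar. The Nullstellensatz is avoided: the dimension count puts all
  forms of degree n + 1 into the ideal, so a common zero in any extension field is 0. There are two
  cases because the squares of the \<open>y i\<close> solve a linear system with matrix \<alpha>
  times the identity plus \<gamma> times the all-ones matrix, singular exactly when \<alpha> + n
  \<gamma> = 0 (as \<alpha> is nonzero). In the singular case powers of \<open>e\<close> die, so
  \<open>y n\<close> is set aside as the reference square. The scalar relation then links
  \<open>l ^ (m + 1)\<close> with \<open>e * l ^ m\<close>, and \<tau> is generic precisely to keep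
  the second coefficient nonzero, so that \<open>e\<close> can be traded for a power of
  \<open>l\<close>.\<close>

definition mons :: "nat \<Rightarrow> nat \<Rightarrow> (nat \<Rightarrow>\<^sub>0 nat) set" where
  "mons n d = {m. Poly_Mapping.keys m \<subseteq> {1..n} \<and> (\<Sum>i = 1..n. Poly_Mapping.lookup m i) = d}"

text \<open>Monomials in variables outside x_1, ..., x_n are discarded too, not only those of other
  degrees. So \<open>proj\<close> applies to arbitrary elements of the type and removes foreign
  variables from the coefficients of ideal combinations.\<close>

definition proj :: "nat \<Rightarrow> nat \<Rightarrow> 'a::comm_ring_1 mpoly \<Rightarrow> 'a mpoly" where
  "proj n d p = (\<Sum>m \<in> Poly_Mapping.keys p \<inter> mons n d. Poly_Mapping.single m (Poly_Mapping.lookup p m))"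

lemma lookup_sum_single:
  assumes "finite M"
  shows "Poly_Mapping.lookup (\<Sum>m\<in>M. Poly_Mapping.single m (c m)) k = (if k \<in> M then c k else 0)"
  using assms by (simp add: lookup_sum lookup_single when_def)

lemma poly_eq_sum_single:
  "(p :: 'b \<Rightarrow>\<^sub>0 'a::comm_monoid_add) = (\<Sum>m\<in>Poly_Mapping.keys p. Poly_Mapping.single m (Poly_Mapping.lookup p m))"
  by (rule poly_mapping_eqI) (auto simp: lookup_sum_single in_keys_iff)

lemma lookup_proj: "Poly_Mapping.lookup (proj n d p) m = (if m \<in> mons n d then Poly_Mapping.lookup p m else 0)"
  by (auto simp: proj_def lookup_sum_single in_keys_iff)

lemma homogeneous_part_iff: "p \<in> homogeneous_part n d \<longleftrightarrow> Poly_Mapping.keys p \<subseteq> mons n d"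
  by (auto simp: homogeneous_part_def poly_algebra_def mons_def)

lemma homogeneous_part_lookup:
  "p \<in> homogeneous_part n d \<longleftrightarrow> (\<forall>m. m \<notin> mons n d \<longrightarrow> Poly_Mapping.lookup p m = 0)"
  by (auto simp: homogeneous_part_iff in_keys_iff subset_iff)

lemma carrier_poly_iff: "p \<in> carrier (poly_algebra n) \<longleftrightarrow> (\<forall>m. m \<notin> (\<Union>d. mons n d) \<longrightarrow> Poly_Mapping.lookup p m = 0)"
  by (auto simp: poly_algebra_def in_keys_iff mons_def) 

text \<open>Exponents are natural numbers, so nothing cancels in \<open>a + b\<close>: supports
  unite and degrees add.\<close>

lemma mons_add_iff:
  assumes "b \<in> mons n e" shows "a + b \<in> mons n (d + e) \<longleftrightarrow> a \<in> mons n d"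
proof -
  have "Poly_Mapping.keys (a + b) = Poly_Mapping.keys a \<union> Poly_Mapping.keys b"
    by (auto simp: in_keys_iff lookup_add)
  then show ?thesis using assms by (auto simp: mons_def lookup_add sum.distrib)
qed

lemma mons_deg_unique: "m \<in> mons n d \<Longrightarrow> m \<in> mons n e \<Longrightarrow> d = e"
  by (auto simp: mons_def)

lemma finite_mons [simp]: "finite (mons n d)"
proof -
  let ?F = "{g :: nat \<Rightarrow> nat. \<forall>i. (i \<in> {1..n} \<longrightarrow> g i \<in> {..d}) \<and> (i \<notin> {1..n} \<longrightarrow> g i = 0)}"
  have fin: "finite ?F" by (rule finite_set_of_finite_funs) auto
  have "Poly_Mapping.lookup ` mons n d \<subseteq> ?F"
  proof clarify
    fix m i assume m: "m \<in> mons n d"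
    have "Poly_Mapping.lookup m i \<le> d" if "i \<in> {1..n}"
      using m that member_le_sum[of i "{1..n}" "Poly_Mapping.lookup m"] by (auto simp: mons_def)
    then show "(i \<in> {1..n} \<longrightarrow> Poly_Mapping.lookup m i \<in> {..d}) \<and> (i \<notin> {1..n} \<longrightarrow> Poly_Mapping.lookup m i = 0)"
      using m by (auto simp: mons_def in_keys_iff subset_iff)
  qed
  then have "finite (Poly_Mapping.lookup ` mons n d)" using fin by (rule finite_subset)
  then show ?thesis by (rule finite_imageD) (auto intro: inj_onI dest: poly_mapping.lookup_inject[THEN iffD1])
qed

lemma mconst_add: "mconst (a + b) = mconst a + mconst b" by (simp add: mconst_def single_add)
lemma mconst_diff: "mconst (a - b) = mconst a - mconst b" by (simp add: mconst_def single_diff)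
lemma mconst_uminus: "mconst (- a) = - mconst a" by (simp add: mconst_def single_uminus)
lemma mconst_mult: "mconst (a * b) = mconst a * mconst b" by (simp add: mconst_def mult_single)
lemma mconst_0 [simp]: "mconst 0 = 0" by (simp add: mconst_def)
lemma mconst_1 [simp]: "mconst 1 = 1" by (simp add: mconst_def)
lemma mconst_of_nat: "mconst (of_nat k) = of_nat k" by (simp add: mconst_def)
lemma mconst_numeral: "mconst (numeral k) = numeral k"
  by (metis mconst_of_nat of_nat_numeral)

lemma lookup_mconst_mult: "Poly_Mapping.lookup (mconst a * p) m = a * Poly_Mapping.lookup p m"
proof -
  have "mconst a * p = Poly_Mapping.map ((*) a) p"
    by (simp add: mconst_def mult_map_scale_conv_mult)
  then show ?thesis by (simp add: Poly_Mapping.map.rep_eq when_def)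
qed

lemma mconst_mult_single: "mconst a * Poly_Mapping.single m b = Poly_Mapping.single m (a * b)"
  by (simp add: mconst_def mult_single)

lemma hom_0 [simp]: "0 \<in> homogeneous_part n d" by (simp add: homogeneous_part_iff)
lemma hom_add [intro]: "p \<in> homogeneous_part n d \<Longrightarrow> q \<in> homogeneous_part n d \<Longrightarrow> p + q \<in> homogeneous_part n d"
  by (simp add: homogeneous_part_lookup lookup_add)
lemma hom_diff [intro]: "p \<in> homogeneous_part n d \<Longrightarrow> q \<in> homogeneous_part n d \<Longrightarrow> p - q \<in> homogeneous_part n d"
  by (simp add: homogeneous_part_lookup lookup_minus)
lemma hom_scale [intro]: "p \<in> homogeneous_part n d \<Longrightarrow> mconst a * p \<in> homogeneous_part n d"
  by (simp add: homogeneous_part_lookup lookup_mconst_mult)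
lemma hom_sum [intro]: "(\<And>i. i \<in> S \<Longrightarrow> p i \<in> homogeneous_part n d) \<Longrightarrow> sum p S \<in> homogeneous_part n d"
  by (induction S rule: infinite_finite_induct) auto

lemma hom_mult [intro]:
  assumes "p \<in> homogeneous_part n d" "q \<in> homogeneous_part n e"
  shows "p * q \<in> homogeneous_part n (d + e)"
  unfolding homogeneous_part_iff
proof
  fix m assume "m \<in> Poly_Mapping.keys (p * q)"
  then obtain a b where "m = a + b" "a \<in> Poly_Mapping.keys p" "b \<in> Poly_Mapping.keys q"
    using keys_mult by blast
  then show "m \<in> mons n (d + e)" using assms by (auto simp: homogeneous_part_iff mons_add_iff subset_iff)
qed

lemma hom_1 [simp]: "1 \<in> homogeneous_part n 0"
  by (simp add: homogeneous_part_iff mons_def)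

lemma hom_mconst [simp]: "mconst a \<in> homogeneous_part n 0"
  using hom_scale[OF hom_1] by (metis mult.right_neutral)

lemma hom_power [intro]: "p \<in> homogeneous_part n d \<Longrightarrow> p ^ k \<in> homogeneous_part n (k * d)"
  by (induction k) auto

lemma hom_power_mult:
  assumes "l \<in> homogeneous_part n 1" "p \<in> homogeneous_part n i" "2 * i \<le> n"
  shows "l ^ (n - 2 * i) * p \<in> homogeneous_part n (n - i)"
proof -
  have "l ^ (n - 2 * i) * p \<in> homogeneous_part n ((n - 2 * i) * 1 + i)" by (intro hom_mult hom_power assms)
  moreover have "(n - 2 * i) * 1 + i = n - i" using assms(3) by simp
  ultimately show ?thesis by metis
qed

lemma hom_mvar [intro]: "i \<in> {1..n} \<Longrightarrow> mvar i \<in> homogeneous_part n 1"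
  by (auto simp: homogeneous_part_iff mons_def mvar_def lookup_single when_def)

lemma hom_carrier: "p \<in> homogeneous_part n d \<Longrightarrow> p \<in> carrier (poly_algebra n)"
  by (simp add: homogeneous_part_def)

lemma single_mem_hom: "m \<in> mons n d \<Longrightarrow> Poly_Mapping.single m c \<in> homogeneous_part n d"
  by (auto simp: homogeneous_part_iff)

lemma proj_hom [simp, intro]: "proj n d p \<in> homogeneous_part n d"
  by (simp add: homogeneous_part_lookup lookup_proj)

lemma proj_id: "p \<in> homogeneous_part n d \<Longrightarrow> proj n d p = p"
  by (rule poly_mapping_eqI) (simp add: lookup_proj homogeneous_part_lookup)

lemma proj_other: "p \<in> homogeneous_part n e \<Longrightarrow> e \<noteq> d \<Longrightarrow> proj n d p = 0"
  by (rule poly_mapping_eqI) (auto simp: lookup_proj homogeneous_part_lookup dest: mons_deg_unique)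

lemma proj_add: "proj n d (p + q) = proj n d p + proj n d q"
  by (rule poly_mapping_eqI) (simp add: lookup_proj lookup_add)
lemma proj_diff: "proj n d (p - q) = proj n d p - proj n d q"
  by (rule poly_mapping_eqI) (simp add: lookup_proj lookup_minus)
lemma proj_0 [simp]: "proj n d 0 = 0"
  by (rule poly_mapping_eqI) (simp add: lookup_proj)
lemma proj_sum: "proj n d (sum p S) = (\<Sum>i\<in>S. proj n d (p i))"
  by (induction S rule: infinite_finite_induct) (auto simp: proj_add)

text \<open>By \<open>mons_add_iff\<close>, a monomial of degree \<open>d + e\<close> in the product
  can only come from a monomial of \<open>g\<close> in \<open>mons n d\<close>; the rest of
  \<open>g\<close> contributes nothing.\<close>

lemma proj_mult:
  assumes f: "f \<in> homogeneous_part n e"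
  shows "proj n (d + e) (g * f) = proj n d g * f"
proof -
  have "proj n (d + e) ((g - proj n d g) * f) = 0"
  proof (rule poly_mapping_eqI)
    fix m
    have "Poly_Mapping.lookup ((g - proj n d g) * f) m = 0" if m: "m \<in> mons n (d + e)"
    proof (rule ccontr)
      assume "\<not> ?thesis"
      then have "m \<in> Poly_Mapping.keys ((g - proj n d g) * f)" by (simp add: in_keys_iff)
      then obtain a b where ab: "m = a + b" "a \<in> Poly_Mapping.keys (g - proj n d g)" "b \<in> Poly_Mapping.keys f"
        using keys_mult by blast
      then have "a \<in> mons n d" using m f mons_add_iff by (auto simp: homogeneous_part_iff)
      then show False using ab(2) by (simp add: in_keys_iff lookup_minus lookup_proj)
    qed
    then show "Poly_Mapping.lookup (proj n (d + e) ((g - proj n d g) * f)) m = Poly_Mapping.lookup 0 m"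
      by (simp add: lookup_proj)
  qed
  moreover have "proj n (d + e) (proj n d g * f) = proj n d g * f"
    by (intro proj_id hom_mult f proj_hom)
  ultimately show ?thesis by (simp add: left_diff_distrib proj_diff)
qed

lemma proj_mult_low:
  assumes f: "f \<in> homogeneous_part n e" and "d < e"
  shows "proj n d (g * f) = 0"
proof (rule poly_mapping_eqI)
  fix m
  have "Poly_Mapping.lookup (g * f) m = 0" if m: "m \<in> mons n d"
  proof (rule ccontr)
    assume "\<not> ?thesis"
    then have "m \<in> Poly_Mapping.keys (g * f)" by (simp add: in_keys_iff)
    then obtain a b where ab: "m = a + b" "a \<in> Poly_Mapping.keys g" "b \<in> Poly_Mapping.keys f"
      using keys_mult by blast
    then have "b \<in> mons n e" using f by (auto simp: homogeneous_part_iff)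
    then have "e = (\<Sum>i = 1..n. Poly_Mapping.lookup b i)" by (simp add: mons_def)
    also have "\<dots> \<le> (\<Sum>i = 1..n. Poly_Mapping.lookup m i)"
      by (rule sum_mono) (simp add: ab lookup_add)
    also have "\<dots> = d" using m by (simp add: mons_def)
    finally show False using assms by simp
  qed
  then show "Poly_Mapping.lookup (proj n d (g * f)) m = Poly_Mapping.lookup 0 m"
    by (simp add: lookup_proj)
qed

lemma carrier_decomp:
  assumes "p \<in> carrier (poly_algebra n)"
  obtains N where "p = (\<Sum>d\<le>N. proj n d p)" "\<And>d. d > N \<Longrightarrow> proj n d p = 0"
proof -
  let ?deg = "\<lambda>m. \<Sum>i = 1..n. Poly_Mapping.lookup m i"
  obtain N where N: "\<And>m. m \<in> Poly_Mapping.keys p \<Longrightarrow> ?deg m \<le> N"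
    using finite_nat_set_iff_bounded_le[of "?deg ` Poly_Mapping.keys p"] by auto
  have 1: "proj n d p = 0" if "d > N" for d
    using N that by (intro poly_mapping_eqI) (force simp: lookup_proj in_keys_iff mons_def)
  have 2: "p = (\<Sum>d\<le>N. proj n d p)"
  proof (rule poly_mapping_eqI)
    fix m
    show "Poly_Mapping.lookup p m = Poly_Mapping.lookup (\<Sum>d\<le>N. proj n d p) m"
    proof (cases "m \<in> Poly_Mapping.keys p")
      case True
      then have "m \<in> mons n d \<longleftrightarrow> d = ?deg m" for d
        using assms by (auto simp: mons_def poly_algebra_def)
      then show ?thesis using N[OF True] by (simp add: lookup_sum lookup_proj)
    next
      case False
      then have "Poly_Mapping.lookup p m = 0" by (simp add: in_keys_iff)
      then have "(\<Sum>d\<le>N. Poly_Mapping.lookup (proj n d p) m) = 0"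
        by (intro sum.neutral) (simp add: lookup_proj)
      then show ?thesis using \<open>Poly_Mapping.lookup p m = 0\<close> by (simp add: lookup_sum)
    qed
  qed
  show ?thesis by (rule that[OF 2 1])
qed

lemma mons_0: "mons n 0 = {0}"
proof -
  have "m = 0" if m: "m \<in> mons n 0" for m
  proof -
    have z: "(\<Sum>i = 1..n. Poly_Mapping.lookup m i) = 0" "Poly_Mapping.keys m \<subseteq> {1..n}"
      using m by (simp_all add: mons_def)
    have "Poly_Mapping.lookup m i = 0" for i
    proof (cases "i \<in> {1..n}")
      case True
      with z(1) show ?thesis by (auto simp only: sum_eq_0_iff finite_atLeastAtMost)
    next
      case False
      with z(2) show ?thesis by (metis in_keys_iff subsetD)
    qed
    then show ?thesis by (intro poly_mapping_eqI) simp
  qed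
  moreover have "0 \<in> mons n 0" by (simp add: mons_def)
  ultimately show ?thesis by blast
qed

lemma mons_Suc:
  assumes "m \<in> mons n (Suc d)"
  shows "\<exists>i\<in>{1..n}. \<exists>m'\<in>mons n d. m = m' + Poly_Mapping.single i 1"
proof -
  have "(\<Sum>i = 1..n. Poly_Mapping.lookup m i) \<noteq> 0" using assms by (simp add: mons_def)
  then obtain i where i: "i \<in> {1..n}" "Poly_Mapping.lookup m i \<noteq> 0"
    using sum.neutral[of "{1..n}" "Poly_Mapping.lookup m"] by auto
  define m' where "m' = m - Poly_Mapping.single i 1"
  have m: "m = m' + Poly_Mapping.single i 1"
    using i by (intro poly_mapping_eqI) (auto simp: m'_def lookup_add lookup_minus lookup_single when_def)
  have "Poly_Mapping.single i 1 \<in> mons n 1"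
    using i by (simp add: mons_def lookup_single when_def)
  then have "m' \<in> mons n d" using assms m mons_add_iff[of "Poly_Mapping.single i 1" n 1 m' d] by simp
  then show ?thesis using i m by blast
qed

lemma homogeneous_induct_mult:
  fixes H :: "nat \<Rightarrow> 'a::comm_ring_1 mpoly set"
  assumes one: "1 \<in> H 0"
    and add: "\<And>d p q. p \<in> H d \<Longrightarrow> q \<in> H d \<Longrightarrow> p + q \<in> H d"
    and scale: "\<And>d a p. p \<in> H d \<Longrightarrow> mconst a * p \<in> H d"
    and var: "\<And>d i p. i \<in> {1..n} \<Longrightarrow> p \<in> H d \<Longrightarrow> mvar i * p \<in> H (Suc d)"
    and p: "p \<in> homogeneous_part n d" and ne: "0 \<in> H d"
  shows "p \<in> H d"
proof -
  have mono: "m \<in> mons n d \<Longrightarrow> Poly_Mapping.single m 1 \<in> H d" for m d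
  proof (induction d arbitrary: m)
    case 0
    then show ?case using one by (simp add: mons_0)
  next
    case (Suc d)
    then obtain i m' where m: "i \<in> {1..n}" "m' \<in> mons n d" "m = m' + Poly_Mapping.single i 1"
      using mons_Suc by blast
    then have "mvar i * Poly_Mapping.single m' 1 \<in> H (Suc d)" using Suc.IH var by blast
    then show ?case by (simp add: mvar_def mult_single m add.commute)
  qed
  have "(\<Sum>m\<in>M. Poly_Mapping.single m (Poly_Mapping.lookup p m)) \<in> H d" if "M \<subseteq> mons n d" "finite M" for M
    using that(2,1)
  proof (induction M rule: finite_induct)
    case (insert m M)
    have "Poly_Mapping.single m (Poly_Mapping.lookup p m) \<in> H d"
      using scale[OF mono, of m d "Poly_Mapping.lookup p m"] insert.prems by (simp add: mconst_mult_single)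
    then show ?case using insert add by simp
  qed (simp add: ne)
  then show ?thesis
    using p by (subst poly_eq_sum_single[of p]) (simp add: homogeneous_part_iff)
qed

section \<open>Dimensions of subspaces\<close>

text \<open>A relation rather than the number \<open>dim V\<close>: it asserts at the same time that
  the set is a subspace and that it has a finite basis.\<close>

definition (in vector_space) hasdim :: "'b set \<Rightarrow> nat \<Rightarrow> bool" where
  "hasdim V k \<longleftrightarrow> (\<exists>B. finite B \<and> independent B \<and> span B = V \<and> card B = k)"

context vector_space
begin

lemma hasdim_unique: "hasdim V k \<Longrightarrow> hasdim V l \<Longrightarrow> k = l"
  unfolding hasdim_def using dim_span_eq_card_independent by metis

lemma hasdim_subspace: "hasdim V k \<Longrightarrow> subspace V"
  by (auto simp: hasdim_def)

lemma hasdim_subspace_exists: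
  assumes V: "hasdim V r" and U: "subspace U" "U \<subseteq> V"
  shows "\<exists>u\<le>r. hasdim U u"
proof -
  obtain C where C: "finite C" "span C = V" "card C = r" using V by (auto simp: hasdim_def)
  obtain B where B: "B \<subseteq> U" "independent B" "U \<subseteq> span B" by (rule basis_exists[of U]) (rule that)
  have "B \<subseteq> span C" using B(1) U(2) C(2) by blast
  then have fin: "finite B \<and> card B \<le> card C" by (rule independent_span_bound[OF C(1) B(2)])
  then have "hasdim U (card B)"
    using B span_minimal[OF B(1) U(1)] unfolding hasdim_def by blast
  then show ?thesis using fin C by auto
qed

lemma hasdim_basis_extend:
  assumes V: "hasdim V r" and B0: "independent B0" "B0 \<subseteq> V"
  obtains B where "B0 \<subseteq> B" "finite B" "independent B" "span B = V" "card B = r"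
proof -
  obtain C where C: "finite C" "span C = V" "card C = r" using V by (auto simp: hasdim_def)
  obtain B where B: "B0 \<subseteq> B" "B \<subseteq> V" "independent B" "V \<subseteq> span B"
    using maximal_independent_subset_extend[OF B0(2,1)] by blast
  have "B \<subseteq> span C" using B(2) C(2) by simp
  then have fin: "finite B" using independent_span_bound[OF C(1) B(3)] by blast
  have sp: "span B = V"
    using B span_minimal[OF B(2) hasdim_subspace[OF V]] by blast
  then have "hasdim V (card B)" using fin B unfolding hasdim_def by blast
  then show ?thesis using that B fin sp hasdim_unique V by metis
qed

lemma hasdim_eq_subset:
  assumes "hasdim V r" "hasdim U r" "U \<subseteq> V" shows "U = V"
proof -
  obtain B0 where B0: "finite B0" "independent B0" "span B0 = U" "card B0 = r"
    using assms(2) by (auto simp: hasdim_def)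
  obtain B where B: "B0 \<subseteq> B" "finite B" "independent B" "span B = V" "card B = r"
    using hasdim_basis_extend[OF assms(1) B0(2)] B0(3) assms(3) span_superset by blast
  then have "B0 = B" using card_subset_eq B0 by metis
  then show ?thesis using B B0 by simp
qed

text \<open>Rank-nullity for the map that \<open>\<phi>\<close> induces from \<open>V\<close> to the
  quotient by \<open>S\<close>, whose kernel is \<open>U\<close>: the vectors completing a basis of
  \<open>U\<close> to one of \<open>V\<close> have images that stay independent modulo
  \<open>S\<close>.\<close>

lemma hasdim_sum_image:
  assumes lin: "Vector_Spaces.linear scale scale \<phi>"
    and S: "hasdim S c" and V: "hasdim V r" and U: "hasdim U u"
    and Udef: "U = {v \<in> V. \<phi> v \<in> S}"
  shows "u \<le> r \<and> hasdim {s + \<phi> v |s v. s \<in> S \<and> v \<in> V} (c + (r - u))"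
proof -
  interpret \<phi>: Vector_Spaces.linear scale scale \<phi> by (rule lin)
  obtain C0 where C0: "finite C0" "independent C0" "span C0 = S" "card C0 = c"
    using S by (auto simp: hasdim_def)
  obtain B0 where B0: "finite B0" "independent B0" "span B0 = U" "card B0 = u"
    using U by (auto simp: hasdim_def)
  have "B0 \<subseteq> V" using B0(3) Udef span_superset by blast
  from hasdim_basis_extend[OF V B0(2) this]
  obtain B where B: "B0 \<subseteq> B" "finite B" "independent B" "span B = V" "card B = r" by blast
  have "independent (C0 \<union> \<phi> ` D) \<and> card (C0 \<union> \<phi> ` D) = c + card D" if "D \<subseteq> B - B0" for D
  proof -
    have "finite D" using that B(2) finite_subset by blast
    then show ?thesis using that
    proof (induction D rule: finite_induct)
      case empty then show ?case using C0 by simp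
    next
      case (insert b D)
      have notin: "\<phi> b \<notin> span (C0 \<union> \<phi> ` D)"
      proof
        assume "\<phi> b \<in> span (C0 \<union> \<phi> ` D)"
        then obtain s v where sv: "\<phi> b = s + \<phi> v" "s \<in> S" "v \<in> span D"
          unfolding span_Un C0(3) \<phi>.span_image by auto
        have bV: "b \<in> V" "v \<in> V"
          using insert.prems B(4) span_superset sv(3) span_mono[of D B] by auto
        have "\<phi> (b - v) \<in> S" using sv by (simp add: \<phi>.diff)
        then have "b - v \<in> span B0"
          using bV Udef B0(3) subspace_diff[OF hasdim_subspace[OF V]] by auto
        then have "(b - v) + v \<in> span (B0 \<union> D)"
          using sv(3) span_mono[of B0 "B0 \<union> D"] span_mono[of D "B0 \<union> D"] by (intro span_add) auto
        then have "b \<in> span (B0 \<union> D)" by simp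
        moreover have "B0 \<union> D \<subseteq> B - {b}" using insert.prems insert.hyps B(1) by auto
        ultimately have "b \<in> span (B - {b})" using span_mono by blast
        then show False using B(3) insert.prems unfolding dependent_def by auto
      qed
      then have "\<phi> b \<notin> C0 \<union> \<phi> ` D" using span_base by metis
      then have "card (C0 \<union> \<phi> ` insert b D) = Suc (card (C0 \<union> \<phi> ` D))"
        using C0(1) insert.hyps(1) by simp
      then show ?case using notin insert independent_insertI[OF notin] by simp
    qed
  qed
  from this[of "B - B0"]
  have 1: "independent (C0 \<union> \<phi> ` (B - B0))" "card (C0 \<union> \<phi> ` (B - B0)) = c + card (B - B0)" by auto
  have 2: "card (B - B0) = r - u" "u \<le> r"
    using B B0 card_Diff_subset[of B0 B] card_mono[of B B0] by auto
  have "span (C0 \<union> \<phi> ` (B - B0)) = {s + \<phi> v |s v. s \<in> S \<and> v \<in> V}"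
  proof (intro equalityI subsetI)
    fix x assume "x \<in> span (C0 \<union> \<phi> ` (B - B0))"
    then obtain s v where "x = s + \<phi> v" "s \<in> S" "v \<in> span (B - B0)"
      unfolding span_Un C0(3) \<phi>.span_image by auto
    then show "x \<in> {s + \<phi> v |s v. s \<in> S \<and> v \<in> V}" using B(4) span_mono[of "B - B0" B] by auto
  next
    fix x assume "x \<in> {s + \<phi> v |s v. s \<in> S \<and> v \<in> V}"
    then obtain s v where x: "x = s + \<phi> v" "s \<in> S" "v \<in> V" by auto
    have "B = B0 \<union> (B - B0)" using B(1) by auto
    then obtain v1 v2 where v: "v = v1 + v2" "v1 \<in> U" "v2 \<in> span (B - B0)"
      using x(3) B(4) B0(3) span_Un[of B0 "B - B0"] by auto
    have "s + \<phi> v1 \<in> S" using x(2) v(2) Udef subspace_add[OF hasdim_subspace[OF S]] by auto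
    moreover have "x = (s + \<phi> v1) + \<phi> v2" using x(1) v(1) by (simp add: \<phi>.add add.assoc)
    ultimately show "x \<in> span (C0 \<union> \<phi> ` (B - B0))"
      unfolding span_Un C0(3) \<phi>.span_image using v(3) by auto
  qed
  then show ?thesis using 1 2 C0(1) B(2) unfolding hasdim_def
    by (intro conjI exI[of _ "C0 \<union> \<phi> ` (B - B0)"]) auto
qed

text \<open>The preimage \<open>U\<close> of \<open>S2\<close> in \<open>V1\<close> contains
  \<open>S1\<close>, and \<open>hasdim_sum_image\<close> forces its dimension to be
  \<open>c1\<close>, so both coincide. This is "surjective implies injective" for the induced map of
  quotients, phrased without quotient spaces.\<close>

lemma hasdim_quotient_inj:
  assumes lin: "Vector_Spaces.linear scale scale \<phi>"
    and S1: "hasdim S1 c1" and V1: "hasdim V1 r1" and S2: "hasdim S2 c2" and V2: "hasdim V2 r2"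
    and sub: "S1 \<subseteq> V1" "S2 \<subseteq> V2" "\<phi> ` S1 \<subseteq> S2" "\<phi> ` V1 \<subseteq> V2"
    and dims: "r1 - c1 = r2 - c2"
    and surj: "\<And>v. v \<in> V2 \<Longrightarrow> \<exists>w \<in> V1. v - \<phi> w \<in> S2"
    and v: "v \<in> V1" "\<phi> v \<in> S2"
  shows "v \<in> S1"
proof -
  interpret \<phi>: Vector_Spaces.linear scale scale \<phi> by (rule lin)
  note sub1 = hasdim_subspace[OF V1] and subS2 = hasdim_subspace[OF S2]
    and subV2 = hasdim_subspace[OF V2]
  define U where "U = {v \<in> V1. \<phi> v \<in> S2}"
  have "subspace U"
    using sub1 subS2 unfolding U_def subspace_def by (auto simp: \<phi>.add \<phi>.scale)
  then obtain u where u: "hasdim U u" using hasdim_subspace_exists[OF V1, of U] by (auto simp: U_def)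
  have eq: "{s + \<phi> v |s v. s \<in> S2 \<and> v \<in> V1} = V2"
  proof (intro equalityI subsetI)
    fix x assume "x \<in> V2"
    then obtain w where "w \<in> V1" "x - \<phi> w \<in> S2" using surj by blast
    then show "x \<in> {s + \<phi> v |s v. s \<in> S2 \<and> v \<in> V1}"
      by (intro CollectI exI[of _ "x - \<phi> w"] exI[of _ w]) simp
  qed (use sub subspace_add[OF subV2] in blast)
  have "u \<le> r1 \<and> hasdim V2 (c2 + (r1 - u))"
    using hasdim_sum_image[OF lin S2 V1 u U_def] unfolding eq by blast
  then have 1: "u \<le> r1" "r2 = c2 + (r1 - u)" using hasdim_unique[OF V2] by auto
  \<comment> \<open>Both \<open>c1 \<le> r1\<close> and \<open>u \<le> r1\<close> are needed to
    cancel in an equation of truncated differences.\<close>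
  have "c1 \<le> r1" using hasdim_subspace_exists[OF V1 hasdim_subspace[OF S1] sub(1)] hasdim_unique S1 by blast
  then have "u = c1" using 1 dims by simp
  moreover have "S1 \<subseteq> U" using sub by (auto simp: U_def)
  ultimately have "S1 = U" using hasdim_eq_subset u S1 by blast
  then show ?thesis using v by (simp add: U_def)
qed

end

section \<open>Ideals generated by regular sequences of quadrics\<close>

interpretation mp: vector_space "\<lambda>(a::'a::field) (p::'a mpoly). mconst a * p"
  by unfold_locales (auto simp: algebra_simps mconst_add mconst_mult)

lemma hasdim_monomials:
  assumes "finite M"
  shows "mp.hasdim {p::'a::field mpoly. Poly_Mapping.keys p \<subseteq> M} (card M)"
proof -
  let ?s = "\<lambda>m. Poly_Mapping.single m (1::'a)"
  have inj: "inj_on ?s M" by (rule inj_onI) (metis keys_single singleton_inject zero_neq_one)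
  have ind: "mp.independent (?s ` M)"
  proof (rule mp.independent_if_scalars_zero)
    fix h x assume h: "(\<Sum>x\<in>?s ` M. mconst (h x) * x) = 0" and x: "x \<in> ?s ` M"
    obtain m where m: "m \<in> M" "x = ?s m" using x by blast
    have "(\<Sum>m\<in>M. Poly_Mapping.single m (h (?s m))) = 0"
      using h by (simp add: sum.reindex[OF inj] mconst_mult_single)
    then have "Poly_Mapping.lookup (\<Sum>m\<in>M. Poly_Mapping.single m (h (?s m))) m = 0" by simp
    then show "h x = 0" using m by (simp add: lookup_sum_single[OF assms])
  qed (use assms in simp)
  have "mp.span (?s ` M) = {p. Poly_Mapping.keys p \<subseteq> M}"
  proof (intro equalityI subsetI)
    have "mp.subspace {p::'a mpoly. Poly_Mapping.keys p \<subseteq> M}"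
    proof -
      have "{p::'a mpoly. Poly_Mapping.keys p \<subseteq> M} = {p. \<forall>m. m \<notin> M \<longrightarrow> Poly_Mapping.lookup p m = 0}"
        by (auto simp: in_keys_iff subset_iff)
      then show ?thesis unfolding mp.subspace_def by (simp add: lookup_add lookup_mconst_mult)
    qed
    then have "mp.span (?s ` M) \<subseteq> {p. Poly_Mapping.keys p \<subseteq> M}"
      by (intro mp.span_minimal) auto
    then show "x \<in> mp.span (?s ` M) \<Longrightarrow> x \<in> {p. Poly_Mapping.keys p \<subseteq> M}" for x by blast
  next
    fix p :: "'a mpoly" assume p: "p \<in> {p. Poly_Mapping.keys p \<subseteq> M}"
    have "(\<Sum>m\<in>Poly_Mapping.keys p. mconst (Poly_Mapping.lookup p m) * ?s m) \<in> mp.span (?s ` M)"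
      using p by (intro mp.span_sum mp.span_scale mp.span_base) auto
    then show "p \<in> mp.span (?s ` M)"
      using poly_eq_sum_single[of p] by (simp add: mconst_mult_single)
  qed
  then show ?thesis using ind assms card_image[OF inj] unfolding mp.hasdim_def
    by (intro exI[of _ "?s ` M"]) simp
qed

lemma hasdim_hom: "mp.hasdim (homogeneous_part n d :: 'a::field mpoly set) (card (mons n d))"
proof -
  have "homogeneous_part n d = {p :: 'a mpoly. Poly_Mapping.keys p \<subseteq> mons n d}"
    by (auto simp: homogeneous_part_iff)
  then show ?thesis using hasdim_monomials[OF finite_mons[of n d]] by simp
qed

lemma linear_mult: "Vector_Spaces.linear (\<lambda>(a::'a::field) (p::'a mpoly). mconst a * p) (\<lambda>a p. mconst a * p) (\<lambda>p. q * p)"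
  by unfold_locales (auto simp: algebra_simps)

text \<open>The coefficients \<open>g i\<close> range over the whole type and may involve foreign
  variables, which spares carrier conditions. For quadrics, \<open>genideal_eq\<close> shows that
  intersecting with the carrier gives back the ideal generated in the polynomial ring.\<close>

definition gen_ideal :: "(nat \<Rightarrow> 'a::comm_ring_1 mpoly) \<Rightarrow> nat \<Rightarrow> 'a mpoly set" where
  "gen_ideal f k = range (\<lambda>g. \<Sum>i = 1..k. g i * f i)"

lemma gen_ideal_0 [simp]: "gen_ideal f 0 = {0}" by (simp add: gen_ideal_def)

lemma gen_ideal_zero [simp]: "0 \<in> gen_ideal f k"
  unfolding gen_ideal_def by (rule range_eqI[of _ _ "\<lambda>_. 0"]) simp
lemma gen_ideal_add: "p \<in> gen_ideal f k \<Longrightarrow> q \<in> gen_ideal f k \<Longrightarrow> p + q \<in> gen_ideal f k"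
  unfolding gen_ideal_def by (auto simp: sum.distrib[symmetric] ring_distribs(2)[symmetric])
lemma gen_ideal_mult: "p \<in> gen_ideal f k \<Longrightarrow> r * p \<in> gen_ideal f k"
  unfolding gen_ideal_def by (auto simp: sum_distrib_left mult.assoc[symmetric])
lemma gen_ideal_diff: "p \<in> gen_ideal f k \<Longrightarrow> q \<in> gen_ideal f k \<Longrightarrow> p - q \<in> gen_ideal f k"
  using gen_ideal_add[of p f k "-1 * q"] gen_ideal_mult[of q f k "-1"] by simp
lemma gen_ideal_gen: "i \<in> {1..k} \<Longrightarrow> f i \<in> gen_ideal f k"
  unfolding gen_ideal_def
  by (rule range_eqI[of _ _ "\<lambda>j. if j = i then 1 else 0"]) (simp add: if_distrib[of "\<lambda>x. x * _"] cong: if_cong)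

lemma gen_ideal_Suc: "gen_ideal f (Suc k) = {s + f (Suc k) * v |s v. s \<in> gen_ideal f k}"
proof (intro equalityI subsetI)
  fix x assume "x \<in> gen_ideal f (Suc k)"
  then obtain g where "x = (\<Sum>i = 1..Suc k. g i * f i)" by (auto simp: gen_ideal_def)
  then have "x = (\<Sum>i = 1..k. g i * f i) + f (Suc k) * g (Suc k)" by (simp add: mult.commute)
  then show "x \<in> {s + f (Suc k) * v |s v. s \<in> gen_ideal f k}" by (auto simp: gen_ideal_def)
next
  fix x assume "x \<in> {s + f (Suc k) * v |s v. s \<in> gen_ideal f k}"
  then obtain g v where x: "x = (\<Sum>i = 1..k. g i * f i) + f (Suc k) * v" by (auto simp: gen_ideal_def)
  have "x = (\<Sum>i = 1..Suc k. (if i = Suc k then v else g i) * f i)"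
    unfolding x by (simp add: mult.commute)
  then show "x \<in> gen_ideal f (Suc k)"
    unfolding gen_ideal_def by (rule range_eqI[where x = "\<lambda>i. if i = Suc k then v else g i"])
qed

lemma proj_gen_ideal:
  assumes f: "\<And>i. i \<in> {1..k} \<Longrightarrow> f i \<in> homogeneous_part n 2" and p: "p \<in> gen_ideal f k"
  shows "proj n d p \<in> gen_ideal f k"
proof -
  obtain g where g: "p = (\<Sum>i = 1..k. g i * f i)" using p by (auto simp: gen_ideal_def)
  show ?thesis
  proof (cases "d < 2")
    case True
    then have "proj n d p = 0" unfolding g proj_sum
      by (intro sum.neutral ballI proj_mult_low[OF f]) auto
    then show ?thesis by simp
  next
    case False
    then obtain e where d: "d = e + 2" using le_Suc_ex[of 2 d] by (auto simp: add.commute)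
    have "proj n d p = (\<Sum>i = 1..k. proj n e (g i) * f i)" unfolding g proj_sum d
      by (intro sum.cong refl proj_mult[OF f])
    then show ?thesis unfolding gen_ideal_def by (rule range_eqI[where x = "\<lambda>i. proj n e (g i)"])
  qed
qed

text \<open>Combinations of quadrics have no terms below degree 2. Contradictions with regularity
  are later reached through this bound.\<close>

lemma gen_ideal_low:
  assumes f: "\<And>i. i \<in> {1..k} \<Longrightarrow> f i \<in> homogeneous_part n 2"
    and p: "p \<in> gen_ideal f k" "p \<in> homogeneous_part n d" "d < 2"
  shows "p = 0"
proof -
  obtain g where g: "p = (\<Sum>i = 1..k. g i * f i)" using p by (auto simp: gen_ideal_def)
  have "proj n d p = 0" unfolding g proj_sum
    by (intro sum.neutral ballI proj_mult_low[OF f]) (use p in auto)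
  then show ?thesis using proj_id[OF p(2)] by simp
qed

text \<open>These are the monomials of degree \<open>d\<close> in the ideal of the squares of x_1,
  ..., x_k, the model with which dimensions are compared.\<close>

definition nonsquarefree :: "nat \<Rightarrow> nat \<Rightarrow> nat \<Rightarrow> (nat \<Rightarrow>\<^sub>0 nat) set" where
  "nonsquarefree n k d = {m \<in> mons n d. \<exists>i\<in>{1..k}. 2 \<le> Poly_Mapping.lookup m i}"

lemma nonsquarefree_sub: "nonsquarefree n k d \<subseteq> mons n d" by (auto simp: nonsquarefree_def)
lemma finite_nonsquarefree [simp]: "finite (nonsquarefree n k d)"
  using finite_subset[OF nonsquarefree_sub finite_mons] .

text \<open>The monomials that enter with the index \<open>Suc k\<close> are the square of that
  variable times a monomial of degree \<open>d\<close> outside \<open>nonsquarefree n k d\<close>,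
  each obtained once.\<close>

lemma card_nonsquarefree_Suc:
  assumes "k < n"
  shows "card (nonsquarefree n (Suc k) (d + 2)) =
    card (nonsquarefree n k (d + 2)) + (card (mons n d) - card (nonsquarefree n k d))"
proof -
  let ?e = "Poly_Mapping.single (Suc k) (2::nat)"
  let ?S = "(\<lambda>m. m + ?e) ` (mons n d - nonsquarefree n k d)"
  have e: "?e \<in> mons n 2" using assms by (simp add: mons_def lookup_single when_def)
  have eq: "nonsquarefree n (Suc k) (d + 2) = nonsquarefree n k (d + 2) \<union> ?S"
  proof (intro equalityI subsetI)
    fix m assume m: "m \<in> nonsquarefree n (Suc k) (d + 2)"
    show "m \<in> nonsquarefree n k (d + 2) \<union> ?S"
    proof (cases "m \<in> nonsquarefree n k (d + 2)")
      case False
      then have lt: "\<not> 2 \<le> Poly_Mapping.lookup m i" if "i \<in> {1..k}" for i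
        using m that by (auto simp: nonsquarefree_def)
      have 2: "2 \<le> Poly_Mapping.lookup m (Suc k)"
        using m lt by (auto simp: nonsquarefree_def atLeastAtMostSuc_conv)
      define m' where "m' = m - ?e"
      have m': "m = m' + ?e"
        using 2 by (intro poly_mapping_eqI) (auto simp: m'_def lookup_add lookup_minus lookup_single when_def)
      have "m' \<in> mons n d" using m mons_add_iff[OF e] by (auto simp: nonsquarefree_def m')
      moreover have "m' \<notin> nonsquarefree n k d"
      proof
        assume "m' \<in> nonsquarefree n k d"
        then obtain i where "i \<in> {1..k}" "2 \<le> Poly_Mapping.lookup m' i" by (auto simp: nonsquarefree_def)
        then show False using lt[of i] by (simp add: m' lookup_add)
      qed
      ultimately show ?thesis using m' by auto
    qed simp
  next
    fix m assume "m \<in> nonsquarefree n k (d + 2) \<union> ?S"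
    then show "m \<in> nonsquarefree n (Suc k) (d + 2)"
    proof
      assume "m \<in> ?S"
      then obtain m' where "m' \<in> mons n d" "m = m' + ?e" by auto
      then show ?thesis using mons_add_iff[OF e] by (auto simp: nonsquarefree_def lookup_add intro!: bexI[of _ "Suc k"])
    qed (force simp: nonsquarefree_def)
  qed
  have disj: "nonsquarefree n k (d + 2) \<inter> ?S = {}"
    by (auto simp: nonsquarefree_def lookup_add lookup_single when_def)
  have "card ?S = card (mons n d - nonsquarefree n k d)"
    by (rule card_image) (simp add: inj_on_def)
  also have "\<dots> = card (mons n d) - card (nonsquarefree n k d)"
    by (rule card_Diff_subset) (simp_all add: nonsquarefree_sub)
  finally show ?thesis unfolding eq using card_Un_disjoint[OF _ _ disj] by simp
qed

lemma nonsquarefree_low: "d < 2 \<Longrightarrow> k \<le> n \<Longrightarrow> nonsquarefree n k d = {}"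
proof (rule ccontr)
  assume d: "d < 2" "k \<le> n" and "nonsquarefree n k d \<noteq> {}"
  then obtain m i where m: "m \<in> mons n d" "i \<in> {1..k}" "2 \<le> Poly_Mapping.lookup m i"
    by (auto simp: nonsquarefree_def)
  have "Poly_Mapping.lookup m i \<le> (\<Sum>i = 1..n. Poly_Mapping.lookup m i)"
    using m(2) d(2) by (intro member_le_sum) auto
  then show False using m d by (simp add: mons_def)
qed

lemma hasdim_zero: "mp.hasdim {0::'a::field mpoly} 0"
  unfolding mp.hasdim_def by (rule exI[of _ "{}"]) (simp add: mp.dependent_def)

text \<open>The dimension recursion along a regular sequence is the one satisfied by the ideal
  \<open>(x\<^sub>1\<^sup>2, \<dots>, x\<^sub>k\<^sup>2)\<close>, whose graded pieces are spanned by monomials.\<close>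

lemma hasdim_gen_ideal:
  fixes f :: "nat \<Rightarrow> 'a::field mpoly"
  assumes f: "\<And>i. i \<in> {1..n} \<Longrightarrow> f i \<in> homogeneous_part n 2"
    and reg: "\<And>k g. k < n \<Longrightarrow> g \<in> carrier (poly_algebra n) \<Longrightarrow> f (Suc k) * g \<in> gen_ideal f k \<Longrightarrow> g \<in> gen_ideal f k"
    and k: "k \<le> n"
  shows "mp.hasdim (gen_ideal f k \<inter> homogeneous_part n d) (card (nonsquarefree n k d))"
  using k
proof (induction k arbitrary: d)
  case 0
  have "{0} \<inter> homogeneous_part n d = {0 :: 'a mpoly}" by auto
  then show ?case using hasdim_zero by (simp add: nonsquarefree_def)
next
  case (Suc k)
  have fk: "f i \<in> homogeneous_part n 2" if "i \<in> {1..Suc k}" for i using f that Suc.prems by auto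
  show ?case
  proof (cases "d < 2")
    case True
    have "gen_ideal f (Suc k) \<inter> homogeneous_part n d = {0}"
      using gen_ideal_low[OF fk _ _ True, of "Suc k"] by auto
    then show ?thesis using hasdim_zero nonsquarefree_low[OF True Suc.prems] by simp
  next
    case False
    then obtain e where d: "d = e + 2" using le_Suc_ex[of 2 d] by (auto simp: add.commute)
    let ?S = "gen_ideal f k \<inter> homogeneous_part n (e + 2)"
    let ?U = "gen_ideal f k \<inter> homogeneous_part n e"
    have fS: "f (Suc k) \<in> homogeneous_part n 2" using fk by simp
    have hf: "f (Suc k) * v \<in> homogeneous_part n (e + 2)" if "v \<in> homogeneous_part n e" for v
      using hom_mult[OF that fS] by (simp add: mult.commute)
    \<comment> \<open>Regularity enters here: the kernel of multiplication by
      \<open>f (Suc k)\<close> modulo the previous ideal is that ideal itself.\<close>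
    have U: "?U = {v \<in> homogeneous_part n e. f (Suc k) * v \<in> ?S}"
    proof (intro equalityI subsetI)
      fix v assume "v \<in> ?U"
      then show "v \<in> {v \<in> homogeneous_part n e. f (Suc k) * v \<in> ?S}"
        using hf gen_ideal_mult by blast
    next
      fix v assume v: "v \<in> {v \<in> homogeneous_part n e. f (Suc k) * v \<in> ?S}"
      then have "v \<in> gen_ideal f k" using reg[of k v] hom_carrier[of v n e] Suc.prems by simp
      then show "v \<in> ?U" using v by simp
    qed
    have EQ: "{s + f (Suc k) * v |s v. s \<in> ?S \<and> v \<in> homogeneous_part n e} = gen_ideal f (Suc k) \<inter> homogeneous_part n d"
    proof (intro equalityI subsetI)
      fix x assume "x \<in> {s + f (Suc k) * v |s v. s \<in> ?S \<and> v \<in> homogeneous_part n e}"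
      then show "x \<in> gen_ideal f (Suc k) \<inter> homogeneous_part n d"
        unfolding gen_ideal_Suc d using hf hom_add by auto
    next
      fix x assume x: "x \<in> gen_ideal f (Suc k) \<inter> homogeneous_part n d"
      then obtain s v where sv: "x = s + v * f (Suc k)" "s \<in> gen_ideal f k"
        unfolding gen_ideal_Suc by (auto simp: mult.commute)
      have "x = proj n d s + proj n e v * f (Suc k)"
        using x proj_id[of x n d] proj_mult[OF fS, of e v] unfolding sv(1) d by (simp add: proj_add)
      moreover have "proj n d s \<in> gen_ideal f k"
        using fk by (intro proj_gen_ideal sv) auto
      ultimately show "x \<in> {s + f (Suc k) * v |s v. s \<in> ?S \<and> v \<in> homogeneous_part n e}"
        unfolding d by (intro CollectI exI[of _ "proj n (e + 2) s"] exI[of _ "proj n e v"]) (simp add: mult.commute)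
    qed
    have IH: "mp.hasdim ?S (card (nonsquarefree n k (e + 2)))" "mp.hasdim ?U (card (nonsquarefree n k e))"
      using Suc by auto
    have "mp.hasdim (gen_ideal f (Suc k) \<inter> homogeneous_part n d)
        (card (nonsquarefree n k (e + 2)) + (card (mons n e) - card (nonsquarefree n k e)))"
      using mp.hasdim_sum_image[OF linear_mult IH(1) hasdim_hom IH(2) U] unfolding EQ by blast
    then show ?thesis
      using card_nonsquarefree_Suc[of k n e] Suc.prems by (simp only: d Suc_le_eq)
  qed
qed

text \<open>A monomial with all exponents below 2 is determined by its support. Together with
  \<open>hasdim_gen_ideal\<close> this gives the dimensions of the graded pieces of the
  quotient.\<close>

lemma card_squarefree: "card (mons n d) - card (nonsquarefree n n d) = n choose d"
proof -
  have "card (mons n d) - card (nonsquarefree n n d) = card (mons n d - nonsquarefree n n d)"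
    by (rule card_Diff_subset[symmetric]) (simp_all add: nonsquarefree_sub)
  also have "\<dots> = card {S. S \<subseteq> {1..n} \<and> card S = d}"
  proof (rule bij_betw_same_card[of Poly_Mapping.keys], unfold bij_betw_def, intro conjI)
    let ?M = "mons n d - nonsquarefree n n d"
    have val: "Poly_Mapping.lookup m i = (if i \<in> Poly_Mapping.keys m then 1 else 0)" if "m \<in> ?M" for m i
    proof (cases "i \<in> {1..n}")
      case True
      with that have "Poly_Mapping.lookup m i < 2" by (auto simp: nonsquarefree_def not_le)
      then show ?thesis by (auto simp: in_keys_iff)
    next
      case False
      with that have "i \<notin> Poly_Mapping.keys m" by (auto simp: mons_def)
      then show ?thesis by (simp add: in_keys_iff)
    qed
    show "inj_on Poly_Mapping.keys ?M"
      by (rule inj_onI, rule poly_mapping_eqI) (simp add: val)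
    show "Poly_Mapping.keys ` ?M = {S. S \<subseteq> {1..n} \<and> card S = d}"
    proof (intro equalityI subsetI)
      fix S assume "S \<in> Poly_Mapping.keys ` ?M"
      then obtain m where m: "m \<in> ?M" "S = Poly_Mapping.keys m" by blast
      have sub: "S \<subseteq> {1..n}" using m by (auto simp: mons_def)
      have "d = (\<Sum>i = 1..n. if i \<in> S then 1 else 0)"
        using m val[OF m(1)] by (simp add: mons_def)
      also have "\<dots> = card S" using sub by (simp add: sum.If_cases Int_absorb1)
      finally show "S \<in> {S. S \<subseteq> {1..n} \<and> card S = d}" using sub by simp
    next
      fix S assume "S \<in> {S. S \<subseteq> {1..n} \<and> card S = d}"
      then have S: "S \<subseteq> {1..n}" "card S = d" by auto
      then have fin: "finite S" using finite_subset by blast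
      define m where "m = (\<Sum>i\<in>S. Poly_Mapping.single i (1::nat))"
      have l: "Poly_Mapping.lookup m i = (if i \<in> S then 1 else 0)" for i
        unfolding m_def by (rule lookup_sum_single[OF fin])
      have k: "Poly_Mapping.keys m = S" by (auto simp: in_keys_iff l split: if_splits)
      have "(\<Sum>i = 1..n. Poly_Mapping.lookup m i) = card S"
        using S by (simp add: l sum.If_cases Int_absorb1)
      then have "m \<in> ?M" using S by (simp add: mons_def nonsquarefree_def k l)
      then show "S \<in> Poly_Mapping.keys ` ?M" using k by blast
    qed
  qed
  also have "\<dots> = n choose d" using n_subsets[of "{1..n}" d] by simp
  finally show ?thesis .
qed

section \<open>Straightening products of elements with a common square\<close>

text \<open>If \<open>t = r\<^sup>2\<close>, then \<open>Qp m z t\<close> is the product of \<open>z - (m - 2 * j) * r\<close> over \<open>j = 0, \<dots>, m\<close>; the zeros are the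
  values of a sum of \<open>m\<close> square roots of \<open>t\<close>.\<close>

fun Qp :: "nat \<Rightarrow> 'r::comm_ring_1 \<Rightarrow> 'r \<Rightarrow> 'r" where
  "Qp 0 z t = z"
| "Qp (Suc 0) z t = z * z - t"
| "Qp (Suc (Suc m)) z t = Qp m z t * (z * z - of_nat (m + 2) * of_nat (m + 2) * t)"

text \<open>For y = r with \<open>t\<close> = r^2, shifting the zeros (m + 1 - 2j) r of
  \<open>Qp (Suc m)\<close> by r yields the zeros of \<open>Qp m\<close> and the additional zero -
  (m + 2) r. The identity states this modulo \<open>y * y - t\<close>, so it covers both signs of
  the root.\<close>

lemma Qp_add:
  fixes z y t :: "'r::comm_ring_1"
  shows "\<exists>c. Qp (Suc m) (z + y) t = Qp m z t * (z + of_nat (m + 2) * y) + c * (y * y - t)"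
proof (induction m z t rule: Qp.induct)
  case (1 z t)
  show ?case by (rule exI[of _ 1]) (simp add: algebra_simps)
next
  case (2 z t)
  have 3: "of_nat 3 = (3::'r)" by simp
  show ?case by (rule exI[of _ "3 * z + y"]) (simp add: algebra_simps)
next
  case (3 m z t)
  then obtain c where c: "Qp (Suc m) (z + y) t = Qp m z t * (z + of_nat (m + 2) * y) + c * (y * y - t)" by blast
  define a :: 'r where "a = of_nat m"
  define d where "d = (z + y) * (z + y) - (a + 3) * (a + 3) * t"
  have num: "of_nat (m + 2) = a + 2" "of_nat (Suc m + 2) = a + 3" "of_nat (Suc (Suc m) + 2) = a + 4"
    by (simp_all add: a_def)
  \<comment> \<open>Modulo \<open>y * y - t\<close> the new factor \<open>d\<close> splits into
    \<open>z - (a + 2) * y\<close> and \<open>z + (a + 4) * y\<close>; the former joins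
    \<open>z + (a + 2) * y\<close> to form the quadratic factor of
    \<open>Qp (Suc (Suc m)) z t\<close>.\<close>
  have "(z + (a + 2) * y) * d = (z * z - (a + 2) * (a + 2) * t) * (z + (a + 4) * y)
      + ((a + 3) * (a + 3) * (z + (a + 2) * y) - (a + 2) * (a + 2) * (z + (a + 4) * y)) * (y * y - t)"
    unfolding d_def by (simp add: algebra_simps)
  moreover have "(P * L + c * S) * d = P * M * N + (P * K + c * d) * S"
    if "L * d = M * N + K * S" for P L S M N K :: 'r
  proof -
    have "(P * L + c * S) * d = P * (L * d) + c * d * S" by (simp add: algebra_simps)
    then show ?thesis unfolding that by (simp add: algebra_simps)
  qed
  ultimately have "Qp (Suc (Suc (Suc m))) (z + y) t = Qp (Suc (Suc m)) z t * (z + (a + 4) * y)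
     + (Qp m z t * ((a + 3) * (a + 3) * (z + (a + 2) * y) - (a + 2) * (a + 2) * (z + (a + 4) * y)) + c * d) * (y * y - t)"
    unfolding Qp.simps c num d_def[symmetric] by blast
  then show ?case unfolding num by blast
qed

text \<open>Allows \<open>Qp\<close> to be evaluated at \<open>u\<close> instead of the sum of the
  \<open>y i\<close>, at the cost of a multiple of their difference.\<close>

lemma Qp_diff:
  fixes a b t :: "'r::comm_ring_1"
  shows "\<exists>c. Qp m a t - Qp m b t = c * (a - b)"
proof (induction m a t rule: Qp.induct)
  case (3 m a t)
  then obtain c where "Qp m a t - Qp m b t = c * (a - b)" by blast
  then have c: "Qp m a t = Qp m b t + c * (a - b)" by (simp add: algebra_simps)
  have "Qp (Suc (Suc m)) a t - Qp (Suc (Suc m)) b t =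
     (c * (a * a - of_nat (m + 2) * of_nat (m + 2) * t) + Qp m b t * (a + b)) * (a - b)"
    unfolding Qp.simps c by (simp add: algebra_simps)
  then show ?case by blast
next
  case (2 a t)
  show ?case by (rule exI[of _ "a + b"]) (simp add: algebra_simps)
qed (auto intro: exI[of _ 1])

text \<open>Two instances are used. In the nondegenerate case \<open>t\<close> and \<open>u\<close>
  are multiples of \<open>e * e\<close> and \<open>e\<close>, with \<open>B\<close> all indices. In
  the degenerate case \<open>t\<close> is the square of \<open>s = y n\<close>, \<open>B\<close>
  omits \<open>n\<close>, and \<open>u\<close> is \<open>mconst \<mu> * e - s\<close>.\<close>

locale square_system =
  fixes J :: "'r::comm_ring_1 set" and y :: "nat \<Rightarrow> 'r" and B :: "nat set" and t u :: 'r
  assumes finite_B: "finite B"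
    and J_zero: "0 \<in> J"
    and J_add: "a \<in> J \<Longrightarrow> b \<in> J \<Longrightarrow> a + b \<in> J"
    and J_mult: "a \<in> J \<Longrightarrow> r * a \<in> J"
    and sq: "i \<in> B \<Longrightarrow> y i * y i - t \<in> J"
    and sum_y: "(\<Sum>i\<in>B. y i) - u \<in> J"
begin

lemma J_diff: "a \<in> J \<Longrightarrow> b \<in> J \<Longrightarrow> a - b \<in> J"
  using J_add[of a "-1 * b"] J_mult[of b "-1"] by simp

text \<open>\<open>V\<close> is the set of indices not yet used in a pair.\<close>

inductive pair_product :: "nat \<Rightarrow> 'r \<Rightarrow> nat set \<Rightarrow> bool" where
  pair_product_0: "pair_product 0 1 B"
| pair_product_Suc: "pair_product k w V \<Longrightarrow> a \<in> V \<Longrightarrow> b \<in> V \<Longrightarrow> a \<noteq> b \<Longrightarrow>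
    pair_product (Suc k) ((y a - y b) * w) (V - {a, b})"

lemma pair_product_card: "pair_product k w V \<Longrightarrow> V \<subseteq> B \<and> card V + 2 * k = card B"
proof (induction rule: pair_product.induct)
  case (pair_product_Suc k w V a b)
  then have "finite V" "{a, b} \<subseteq> V" using finite_B finite_subset by auto
  then have "card (V - {a, b}) + 2 = card V"
    using pair_product_Suc card_Diff_subset[of "{a,b}" V] card_mono[of V "{a,b}"] by simp
  then show ?case using pair_product_Suc by auto
qed simp

lemma pair_product_sum: "pair_product k w V \<Longrightarrow> w * ((\<Sum>i\<in>V. y i) - u) \<in> J"
proof (induction rule: pair_product.induct)
  case pair_product_0 then show ?case using sum_y by simp
next
  case (pair_product_Suc k w V a b)
  have V: "V \<subseteq> B" using pair_product_card[OF pair_product_Suc.hyps(1)] by simp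
  then have fin: "finite V" using finite_B by (rule finite_subset)
  have "(\<Sum>i\<in>V. y i) = y a + (y b + (\<Sum>i\<in>V - {a, b}. y i))"
    using sum.remove[OF fin, of a y] sum.remove[of "V - {a}" b y] fin pair_product_Suc.hyps
    by (simp add: Diff_insert2[of V a "{b}"])
  then have "(y a - y b) * w * ((\<Sum>i\<in>V - {a, b}. y i) - u) =
     (y a - y b) * (w * ((\<Sum>i\<in>V. y i) - u)) - w * ((y a * y a - t) - (y b * y b - t))"
    by (simp add: algebra_simps)
  also have "\<dots> \<in> J"
    using pair_product_Suc V by (intro J_diff[OF J_mult J_mult[OF J_diff]] sq) auto
  finally show ?case .
qed

text \<open>Inserting one more square root of \<open>t\<close> multiplies the polynomial by a linear
  factor modulo \<open>J\<close>, by \<open>Qp_add\<close>.\<close>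

lemma Qp_sum: "V \<subseteq> B \<Longrightarrow> Qp (card V) (\<Sum>i\<in>V. y i) t \<in> J"
proof -
  assume V: "V \<subseteq> B"
  then have "finite V" using finite_B finite_subset by blast
  then show ?thesis using V
  proof (induction V rule: finite_induct)
    case empty then show ?case using J_zero by simp
  next
    case (insert a V)
    obtain c where "Qp (Suc (card V)) ((\<Sum>i\<in>V. y i) + y a) t =
        Qp (card V) (\<Sum>i\<in>V. y i) t * ((\<Sum>i\<in>V. y i) + of_nat (card V + 2) * y a) + c * (y a * y a - t)"
      using Qp_add by blast
    also have "\<dots> = ((\<Sum>i\<in>V. y i) + of_nat (card V + 2) * y a) * Qp (card V) (\<Sum>i\<in>V. y i) t + c * (y a * y a - t)"
      by (simp add: mult.commute)
    also have "\<dots> \<in> J" using insert by (intro J_add J_mult sq) auto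
    finally show ?case using insert.hyps by (simp add: add.commute)
  qed
qed

lemma pair_product_Qp:
  assumes "pair_product k w V" shows "w * Qp (card V) u t \<in> J"
proof -
  obtain c where c: "Qp (card V) (\<Sum>i\<in>V. y i) t - Qp (card V) u t = c * ((\<Sum>i\<in>V. y i) - u)"
    using Qp_diff by blast
  have "w * Qp (card V) u t = w * Qp (card V) (\<Sum>i\<in>V. y i) t - w * (Qp (card V) (\<Sum>i\<in>V. y i) t - Qp (card V) u t)"
    by (simp add: algebra_simps)
  also have "\<dots> = w * Qp (card V) (\<Sum>i\<in>V. y i) t - c * (w * ((\<Sum>i\<in>V. y i) - u))"
    unfolding c by (simp add: algebra_simps)
  also have "\<dots> \<in> J"
    using pair_product_card[OF assms] by (intro J_diff[OF J_mult J_mult[OF pair_product_sum[OF assms]]] Qp_sum) simp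
  finally show ?thesis .
qed

end

text \<open>\<open>F d\<close> stands for the elements of degree \<open>d\<close> that have the
  desired normal form, which differs between the two cases. Closure under multiplication by single
  \<open>y i\<close> is not among the assumptions; only products of generators will be shown to lie
  in \<open>F\<close>. The division rule \<open>F_div\<close> is what averaging requires.\<close>

locale square_family = square_system J y B t u
  for J :: "'r::comm_ring_1 set" and y :: "nat \<Rightarrow> 'r" and B :: "nat set" and t u :: 'r +
  fixes F :: "nat \<Rightarrow> 'r set" and E :: "'r set"
  assumes F_add: "a \<in> F d \<Longrightarrow> b \<in> F d \<Longrightarrow> a + b \<in> F d"
    and F_diff: "a \<in> F d \<Longrightarrow> b \<in> F d \<Longrightarrow> a - b \<in> F d"
    and F_div: "of_nat (Suc c) * a \<in> F d \<Longrightarrow> a \<in> F d"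
    and F_J: "a \<in> J \<Longrightarrow> a \<in> F d"
    and F_t: "a \<in> F d \<Longrightarrow> t * a \<in> F (Suc (Suc d))"
    and F_u: "a \<in> F d \<Longrightarrow> u * a \<in> F (Suc d)"
    and F_E: "e \<in> E \<Longrightarrow> a \<in> F d \<Longrightarrow> e * a \<in> F (Suc d)"
    and F_pair_product: "pair_product k w V \<Longrightarrow> w \<in> F k"
begin

lemma F_sum: "(\<And>i. i \<in> S \<Longrightarrow> g i \<in> F d) \<Longrightarrow> sum g S \<in> F d"
  by (induction S rule: infinite_finite_induct) (auto simp: F_add F_J J_zero)

lemma F_cong: "a - b \<in> J \<Longrightarrow> b \<in> F d \<Longrightarrow> a \<in> F d"
  using F_add[of "a - b" d b] F_J by simp

text \<open>Exchanging one index of \<open>T\<close> for another index of \<open>V\<close> changes \<open>w * (\<Prod>i\<in>T. y i)\<close> by an element with one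
  more pair and a shorter product. Averaging over all exchanges turns the sum of the \<open>y i\<close> into \<open>u\<close>.\<close>

lemma straighten:
  "pair_product k w V \<Longrightarrow> T \<subseteq> V \<Longrightarrow> w * (\<Prod>i\<in>T. y i) \<in> F (k + card T)"
proof (induction "card T" arbitrary: k w V T rule: less_induct)
  case less
  have fin: "finite V" "finite T" "V \<subseteq> B"
    using pair_product_card less.prems finite_B finite_subset by metis+
  show ?case
  proof (cases "T = {}")
    case True
    then show ?thesis using F_pair_product less.prems by simp
  next
    case False
    then obtain a where a: "a \<in> T" by blast
    define T0 where "T0 = T - {a}"
    let ?P = "\<lambda>S. \<Prod>i\<in>S. y i"
    have T: "T = insert a T0" "a \<notin> T0" "finite T0" "card T = Suc (card T0)"
      using a fin card_Suc_Diff1[OF fin(2) a] by (auto simp: T0_def)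
    \<comment> \<open>The index \<open>b\<close> ranges over all possible replacements of
      \<open>a\<close>, including \<open>a\<close> itself, where the difference is 0. For another
      \<open>b\<close> the factor \<open>y b - y a\<close> opens a new pair disjoint from
      \<open>T0\<close>.\<close>
    have "b \<in> V - T0 \<Longrightarrow> w * ?P T0 * y b - w * ?P T \<in> F (k + card T)" for b
    proof (cases "b = a")
      case True
      then show ?thesis using T F_J J_zero by (simp add: mult_ac)
    next
      case False
      assume b: "b \<in> V - T0"
      have pp: "pair_product (Suc k) ((y b - y a) * w) (V - {b, a})"
        using b a False less.prems by (intro pair_product_Suc) auto
      have "(y b - y a) * w * ?P T0 \<in> F (Suc k + card T0)"
        using T b less.prems by (intro less.hyps[OF _ pp]) auto
      moreover have "w * ?P T0 * y b - w * ?P T = (y b - y a) * w * ?P T0"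
        using T by (simp add: algebra_simps)
      ultimately show ?thesis using T by simp
    qed
    then have A: "(\<Sum>b\<in>V - T0. w * ?P T0 * y b - w * ?P T) \<in> F (k + card T)"
      by (rule F_sum)
    \<comment> \<open>For \<open>b\<close> in \<open>T0\<close> a square arises; replacing it by
      \<open>t\<close> leaves a product with two indices fewer than \<open>T\<close>.\<close>
    have "w * ?P T0 * y b \<in> F (k + card T)" if b: "b \<in> T0" for b
    proof -
      have T0: "?P T0 = y b * ?P (T0 - {b})" "card T = Suc (Suc (card (T0 - {b})))"
        using T card_Suc_Diff1[OF T(3) b] prod.remove[OF T(3) b, of y] by auto
      have "w * ?P (T0 - {b}) \<in> F (k + card (T0 - {b}))"
        using T0 less.prems T by (intro less.hyps[OF _ less.prems(1)]) auto
      from F_t[OF this] have "t * (w * ?P (T0 - {b})) \<in> F (k + card T)" using T0 by simp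
      moreover have "w * ?P T0 * y b - t * (w * ?P (T0 - {b})) \<in> J"
      proof -
        have "w * ?P T0 * y b - t * (w * ?P (T0 - {b})) = w * ?P (T0 - {b}) * (y b * y b - t)"
          unfolding T0(1) by (simp add: algebra_simps)
        then show ?thesis using J_mult sq b T less.prems fin by auto
      qed
      ultimately show ?thesis using F_cong by blast
    qed
    then have B: "(\<Sum>b\<in>T0. w * ?P T0 * y b) \<in> F (k + card T)" by (rule F_sum)
    have C: "w * ?P T0 * (\<Sum>b\<in>V. y b) \<in> F (k + card T)"
    proof -
      have "w * ?P T0 \<in> F (k + card T0)"
        using T less.prems by (intro less.hyps[OF _ less.prems(1)]) auto
      from F_u[OF this] have "u * (w * ?P T0) \<in> F (k + card T)" using T by simp
      moreover have "w * ?P T0 * (\<Sum>b\<in>V. y b) - u * (w * ?P T0) \<in> J"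
        using J_mult[OF pair_product_sum[OF less.prems(1)], of "?P T0"] by (simp add: algebra_simps)
      ultimately show ?thesis using F_cong by blast
    qed
    have sub: "T0 \<subseteq> V" "a \<in> V - T0" using T less.prems by auto
    then have "0 < card (V - T0)" using fin by (auto simp: card_gt_0_iff)
    \<comment> \<open>The number of exchanges is positive because \<open>a\<close> is one of them;
      it is the integer cancelled by \<open>F_div\<close> at the end.\<close>
    then obtain c where c: "card (V - T0) = Suc c" using gr0_implies_Suc by blast
    have "(\<Sum>b\<in>V. y b) = (\<Sum>b\<in>V - T0. y b) + (\<Sum>b\<in>T0. y b)"
      using sum.subset_diff[OF sub(1) fin(1)] .
    then have "of_nat (Suc c) * (w * ?P T) =
      w * ?P T0 * (\<Sum>b\<in>V. y b) - (\<Sum>b\<in>T0. w * ?P T0 * y b) - (\<Sum>b\<in>V - T0. w * ?P T0 * y b - w * ?P T)"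
      unfolding sum_subtractf sum_distrib_left[symmetric] by (simp add: c algebra_simps)
    also have "\<dots> \<in> F (k + card T)" using A B C by (intro F_diff)
    finally show ?thesis by (rule F_div)
  qed
qed

text \<open>The set \<open>S\<close> accumulates the squarefree part read so far. A generator
  \<open>y j\<close> with \<open>j\<close> already in \<open>S\<close> produces a square, which
  becomes \<open>t\<close> and removes \<open>j\<close> from \<open>S\<close>; once the list is
  empty, \<open>straighten\<close> applies.\<close>

lemma prod_list_mem_F:
  "set ws \<subseteq> y ` B \<union> E \<Longrightarrow> S \<subseteq> B \<Longrightarrow> prod_list ws * (\<Prod>i\<in>S. y i) \<in> F (length ws + card S)"
proof (induction ws arbitrary: S)
  case Nil
  then show ?case using straighten[OF pair_product_0, of S] by simp
next
  case (Cons g ws)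
  have finS: "finite S" using Cons.prems finite_B finite_subset by blast
  show ?case
  proof (cases "g \<in> E")
    case True
    have "g * (prod_list ws * (\<Prod>i\<in>S. y i)) \<in> F (Suc (length ws + card S))"
      using Cons True by (intro F_E) auto
    then show ?thesis by (simp add: mult.assoc)
  next
    case False
    then obtain j where j: "j \<in> B" "g = y j" using Cons.prems by auto
    show ?thesis
    proof (cases "j \<in> S")
      case False
      have "prod_list ws * (\<Prod>i\<in>insert j S. y i) \<in> F (length ws + card (insert j S))"
        using Cons j by (intro Cons.IH) auto
      then show ?thesis using False finS j by (simp add: mult_ac)
    next
      case True
      have S: "(\<Prod>i\<in>S. y i) = y j * (\<Prod>i\<in>S - {j}. y i)" "card S = Suc (card (S - {j}))"
        using card_Suc_Diff1[OF finS True] prod.remove[OF finS True, of y] by auto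
      let ?p = "prod_list ws * (\<Prod>i\<in>S - {j}. y i)"
      have "?p \<in> F (length ws + card (S - {j}))"
        using Cons by (intro Cons.IH) auto
      from F_t[OF this] have "t * ?p \<in> F (length (g # ws) + card S)" using S by simp
      moreover have "prod_list (g # ws) * (\<Prod>i\<in>S. y i) - t * ?p = ?p * (y j * y j - t)"
        unfolding S(1) by (simp add: j algebra_simps)
      ultimately show ?thesis using F_cong J_mult[OF sq[OF j(1)], of ?p] by metis
    qed
  qed
qed

end

section \<open>Evaluation of polynomials\<close>

text \<open>The coefficient map \<open>h\<close> is present because common zeros of the quadrics are
  constructed in an algebraic closure.\<close>

definition meval :: "('a::comm_ring_1 \<Rightarrow> 'b::comm_ring_1) \<Rightarrow> (nat \<Rightarrow> 'b) \<Rightarrow> 'a mpoly \<Rightarrow> 'b" where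
  "meval h g p = (\<Sum>m\<in>Poly_Mapping.keys p. h (Poly_Mapping.lookup p m) *
     (\<Prod>i\<in>Poly_Mapping.keys m. g i ^ Poly_Mapping.lookup m i))"

context
  fixes h :: "'a::comm_ring_1 \<Rightarrow> 'b::comm_ring_1" and g :: "nat \<Rightarrow> 'b"
  assumes h0: "h 0 = 0" and h1: "h 1 = 1"
    and h_add: "\<And>a b. h (a + b) = h a + h b" and h_mult: "\<And>a b. h (a * b) = h a * h b"
begin

lemma meval_superset:
  assumes "finite M" "Poly_Mapping.keys p \<subseteq> M"
  shows "meval h g p = (\<Sum>m\<in>M. h (Poly_Mapping.lookup p m) *
     (\<Prod>i\<in>Poly_Mapping.keys m. g i ^ Poly_Mapping.lookup m i))"
  unfolding meval_def using assms by (intro sum.mono_neutral_left) (auto simp: in_keys_iff h0)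

lemma meval_add: "meval h g (p + q) = meval h g p + meval h g q"
proof -
  let ?M = "Poly_Mapping.keys p \<union> Poly_Mapping.keys q"
  show ?thesis
    unfolding meval_superset[of ?M p, simplified] meval_superset[of ?M q, simplified]
      meval_superset[of ?M "p + q", simplified, OF keys_add]
    by (simp add: lookup_add h_add sum.distrib ring_distribs)
qed

lemma meval_0: "meval h g 0 = 0" by (simp add: meval_def)

lemma meval_sum: "meval h g (sum p S) = (\<Sum>i\<in>S. meval h g (p i))"
  by (induction S rule: infinite_finite_induct) (auto simp: meval_add meval_0)

lemma meval_single: "meval h g (Poly_Mapping.single m a) = h a * (\<Prod>i\<in>Poly_Mapping.keys m. g i ^ Poly_Mapping.lookup m i)"
  using meval_superset[of "{m}" "Poly_Mapping.single m a"] by simp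

lemma monomial_value_add:
  "(\<Prod>i\<in>Poly_Mapping.keys (a + b). g i ^ Poly_Mapping.lookup (a + b) i) =
   (\<Prod>i\<in>Poly_Mapping.keys a. g i ^ Poly_Mapping.lookup a i) *
   (\<Prod>i\<in>Poly_Mapping.keys b. g i ^ Poly_Mapping.lookup (b :: nat \<Rightarrow>\<^sub>0 nat) i)"
proof -
  let ?M = "Poly_Mapping.keys a \<union> Poly_Mapping.keys b"
  have k: "Poly_Mapping.keys (a + b) = ?M" by (auto simp: in_keys_iff lookup_add)
  have "(\<Prod>i\<in>Poly_Mapping.keys c. g i ^ Poly_Mapping.lookup c i) = (\<Prod>i\<in>?M. g i ^ Poly_Mapping.lookup c i)"
    if "c = a \<or> c = b" for c
    using that by (intro prod.mono_neutral_left) (auto simp: in_keys_iff)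
  then show ?thesis unfolding k by (simp add: lookup_add power_add prod.distrib)
qed

lemma meval_mult: "meval h g (p * q) = meval h g p * meval h g q"
proof -
  have "p * q = (\<Sum>m\<in>Poly_Mapping.keys p. \<Sum>m'\<in>Poly_Mapping.keys q.
      Poly_Mapping.single (m + m') (Poly_Mapping.lookup p m * Poly_Mapping.lookup q m'))"
    by (subst poly_eq_sum_single[of p], subst poly_eq_sum_single[of q])
      (simp add: sum_product mult_single)
  then have "meval h g (p * q) = (\<Sum>m\<in>Poly_Mapping.keys p. \<Sum>m'\<in>Poly_Mapping.keys q.
      h (Poly_Mapping.lookup p m * Poly_Mapping.lookup q m') *
      (\<Prod>i\<in>Poly_Mapping.keys (m + m'). g i ^ Poly_Mapping.lookup (m + m') i))"
    by (simp only: meval_sum meval_single)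
  also have "\<dots> = meval h g p * meval h g q"
    unfolding meval_def sum_product monomial_value_add by (simp add: h_mult mult_ac)
  finally show ?thesis .
qed

lemma meval_mvar: "meval h g (mvar i) = g i"
  by (simp add: mvar_def meval_single h1)

lemma meval_mconst: "meval h g (mconst a) = h a"
  by (simp add: mconst_def meval_single)

lemma meval_power: "meval h g (p ^ k) = meval h g p ^ k"
  using meval_mconst[of 1] by (induction k) (auto simp: meval_mult h1)

end

text \<open>With \<open>z\<close> of weight 1 and \<open>t\<close> of weight 2, \<open>Qp m\<close>
  has weight \<open>m + 1\<close>, one for each zero.\<close>

lemma Qp_homogeneous: "Qp m (z * e) (t * (e * e)) = Qp m z t * e ^ Suc m"
  by (induction m z t rule: Qp.induct) (simp_all add: algebra_simps)

lemma Qp_mconst: "Qp m (mconst z) (mconst t) = mconst (Qp m z t)"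
  by (induction m z t rule: Qp.induct)
    (simp_all add: mconst_mult mconst_diff mconst_add mconst_of_nat[symmetric] mconst_numeral del: of_nat_add)

text \<open>The factor gained from \<open>m\<close> to \<open>m + 2\<close> has the two zeros with
  all signs equal; the other zeros are those for \<open>m\<close>, with one sign of each kind
  added.\<close>

lemma Qp_root:
  fixes z r :: "'a::field"
  assumes "Qp m z (r * r) = 0"
  shows "\<exists>a b. a + b = m \<and> z = (of_nat a - of_nat b) * r"
  using assms
proof (induction m z "r * r" rule: Qp.induct)
  case (1 z) then show ?case by simp
next
  case (2 z)
  then have "z = r \<or> z = - r" by (simp add: square_eq_iff)
  then show ?case
    by (elim disjE) (rule exI[of _ 1], rule exI[of _ 0], simp, rule exI[of _ 0], rule exI[of _ 1], simp)
next
  case (3 m z)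
  let ?c = "of_nat (m + 2) :: 'a"
  have "Qp m z (r * r) = 0 \<or> z * z = (?c * r) * (?c * r)"
    using 3 by (auto simp: mult_ac)
  then show ?case
  proof
    assume "Qp m z (r * r) = 0"
    then obtain a b where "a + b = m" "z = (of_nat a - of_nat b) * r" using 3 by blast
    then show ?thesis by (intro exI[of _ "Suc a"] exI[of _ "Suc b"]) simp
  next
    assume "z * z = (?c * r) * (?c * r)"
    then have "z = ?c * r \<or> z = - (?c * r)" by (simp only: square_eq_iff)
    then show ?thesis
    proof
      assume "z = ?c * r"
      then show ?thesis by (intro exI[of _ "m + 2"] exI[of _ 0]) simp
    next
      assume "z = - (?c * r)"
      then show ?thesis by (intro exI[of _ 0] exI[of _ "m + 2"]) (simp add: algebra_simps)
    qed
  qed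
qed

text \<open>For \<open>t = 1\<close> and even \<open>m\<close> the zeros m - 2j are even integers,
  so -1 is not among them in characteristic 0.\<close>

lemma Qp_even_nonzero: "even m \<Longrightarrow> Qp m (-1) (1::'a::field_char_0) \<noteq> 0"
proof (induction m "-1::'a" "1::'a" rule: Qp.induct)
  case (3 m)
  have "(of_nat (m + 2) * of_nat (m + 2) :: 'a) \<noteq> 1"
    by (simp only: of_nat_mult[symmetric] of_nat_eq_1_iff) simp
  then have "(-1) * (-1) - of_nat (m + 2) * of_nat (m + 2) * (1::'a) \<noteq> 0" by simp
  moreover have "Qp m (-1) (1::'a) \<noteq> 0" using 3 by simp
  ultimately show ?case unfolding Qp.simps by (rule no_zero_divisors[rotated])
qed simp_all

text \<open>First-order expansion in \<open>e\<close> around \<open>z = - s\<close>; the constant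
  term is homogeneous in \<open>s\<close>. The coefficient \<open>b\<close> is fixed before
  \<open>e\<close> and \<open>s\<close>, so it depends only on \<open>m\<close> and
  \<open>c\<close>, and a generic scalar can later be chosen to avoid the values it rules
  out.\<close>

lemma Qp_perturb:
  fixes c :: "'a::comm_ring_1"
  shows "\<exists>b::'a. \<forall>e s. \<exists>r. Qp m (mconst c * e - s) (s * s) =
     mconst (Qp m (-1) 1) * s ^ Suc m + mconst b * (e * s ^ m) + r * (e * e)"
proof (induction m rule: induct_nat_012)
  case 0
  show ?case by (rule exI[of _ c]) (auto simp: mconst_uminus intro!: exI[of _ 0])
next
  case 1
  show ?case
    by (rule exI[of _ "- (2 * c)"], intro allI, rule exI[of _ "mconst c * mconst c"])
      (simp add: algebra_simps mconst_uminus mconst_mult mconst_numeral)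
next
  case (ge2 m)
  then obtain b where b: "\<And>e s. \<exists>r. Qp m (mconst c * e - s) (s * s) =
     mconst (Qp m (-1) 1) * s ^ Suc m + mconst b * (e * s ^ m) + r * (e * e)" by blast
  let ?k = "of_nat (m + 2) :: 'a"
  let ?Q = "Qp m (-1) (1::'a)"
  show ?case
  \<comment> \<open>The new coefficient comes from multiplying the expansion for \<open>m\<close> by
    \<open>(1 - k * k) * (s * s) - 2 * C * (e * s)\<close> and collecting the terms linear in
    \<open>e\<close>.\<close>
  proof (intro exI[of _ "b * (1 - ?k * ?k) - 2 * c * ?Q"] allI)
    fix e s :: "'a mpoly"
    obtain r where r: "Qp m (mconst c * e - s) (s * s) =
     mconst ?Q * s ^ Suc m + mconst b * (e * s ^ m) + r * (e * e)" using b by blast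
    define k where "k = mconst ?k"
    have k: "of_nat (m + 2) = k" unfolding k_def by (rule mconst_of_nat[symmetric])
    define C B Q where "C = mconst c" and "B = mconst b" and "Q = mconst ?Q"
    define Z where "Z = C * e - s"
    have Z: "Z * Z - k * k * (s * s) = (1 - k * k) * (s * s) - 2 * C * (e * s) + C * C * (e * e)"
      by (simp add: Z_def algebra_simps)
    have "Qp (Suc (Suc m)) Z (s * s) =
      Q * (1 - k * k) * s ^ Suc (Suc (Suc m)) + (B * (1 - k * k) - 2 * C * Q) * (e * s ^ Suc (Suc m))
      + (Q * s ^ Suc m * (C * C) - 2 * B * C * s ^ Suc m + B * C * C * e * s ^ m
         + r * (Z * Z - k * k * (s * s))) * (e * e)"
    proof -
      have "(Q * s ^ Suc m + B * (e * s ^ m)) * ((1 - k * k) * (s * s) - 2 * C * (e * s) + C * C * (e * e)) =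
        Q * (1 - k * k) * s ^ Suc (Suc (Suc m)) + (B * (1 - k * k) - 2 * C * Q) * (e * s ^ Suc (Suc m))
      + (Q * s ^ Suc m * (C * C) - 2 * B * C * s ^ Suc m + B * C * C * e * s ^ m) * (e * e)"
        by (simp add: algebra_simps)
      moreover have "(A + r * w) * D = T + (c + r * D) * w" if "A * D = T + c * w" for A D T c w :: "'a mpoly"
        by (simp only: ring_distribs that) (simp add: mult_ac add_ac)
      ultimately show ?thesis
        unfolding Qp.simps k r[folded C_def B_def Q_def, folded Z_def] Z by blast
    qed
    moreover have "mconst (Qp (Suc (Suc m)) (-1) (1::'a)) = Q * (1 - k * k)"
      by (simp add: Q_def k_def mconst_mult mconst_diff)
    moreover have "mconst (b * (1 - ?k * ?k) - 2 * c * ?Q) = B * (1 - k * k) - 2 * C * Q"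
      by (simp only: Q_def k_def B_def C_def mconst_mult mconst_diff mconst_numeral mconst_1)
    ultimately show "\<exists>r. Qp (Suc (Suc m)) (mconst c * e - s) (s * s) =
       mconst (Qp (Suc (Suc m)) (-1) 1) * s ^ Suc (Suc (Suc m)) +
       mconst (b * (1 - ?k * ?k) - 2 * c * ?Q) * (e * s ^ Suc (Suc m)) + r * (e * e)"
      unfolding Z_def C_def by metis
  qed
qed

section \<open>Surjectivity of the powers of a linear form\<close>

text \<open>Regularity is represented by its two consequences \<open>J_top\<close> and
  \<open>sum_f\<close>. The former excludes nontrivial common zeros, the latter yields that
  \<open>e * e\<close> lies in \<open>J\<close> in the degenerate case.\<close>

locale symmetric_quadrics =
  fixes n :: nat and f :: "nat \<Rightarrow> 'a::field_char_0 mpoly" and b \<alpha> \<gamma> \<delta> :: 'a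
    and e :: "'a mpoly" and y :: "nat \<Rightarrow> 'a mpoly" and J :: "'a mpoly set"
  defines "e \<equiv> \<Sum>i = 1..n. mvar i" and "y \<equiv> \<lambda>i. mvar i + mconst b * e" and "J \<equiv> gen_ideal f n"
  assumes f_eq: "\<And>i. i \<in> {1..n} \<Longrightarrow>
      f i = mconst \<alpha> * (y i * y i) + mconst \<gamma> * (\<Sum>j = 1..n. y j * y j) + mconst \<delta> * (e * e)"
    and \<alpha>: "\<alpha> \<noteq> 0"
    and J_top: "homogeneous_part n (Suc n) \<subseteq> J"
    and sum_f: "0 < n \<Longrightarrow> (\<Sum>i = 1..n. f i) \<noteq> 0"
begin

definition "\<mu> = 1 + of_nat n * b"

lemma e_hom [intro]: "e \<in> homogeneous_part n 1"
  unfolding e_def by (intro hom_sum hom_mvar)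

lemma y_hom [intro]: "i \<in> {1..n} \<Longrightarrow> y i \<in> homogeneous_part n 1"
  unfolding y_def by (intro hom_add hom_mvar hom_scale e_hom)

lemma sum_y_eq: "(\<Sum>i = 1..n. y i) = mconst \<mu> * e"
proof -
  have "(\<Sum>i = 1..n. y i) = e + of_nat n * (mconst b * e)"
    by (simp add: y_def sum.distrib e_def)
  then show ?thesis by (simp add: \<mu>_def mconst_add mconst_mult mconst_of_nat algebra_simps)
qed

lemmas J_closed = gen_ideal_zero[of f n, folded J_def] gen_ideal_add[of _ f n, folded J_def]
  gen_ideal_mult[of _ f n, folded J_def] gen_ideal_diff[of _ f n, folded J_def]
  gen_ideal_gen[of _ n f, folded J_def]

lemma J_sum: "(\<And>i. i \<in> S \<Longrightarrow> p i \<in> J) \<Longrightarrow> sum p S \<in> J"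
  by (induction S rule: infinite_finite_induct) (auto intro: J_closed)

lemma J_scale_cancel: "a \<noteq> 0 \<Longrightarrow> mconst a * p \<in> J \<Longrightarrow> p \<in> J"
  using J_closed(3)[of "mconst a * p" "mconst (inverse a)"]
  by (simp add: mult.assoc[symmetric] mconst_mult[symmetric])

text \<open>Evaluation at a common zero kills \<open>J\<close>, which contains
  \<open>mvar i ^ Suc n\<close> by \<open>J_top\<close>; a field has no nilpotent elements except
  0.\<close>

lemma no_common_zero:
  fixes h :: "'a \<Rightarrow> 'b::field" and g :: "nat \<Rightarrow> 'b"
  assumes h: "h 0 = 0" "h 1 = 1" "\<And>a b. h (a + b) = h a + h b" "\<And>a b. h (a * b) = h a * h b"
    and zero: "\<And>i. i \<in> {1..n} \<Longrightarrow>
      h \<alpha> * ((g i + h b * (\<Sum>j = 1..n. g j)) * (g i + h b * (\<Sum>j = 1..n. g j)))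
      + h \<gamma> * (\<Sum>k = 1..n. (g k + h b * (\<Sum>j = 1..n. g j)) * (g k + h b * (\<Sum>j = 1..n. g j)))
      + h \<delta> * ((\<Sum>j = 1..n. g j) * (\<Sum>j = 1..n. g j)) = 0"
    and i: "i \<in> {1..n}"
  shows "g i = 0"
proof -
  note ev = meval_add[of h g, OF h] meval_mult[of h g, OF h] meval_sum[of h g, OF h]
    meval_mvar[of h g, OF h] meval_mconst[of h g, OF h] meval_power[of h g, OF h]
  have "meval h g (f j) = 0" if "j \<in> {1..n}" for j
    unfolding f_eq[OF that] using zero[OF that] by (simp add: ev y_def e_def)
  then have J0: "meval h g p = 0" if "p \<in> J" for p
    using that by (auto simp: J_def gen_ideal_def ev intro!: sum.neutral)
  have "mvar i ^ Suc n \<in> homogeneous_part n (Suc n)"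
    using hom_power[OF hom_mvar[OF i], of "Suc n"] by simp
  then have "meval h g (mvar i ^ Suc n) = 0" using J_top J0 by blast
  then show ?thesis by (simp only: ev power_eq_0_iff)
qed

lemma sum_f_eq: "(\<Sum>i = 1..n. f i) =
    mconst (\<alpha> + of_nat n * \<gamma>) * (\<Sum>j = 1..n. y j * y j) + mconst (of_nat n * \<delta>) * (e * e)"
proof -
  have "(\<Sum>i = 1..n. f i) = (\<Sum>i = 1..n. mconst \<alpha> * (y i * y i) + (mconst \<gamma> * (\<Sum>j = 1..n. y j * y j) + mconst \<delta> * (e * e)))"
    by (intro sum.cong) (auto simp: f_eq add.assoc)
  then show ?thesis
    by (simp add: sum.distrib sum_distrib_left[symmetric] mconst_add mconst_mult mconst_of_nat algebra_simps)
qed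

text \<open>Since each variable is \<open>y i - mconst b * e\<close>, a form of degree
  \<open>d\<close> is a combination of products of \<open>d\<close> elements of \<open>W\<close>,
  and those lie in \<open>F d\<close> by \<open>gens\<close>.\<close>

lemma hom_mem_family:
  assumes F_add: "\<And>d p q. p \<in> F d \<Longrightarrow> q \<in> F d \<Longrightarrow> p + q \<in> F d"
    and F_scale: "\<And>d a p. p \<in> F d \<Longrightarrow> mconst a * p \<in> F d"
    and F_zero: "\<And>d. 0 \<in> F d"
    and gens: "\<And>ws. set ws \<subseteq> W \<Longrightarrow> prod_list ws \<in> F (length ws)"
    and W: "e \<in> W" "y ` {1..n} \<subseteq> W"
    and p: "p \<in> homogeneous_part n d"
  shows "p \<in> F d"
proof -
  \<comment> \<open>\<open>F\<close> itself is not known to be closed under multiplication by the \<open>y i\<close>.\<close>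
  define H where "H d = {p. \<forall>ws. set ws \<subseteq> W \<longrightarrow> p * prod_list ws \<in> F (d + length ws)}" for d
  have shift: "g * q \<in> H (Suc d)" if "g \<in> W" "q \<in> H d" for g q d
    unfolding H_def
  proof (intro CollectI allI impI)
    fix ws assume "set ws \<subseteq> W"
    then have "q * prod_list (g # ws) \<in> F (d + length (g # ws))"
      using that unfolding H_def by (intro that(2)[unfolded H_def, THEN CollectD, rule_format]) auto
    then show "g * q * prod_list ws \<in> F (Suc d + length ws)" by (simp add: mult_ac)
  qed
  have add: "p + q \<in> H d" if "p \<in> H d" "q \<in> H d" for p q d
    using that by (simp add: H_def ring_distribs F_add)
  have scale: "mconst a * p \<in> H d" if "p \<in> H d" for a p d
    using that by (simp add: H_def mult.assoc F_scale)
  have "p \<in> H d"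
  proof (rule homogeneous_induct_mult[of H n, OF _ add scale _ p])
    show "1 \<in> H 0" using gens by (simp add: H_def)
    show "mvar i * q \<in> H (Suc d)" if "i \<in> {1..n}" "q \<in> H d" for d i q
    proof -
      have "mvar i * q = y i * q + mconst (- b) * (e * q)"
        by (simp add: y_def mconst_uminus algebra_simps)
      moreover have "y i \<in> W" using that W by auto
      ultimately show ?thesis
        using add[OF shift[OF _ that(2)] scale[OF shift[OF W(1) that(2)]]] by metis
    qed
    show "0 \<in> H d" by (simp add: H_def F_zero)
  qed
  then show ?thesis using H_def[of d] by (auto dest: spec[of _ "[]"])
qed

lemma of_nat_cancel_scale:
  assumes "\<And>a p. p \<in> S \<Longrightarrow> mconst a * p \<in> S" "of_nat (Suc c) * (p :: 'a mpoly) \<in> S" shows "p \<in> S"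
proof -
  have "mconst (inverse (of_nat (Suc c))) * (of_nat (Suc c) * p) = mconst (inverse (of_nat (Suc c)) * of_nat (Suc c)) * p"
    by (simp only: mconst_mult mconst_of_nat mult.assoc)
  also have "\<dots> = p" by (simp del: of_nat_Suc)
  finally show ?thesis using assms(1)[OF assms(2)] by metis
qed

lemma scale_diff:
  assumes "\<And>a p. p \<in> S \<Longrightarrow> mconst a * p \<in> S" "\<And>p q. p \<in> S \<Longrightarrow> q \<in> S \<Longrightarrow> p + q \<in> S"
    "p \<in> S" "q \<in> S" shows "p - q \<in> (S :: 'a mpoly set)"
  using assms(2)[OF assms(3) assms(1)[OF assms(4), of "-1"]] by (simp add: mconst_uminus)

section \<open>Nondegenerate case: every \<open>y i * y i\<close> is the same multiple of
  \<open>e * e\<close> modulo \<open>J\<close>\<close>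

context
  assumes nondeg: "\<alpha> + of_nat n * \<gamma> \<noteq> 0"
begin

text \<open>If all \<open>y j * y j\<close> equal \<kappa> times \<open>e * e\<close>, the vanishing
  of \<open>f i\<close> requires (\<alpha> + n \<gamma>) \<kappa> + \<delta> = 0.\<close>

definition "\<kappa> = - \<delta> / (\<alpha> + of_nat n * \<gamma>)"

lemma y_sq: assumes "i \<in> {1..n}" shows "y i * y i - mconst \<kappa> * (e * e) \<in> J"
proof (rule J_scale_cancel)
  let ?c = "\<alpha> + of_nat n * \<gamma>"
  have "(\<Sum>i = 1..n. f i) \<in> J" by (intro J_sum J_closed)
  \<comment> \<open>In this combination the sum of all squares cancels, leaving only
    \<open>y i * y i\<close> and \<open>e * e\<close>.\<close>
  then have 1: "mconst ?c * f i - mconst \<gamma> * (\<Sum>i = 1..n. f i) \<in> J"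
    using assms by (intro J_closed) 
  have ck: "?c * \<kappa> = - \<delta>" using nondeg by (simp add: \<kappa>_def)
  have "\<alpha> * ?c * \<kappa> = \<alpha> * (- \<delta>)" by (simp only: mult.assoc ck)
  also have "\<dots> = \<gamma> * (of_nat n * \<delta>) - ?c * \<delta>" by (simp add: algebra_simps)
  finally have k: "mconst (\<alpha> * ?c) * mconst \<kappa> = mconst \<gamma> * mconst (of_nat n * \<delta>) - mconst ?c * mconst \<delta>"
    by (simp only: mconst_mult[symmetric] mconst_diff[symmetric])
  have "mconst (\<alpha> * ?c) * (y i * y i - mconst \<kappa> * (e * e)) =
     mconst ?c * (mconst \<alpha> * (y i * y i)) - (mconst (\<alpha> * ?c) * mconst \<kappa>) * (e * e)"
    unfolding mconst_mult[of \<alpha> ?c] by (simp only: right_diff_distrib mult_ac)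
  also have "\<dots> = mconst ?c * f i - mconst \<gamma> * (\<Sum>i = 1..n. f i)"
    unfolding k sum_f_eq f_eq[OF assms] by (simp add: algebra_simps)
  finally show "mconst (\<alpha> * ?c) * (y i * y i - mconst \<kappa> * (e * e)) \<in> J" using 1 by simp
  show "\<alpha> * ?c \<noteq> 0" using \<alpha> nondeg by simp
qed

lemma Qp_nonzero:
  assumes "2 * k \<le> n" shows "Qp (n - 2 * k) \<mu> \<kappa> \<noteq> 0"
proof
  assume Q: "Qp (n - 2 * k) \<mu> \<kappa> = 0"
  \<comment> \<open>The common zero has \<open>e = 1\<close> and \<open>y i = r\<close> or \<open>y i = - r\<close> with suitable signs.\<close>
  obtain r :: "'a alg_closure" where r: "r * r = to_ac \<kappa>"
    using nth_root_exists[of 2 "to_ac \<kappa>"] by (auto simp: power2_eq_square)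
  have "Qp m (to_ac z) (to_ac t) = to_ac (Qp m z t)" for m and z t :: 'a
    by (induction m z t rule: Qp.induct) (simp_all add: to_ac_of_nat[symmetric] del: to_ac_of_nat of_nat_add)
  then have "Qp (n - 2 * k) (to_ac \<mu>) (r * r) = 0" using Q r by simp
  from Qp_root[OF this] obtain p q where pq: "p + q = n - 2 * k" "to_ac \<mu> = (of_nat p - of_nat q) * r" by blast
  \<comment> \<open>The \<open>p + q = n - 2 * k\<close> signs are padded by \<open>k\<close> plus
    and \<open>k\<close> minus signs; this gives \<open>n\<close> signs with the same signed
    sum.\<close>
  define P where "P = p + k"
  have nP: "n - P = q + k" and "P \<le> n" using pq(1) assms by (auto simp: P_def)
  then have P: "P \<le> n" "to_ac \<mu> = (of_nat P - of_nat (n - P)) * r"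
    unfolding nP by (simp_all add: P_def pq(2))
  define s where "s i = (if i \<le> P then r else - r)" for i :: nat
  \<comment> \<open>The variables are shifted so that \<open>e\<close> takes the value 1 and
    \<open>y i\<close> the value \<open>s i\<close>; the former holds because the \<open>s i\<close>
    add up to \<mu> = 1 + n b.\<close>
  define g where "g i = s i - to_ac b" for i
  have "(\<Sum>i = 1..n. s i) = of_nat P * r - of_nat (n - P) * r"
  proof -
    have "{1..n} = {1..P} \<union> {P+1..n}" using P by auto
    then have "(\<Sum>i = 1..n. s i) = (\<Sum>i = 1..P. s i) + (\<Sum>i = P+1..n. s i)"
      by (simp add: sum.union_disjoint)
    also have "(\<Sum>i = 1..P. s i) = (\<Sum>i = 1..P. r)" by (intro sum.cong) (auto simp: s_def)
    also have "(\<Sum>i = P+1..n. s i) = (\<Sum>i = P+1..n. - r)" by (intro sum.cong) (auto simp: s_def)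
    finally show ?thesis by simp
  qed
  then have "(\<Sum>i = 1..n. s i) = to_ac \<mu>" using P(2) by (simp add: left_diff_distrib)
  then have sg: "(\<Sum>i = 1..n. g i) = 1"
    by (simp add: g_def sum_subtractf \<mu>_def)
  have sq: "s i * s i = to_ac \<kappa>" for i using r by (simp add: s_def)
  have "(\<alpha> + of_nat n * \<gamma>) * \<kappa> + \<delta> = 0" using nondeg by (simp add: \<kappa>_def)
  then have "to_ac ((\<alpha> + of_nat n * \<gamma>) * \<kappa> + \<delta>) = 0" by simp
  then have z: "to_ac \<alpha> * to_ac \<kappa> + to_ac \<gamma> * (of_nat n * to_ac \<kappa>) + to_ac \<delta> = 0"
    by (simp add: algebra_simps)
  have gs: "g i + to_ac b * (\<Sum>j = 1..n. g j) = s i" for i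
    unfolding sg by (simp add: g_def)
  have "g i = 0" if "i \<in> {1..n}" for i
  proof (rule no_common_zero[of to_ac, OF _ _ _ _ _ that])
    show "to_ac \<alpha> * ((g i + to_ac b * (\<Sum>j = 1..n. g j)) * (g i + to_ac b * (\<Sum>j = 1..n. g j)))
      + to_ac \<gamma> * (\<Sum>k = 1..n. (g k + to_ac b * (\<Sum>j = 1..n. g j)) * (g k + to_ac b * (\<Sum>j = 1..n. g j)))
      + to_ac \<delta> * ((\<Sum>j = 1..n. g j) * (\<Sum>j = 1..n. g j)) = 0" for i
      unfolding gs unfolding sg sq using z by simp
  qed simp_all
  then have "(\<Sum>i = 1..n. g i) = 0" by simp
  then show False using sg by simp
qed

lemma surjective_e:
  assumes i: "2 * i \<le> n" and p: "p \<in> homogeneous_part n (n - i)"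
  shows "\<exists>q \<in> homogeneous_part n i. p - e ^ (n - 2 * i) * q \<in> J"
proof -
  \<comment> \<open>The analogue of primitive elements of degree \<open>k\<close>. The last clause
    treats the degrees beyond n/2, where no pair products exist and the exponent would be
    truncated.\<close>
  define P where "P k = {q \<in> homogeneous_part n k. (2 * k \<le> n \<longrightarrow> e ^ (n + 1 - 2 * k) * q \<in> J) \<and>
      (n < 2 * k \<longrightarrow> q = 0)}" for k
  have P_0: "0 \<in> P k" for k by (simp add: P_def J_closed)
  have P_add: "q \<in> P k \<Longrightarrow> r \<in> P k \<Longrightarrow> q + r \<in> P k" for q r k
    by (auto simp: P_def ring_distribs intro: J_closed)
  have P_scale: "q \<in> P k \<Longrightarrow> mconst a * q \<in> P k" for q k a
    by (auto simp: P_def mult.left_commute[of _ "mconst a"] intro: J_closed)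
  define F where "F d = {q. \<exists>h. (\<forall>k. h k \<in> P k) \<and> q - (\<Sum>k\<le>d. e ^ (d - k) * h k) \<in> J}" for d
  have FI: "q \<in> F d" if "q - (\<Sum>k\<le>d. e ^ (d - k) * h k) = r" "\<And>k. h k \<in> P k" "r \<in> J" for h q r d
    using that unfolding F_def by blast
  have F_add: "q + r \<in> F d" if qr: "q \<in> F d" "r \<in> F d" for q r d
  proof -
    obtain h where h: "\<And>k. h k \<in> P k" "q - (\<Sum>k\<le>d. e ^ (d - k) * h k) \<in> J" using qr by (auto simp: F_def)
    obtain h' where h': "\<And>k. h' k \<in> P k" "r - (\<Sum>k\<le>d. e ^ (d - k) * h' k) \<in> J" using qr by (auto simp: F_def)
    have "q + r - (\<Sum>k\<le>d. e ^ (d - k) * (h k + h' k)) =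
       (q - (\<Sum>k\<le>d. e ^ (d - k) * h k)) + (r - (\<Sum>k\<le>d. e ^ (d - k) * h' k))"
      by (simp add: ring_distribs sum.distrib)
    then show ?thesis by (rule FI) (auto intro: P_add J_closed h h')
  qed
  have F_scale: "mconst a * q \<in> F d" if q: "q \<in> F d" for a q d
  proof -
    obtain h where h: "\<And>k. h k \<in> P k" "q - (\<Sum>k\<le>d. e ^ (d - k) * h k) \<in> J" using q by (auto simp: F_def)
    have "mconst a * q - (\<Sum>k\<le>d. e ^ (d - k) * (mconst a * h k)) = mconst a * (q - (\<Sum>k\<le>d. e ^ (d - k) * h k))"
      by (simp add: ring_distribs sum_distrib_left mult_ac)
    then show ?thesis by (rule FI) (auto intro: P_scale h J_closed)
  qed
  have F_J: "q \<in> F d" if "q \<in> J" for q d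
    unfolding F_def using that P_0 by (intro CollectI exI[of _ "\<lambda>_. 0"]) simp
  have F_e: "e * q \<in> F (Suc d)" if q: "q \<in> F d" for q d
  proof -
    obtain h where h: "\<And>k. h k \<in> P k" "q - (\<Sum>k\<le>d. e ^ (d - k) * h k) \<in> J" using q by (auto simp: F_def)
    define h' where "h' k = (if k \<le> d then h k else 0)" for k
    have "(\<Sum>k\<le>Suc d. e ^ (Suc d - k) * h' k) = (\<Sum>k\<le>d. e ^ (Suc d - k) * h k)"
      by (simp add: h'_def)
    also have "\<dots> = e * (\<Sum>k\<le>d. e ^ (d - k) * h k)"
      unfolding sum_distrib_left by (intro sum.cong) (auto simp: Suc_diff_le mult.assoc)
    finally have "e * q - (\<Sum>k\<le>Suc d. e ^ (Suc d - k) * h' k) = e * (q - (\<Sum>k\<le>d. e ^ (d - k) * h k))"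
      by (simp add: ring_distribs)
    then show ?thesis by (rule FI) (auto simp: h'_def intro: P_0 h J_closed)
  qed
  have F_P: "q \<in> F k" if "q \<in> P k" for q k
  proof -
    define h where "h = (\<lambda>j. if j = k then q else 0)"
    have "(\<Sum>j\<le>k. e ^ (k - j) * h j) = (\<Sum>j\<le>k. if j = k then q else 0)"
      by (intro sum.cong) (auto simp: h_def)
    then have "(\<Sum>j\<le>k. e ^ (k - j) * h j) = q" by simp
    then show ?thesis unfolding F_def using that P_0
      by (intro CollectI exI[of _ h]) (simp add: h_def J_closed)
  qed
  have sum_y_J: "(\<Sum>i = 1..n. y i) - mconst \<mu> * e \<in> J"
    unfolding sum_y_eq by (simp add: J_closed)
  interpret S: square_system J y "{1..n}" "mconst \<kappa> * (e * e)" "mconst \<mu> * e"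
    by unfold_locales (blast intro: finite_atLeastAtMost J_closed y_sq sum_y_J)+
  have pp_hom: "w \<in> homogeneous_part n k" if "S.pair_product k w V" for k w V
    using that
  proof (induction rule: S.pair_product.induct)
    case (pair_product_Suc k w V a c)
    then have "a \<in> {1..n}" "c \<in> {1..n}" using S.pair_product_card by blast+
    then have "(y a - y c) * w \<in> homogeneous_part n (1 + k)"
      using pair_product_Suc by (intro hom_mult hom_diff y_hom)
    then show ?case by simp
  qed simp
  have pp_P: "w \<in> P k" if pp: "S.pair_product k w V" for k w V
  proof -
    have c: "card V + 2 * k = n" using S.pair_product_card[OF pp] by simp
    then have V: "card V = n - 2 * k" "2 * k \<le> n" by auto
    have 1: "w * Qp (card V) (mconst \<mu> * e) (mconst \<kappa> * (e * e)) \<in> J" by (rule S.pair_product_Qp[OF pp])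
    have 2: "n + 1 - 2 * k = Suc (n - 2 * k)" using V(2) by simp
    have "mconst (Qp (n - 2 * k) \<mu> \<kappa>) * (e ^ (n + 1 - 2 * k) * w) \<in> J"
      using 1 unfolding 2 Qp_homogeneous Qp_mconst V(1) by (simp only: mult_ac)
    from J_scale_cancel[OF Qp_nonzero[OF V(2)] this]
    show ?thesis using V pp_hom[OF pp] by (simp add: P_def)
  qed
  interpret S: square_family J y "{1..n}" "mconst \<kappa> * (e * e)" "mconst \<mu> * e" F "{e}"
  proof unfold_locales
    show "a - c \<in> F d" if "a \<in> F d" "c \<in> F d" for a c d
      using scale_diff[OF F_scale F_add that] .
    show "a \<in> F d" if "of_nat (Suc c) * a \<in> F d" for a c d
      using of_nat_cancel_scale[OF F_scale that] .
    show "mconst \<kappa> * (e * e) * a \<in> F (Suc (Suc d))" if "a \<in> F d" for a d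
      using F_scale[OF F_e[OF F_e[OF that]], of \<kappa>] by (simp add: mult_ac)
    show "mconst \<mu> * e * a \<in> F (Suc d)" if "a \<in> F d" for a d
      using F_scale[OF F_e[OF that], of \<mu>] by (simp add: mult_ac)
  qed (blast intro: F_add F_J F_e F_P pp_P)+
  have gens: "prod_list ws \<in> F (length ws)" if "set ws \<subseteq> y ` {1..n} \<union> {e}" for ws
    using S.prod_list_mem_F[OF that, of "{}"] by simp
  have "0 \<in> F d" for d using F_J J_closed by blast
  from hom_mem_family[OF F_add F_scale this gens _ _ p]
  have "p \<in> F (n - i)" by auto
  then obtain h where h: "\<And>k. h k \<in> P k" "p - (\<Sum>k\<le>n - i. e ^ (n - i - k) * h k) \<in> J" by (auto simp: F_def)
  define q where "q = (\<Sum>k\<le>i. e ^ (i - k) * h k)"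
  have qh: "q \<in> homogeneous_part n i"
    unfolding q_def
  proof (intro hom_sum)
    fix k assume "k \<in> {..i}"
    moreover have "e ^ (i - k) * h k \<in> homogeneous_part n ((i - k) * 1 + k)"
      using h(1)[of k] by (intro hom_mult hom_power e_hom) (simp add: P_def)
    ultimately show "e ^ (i - k) * h k \<in> homogeneous_part n i" by simp
  qed
  \<comment> \<open>For k at most i, n - i - k = (n - 2i) + (i - k), so the required power of
    \<open>e\<close> splits off and the cofactors form \<open>q\<close>. For k above i, n - i - k is
    at least n + 1 - 2k, so the term lies in \<open>J\<close> when 2k is at most n; otherwise
    \<open>h k\<close> is 0.\<close>
  have split: "{..n - i} = {..i} \<union> {i<..n - i}" using i by auto
  have "(\<Sum>k\<le>n - i. e ^ (n - i - k) * h k) = (\<Sum>k\<le>i. e ^ (n - i - k) * h k) + (\<Sum>k\<in>{i<..n - i}. e ^ (n - i - k) * h k)"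
    unfolding split by (rule sum.union_disjoint) auto
  also have "(\<Sum>k\<le>i. e ^ (n - i - k) * h k) = e ^ (n - 2 * i) * q"
    unfolding q_def sum_distrib_left
  proof (intro sum.cong refl)
    fix k assume "k \<in> {..i}"
    then have "n - i - k = (n - 2 * i) + (i - k)" using i by auto
    then show "e ^ (n - i - k) * h k = e ^ (n - 2 * i) * (e ^ (i - k) * h k)"
      by (simp add: power_add mult.assoc)
  qed
  finally have eq: "p - e ^ (n - 2 * i) * q = (p - (\<Sum>k\<le>n - i. e ^ (n - i - k) * h k)) + (\<Sum>k\<in>{i<..n - i}. e ^ (n - i - k) * h k)"
    by simp
  have "(\<Sum>k\<in>{i<..n - i}. e ^ (n - i - k) * h k) \<in> J"
  proof (rule J_sum)
    fix k assume k: "k \<in> {i<..n - i}"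
    show "e ^ (n - i - k) * h k \<in> J"
    proof (cases "2 * k \<le> n")
      case True
      then have "n - i - k = (k - i - 1) + (n + 1 - 2 * k)" using k by auto
      then have eq: "e ^ (n - i - k) * h k = e ^ (k - i - 1) * (e ^ (n + 1 - 2 * k) * h k)"
        by (simp add: power_add mult.assoc)
      have "e ^ (n + 1 - 2 * k) * h k \<in> J" using h(1)[of k] True by (simp add: P_def)
      then show ?thesis unfolding eq by (rule J_closed)
    next
      case False
      then show ?thesis using h(1)[of k] by (simp add: P_def J_closed)
    qed
  qed
  then have "p - e ^ (n - 2 * i) * q \<in> J" unfolding eq by (rule J_closed(2)[OF h(2)])
  then show ?thesis using qh by blast
qed

end

section \<open>Degenerate case: \<open>e * e\<close> lies in \<open>J\<close> and only differences
  of the squares are controlled\<close>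

context
  assumes degen: "\<alpha> + of_nat n * \<gamma> = 0"
begin

lemma degenerate_pos: "0 < n"
  using degen \<alpha> by (cases n) auto

text \<open>The squares drop out of the sum of all \<open>f i\<close>, which becomes n \<delta>
  times \<open>e * e\<close>; \<open>sum_f\<close> makes this scalar nonzero.\<close>

lemma e_sq: "e * e \<in> J"
proof (rule J_scale_cancel)
  have "(\<Sum>i = 1..n. f i) \<in> J" by (intro J_sum J_closed)
  then show "mconst (of_nat n * \<delta>) * (e * e) \<in> J" unfolding sum_f_eq degen by simp
  show "of_nat n * \<delta> \<noteq> 0" using sum_f[OF degenerate_pos] degenerate_pos unfolding sum_f_eq degen by auto
qed

lemma y_sq_diff:
  assumes "i \<in> {1..n}" "j \<in> {1..n}" shows "y i * y i - y j * y j \<in> J"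
proof (rule J_scale_cancel[OF \<alpha>])
  have "f i - f j \<in> J" using assms by (intro J_closed)
  moreover have "f i - f j = mconst \<alpha> * (y i * y i - y j * y j)"
    unfolding f_eq[OF assms(1)] f_eq[OF assms(2)] by (simp add: algebra_simps)
  ultimately show "mconst \<alpha> * (y i * y i - y j * y j) \<in> J" by simp
qed

text \<open>For even \<open>n\<close>, half the coordinates 1 and half -1 make \<open>e\<close>
  vanish and all squares 1, so each \<open>f i\<close> takes the value \<alpha> + n \<gamma> = 0 at
  this nonzero point.\<close>

lemma degenerate_odd: "odd n"
proof
  assume "even n"
  then obtain k where k: "n = 2 * k" by blast
  define g :: "nat \<Rightarrow> 'a" where "g i = (if i \<le> k then 1 else -1)" for i
  have sg: "(\<Sum>i = 1..n. g i) = 0"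
  proof -
    have "{1..n} = {1..k} \<union> {k+1..n}" using k by auto
    then have "(\<Sum>i = 1..n. g i) = (\<Sum>i = 1..k. g i) + (\<Sum>i = k+1..n. g i)"
      by (simp add: sum.union_disjoint)
    also have "(\<Sum>i = 1..k. g i) = (\<Sum>i = 1..k. 1)" by (intro sum.cong) (auto simp: g_def)
    also have "(\<Sum>i = k+1..n. g i) = (\<Sum>i = k+1..n. - 1)" by (intro sum.cong) (auto simp: g_def)
    finally show ?thesis using k by simp
  qed
  have sq: "g i * g i = 1" for i by (simp add: g_def)
  have "g 1 = 0"
  proof (rule no_common_zero[of "\<lambda>x. x"])
    show "\<alpha> * ((g i + b * (\<Sum>j = 1..n. g j)) * (g i + b * (\<Sum>j = 1..n. g j)))
      + \<gamma> * (\<Sum>k = 1..n. (g k + b * (\<Sum>j = 1..n. g j)) * (g k + b * (\<Sum>j = 1..n. g j)))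
      + \<delta> * ((\<Sum>j = 1..n. g j) * (\<Sum>j = 1..n. g j)) = 0" for i
      unfolding sg using degen by (simp add: sq mult.commute)
  qed (use degenerate_pos in auto)
  then show False using sq[of 1] by simp
qed

text \<open>No common value of the squares in terms of \<open>e\<close> is available, so
  \<open>s = y n\<close> supplies the square for the other n - 1 elements, whose sum is
  \<open>mconst \<mu> * e - s\<close>. As \<open>e * e\<close> lies in \<open>J\<close>,
  coefficients reduce to powers of \<open>l\<close>, possibly times one \<open>e\<close>.\<close>

lemma surjective_generic:
  "\<exists>l \<in> homogeneous_part n 1. \<forall>i p. 2 * i \<le> n \<longrightarrow> p \<in> homogeneous_part n (n - i) \<longrightarrow>
     (\<exists>q \<in> homogeneous_part n i. p - l ^ (n - 2 * i) * q \<in> J)"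
proof -
  define s where "s = y n"
  have n: "n \<in> {1..n}" using degenerate_pos by simp
  define A :: "nat \<Rightarrow> 'a" where "A m = Qp m (-1) 1" for m
  have "\<forall>m. \<exists>c::'a. \<forall>e s. \<exists>r. Qp m (mconst \<mu> * e - s) (s * s) =
     mconst (A m) * s ^ Suc m + mconst c * (e * s ^ m) + r * (e * e)"
    unfolding A_def using Qp_perturb by blast
  then obtain B :: "nat \<Rightarrow> 'a" where B: "\<And>m e s. \<exists>r. Qp m (mconst \<mu> * e - s) (s * s) =
     mconst (A m) * s ^ Suc m + mconst (B m) * (e * s ^ m) + r * (e * e)" by metis
  \<comment> \<open>For even \<open>m\<close> the excluded value is the one at which
    \<open>D m\<close> would vanish. For odd \<open>m\<close> the quotient may be a division by 0,
    which merely excludes a further value.\<close>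
  have "\<exists>\<tau>::'a. \<tau> \<notin> (\<lambda>m. B m / (A m * of_nat (Suc m))) ` {..n}"
    by (rule ex_new_if_finite) (simp_all add: infinite_UNIV_char_0)
  then obtain \<tau> where \<tau>: "\<And>m. m \<le> n \<Longrightarrow> \<tau> \<noteq> B m / (A m * of_nat (Suc m))" by blast
  \<comment> \<open>Modulo \<open>e * e\<close>, rewriting
    \<open>A m * s ^ Suc m + B m * e * s ^ m\<close> in terms of \<open>l\<close> and dividing by
    \<open>A m\<close> gives \<open>l ^ Suc m + D m * e * l ^ m\<close>.\<close>
  define D where "D m = (B m - A m * of_nat (Suc m) * \<tau>) / A m" for m
  have A0: "A m \<noteq> 0" if "even m" for m unfolding A_def by (rule Qp_even_nonzero[OF that])
  have D0: "D m \<noteq> 0" if "even m" "m \<le> n" for m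
    using \<tau>[OF that(2)] A0[OF that(1)] by (auto simp: D_def field_simps simp del: of_nat_Suc)
  define l where "l = s + mconst \<tau> * e"
  have s_eq: "s = l - mconst \<tau> * e" by (simp add: l_def)
  have s_hom: "s \<in> homogeneous_part n 1" unfolding s_def using n by (rule y_hom)
  have l_hom: "l \<in> homogeneous_part n 1" unfolding l_def by (intro hom_add s_hom hom_scale e_hom)
  \<comment> \<open>Binomial expansion of the powers of \<open>l - mconst \<tau> * e\<close> to
    first order in \<open>e\<close>. At m = 0 the truncated exponent \<open>m - 1\<close> is
    harmless because its coefficient is 0.\<close>
  have s_pow: "\<exists>r. s ^ m = l ^ m - mconst (of_nat m * \<tau>) * (e * l ^ (m - 1)) + r * (e * e)" for m
  proof (induction m)
    case 0 show ?case by (rule exI[of _ 0]) simp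
  next
    case (Suc m)
    then obtain r where r: "s ^ m = l ^ m - mconst (of_nat m * \<tau>) * (e * l ^ (m - 1)) + r * (e * e)" by blast
    have lm: "mconst (of_nat m * \<tau>) * (e * l ^ (m - 1)) * l = mconst (of_nat m * \<tau>) * (e * l ^ m)"
      by (cases m) (simp_all add: mult_ac)
    have "s ^ Suc m = l ^ m * l - mconst (of_nat m * \<tau>) * (e * l ^ (m - 1)) * l - mconst \<tau> * (e * l ^ m)
       + (mconst (of_nat m * \<tau>) * mconst \<tau> * l ^ (m - 1) + r * s) * (e * e)"
      unfolding power_Suc r by (simp add: s_eq algebra_simps)
    also have "\<dots> = l ^ Suc m - mconst (of_nat (Suc m) * \<tau>) * (e * l ^ m)
       + (mconst (of_nat m * \<tau>) * mconst \<tau> * l ^ (m - 1) + r * s) * (e * e)"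
      unfolding lm by (simp add: ring_distribs mconst_add)
    finally show ?case by auto
  qed
  define m where "m k = n - 1 - 2 * k" for k
  \<comment> \<open>Instead of being killed by a power, elements of \<open>P k\<close> satisfy a
    relation that trades \<open>e * l ^ m k\<close> for \<open>l ^ Suc (m k)\<close>. Here
    \<open>m k\<close> counts the indices among 1, ..., n - 1 left after \<open>k\<close> pairs; it
    is even because n is odd.\<close>
  define P where "P k = {q \<in> homogeneous_part n k.
      (2 * k \<le> n - 1 \<longrightarrow> l ^ Suc (m k) * q + mconst (D (m k)) * (e * (l ^ m k * q)) \<in> J) \<and>
      (n - 1 < 2 * k \<longrightarrow> q = 0)}" for k
  have P_0: "0 \<in> P k" for k by (simp add: P_def J_closed)
  have P_add: "q + r \<in> P k" if qr: "q \<in> P k" "r \<in> P k" for q r k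
  proof -
    have "l ^ Suc (m k) * (q + r) + mconst (D (m k)) * (e * (l ^ m k * (q + r))) =
      (l ^ Suc (m k) * q + mconst (D (m k)) * (e * (l ^ m k * q))) +
      (l ^ Suc (m k) * r + mconst (D (m k)) * (e * (l ^ m k * r)))"
      by (simp only: ring_distribs add_ac)
    then show ?thesis using qr unfolding P_def mem_Collect_eq by (metis J_closed(2) add_0 hom_add)
  qed
  have P_scale: "mconst a * q \<in> P k" if q: "q \<in> P k" for q k a
  proof -
    have "l ^ Suc (m k) * (mconst a * q) + mconst (D (m k)) * (e * (l ^ m k * (mconst a * q))) =
      mconst a * (l ^ Suc (m k) * q + mconst (D (m k)) * (e * (l ^ m k * q)))"
      by (simp only: ring_distribs mult_ac)
    then show ?thesis using q unfolding P_def mem_Collect_eq by (metis J_closed(3) mult_zero_right hom_scale)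
  qed
  \<comment> \<open>The factor \<open>e\<close> takes up one degree, whence the exponent
    \<open>d - Suc k\<close> and the strict bound in the second sum.\<close>
  define F where "F d = {q. \<exists>h g. (\<forall>k. h k \<in> P k) \<and> (\<forall>k. g k \<in> P k) \<and>
     q - ((\<Sum>k\<le>d. l ^ (d - k) * h k) + (\<Sum>k<d. e * (l ^ (d - Suc k) * g k))) \<in> J}" for d
  have FI: "q \<in> F d"
    if "q - ((\<Sum>k\<le>d. l ^ (d - k) * h k) + (\<Sum>k<d. e * (l ^ (d - Suc k) * g k))) = r"
      "\<And>k. h k \<in> P k" "\<And>k. g k \<in> P k" "r \<in> J" for h g q r d
    using that unfolding F_def by blast
  have FE: "\<exists>h g. (\<forall>k. h k \<in> P k) \<and> (\<forall>k. g k \<in> P k) \<and>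
     q - ((\<Sum>k\<le>d. l ^ (d - k) * h k) + (\<Sum>k<d. e * (l ^ (d - Suc k) * g k))) \<in> J"
    if "q \<in> F d" for q d using that by (simp add: F_def)
  have F_add: "q + r \<in> F d" if qr: "q \<in> F d" "r \<in> F d" for q r d
  proof -
    obtain h g where h: "\<And>k. h k \<in> P k" "\<And>k. g k \<in> P k"
      "q - ((\<Sum>k\<le>d. l ^ (d - k) * h k) + (\<Sum>k<d. e * (l ^ (d - Suc k) * g k))) \<in> J"
      using FE[OF qr(1)] by blast
    obtain h' g' where h': "\<And>k. h' k \<in> P k" "\<And>k. g' k \<in> P k"
      "r - ((\<Sum>k\<le>d. l ^ (d - k) * h' k) + (\<Sum>k<d. e * (l ^ (d - Suc k) * g' k))) \<in> J"
      using FE[OF qr(2)] by blast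
    have "q + r - ((\<Sum>k\<le>d. l ^ (d - k) * (h k + h' k)) + (\<Sum>k<d. e * (l ^ (d - Suc k) * (g k + g' k)))) =
       (q - ((\<Sum>k\<le>d. l ^ (d - k) * h k) + (\<Sum>k<d. e * (l ^ (d - Suc k) * g k)))) +
       (r - ((\<Sum>k\<le>d. l ^ (d - k) * h' k) + (\<Sum>k<d. e * (l ^ (d - Suc k) * g' k))))"
      by (simp add: ring_distribs sum.distrib)
    then show ?thesis by (rule FI) (auto intro: P_add J_closed h h')
  qed
  have F_scale: "mconst a * q \<in> F d" if q: "q \<in> F d" for a q d
  proof -
    obtain h g where h: "\<And>k. h k \<in> P k" "\<And>k. g k \<in> P k"
      "q - ((\<Sum>k\<le>d. l ^ (d - k) * h k) + (\<Sum>k<d. e * (l ^ (d - Suc k) * g k))) \<in> J"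
      using FE[OF q] by blast
    have "mconst a * q - ((\<Sum>k\<le>d. l ^ (d - k) * (mconst a * h k)) + (\<Sum>k<d. e * (l ^ (d - Suc k) * (mconst a * g k)))) =
      mconst a * (q - ((\<Sum>k\<le>d. l ^ (d - k) * h k) + (\<Sum>k<d. e * (l ^ (d - Suc k) * g k))))"
      by (simp add: ring_distribs sum_distrib_left mult_ac)
    then show ?thesis by (rule FI) (auto intro: P_scale h J_closed)
  qed
  have F_J: "q \<in> F d" if q: "q \<in> J" for q d
    by (rule FI[of q d "\<lambda>_. 0" "\<lambda>_. 0" q]) (use q P_0 in auto)
  have F_l: "l * q \<in> F (Suc d)" if q: "q \<in> F d" for q d
  proof -
    obtain h g where h: "\<And>k. h k \<in> P k" "\<And>k. g k \<in> P k"
      "q - ((\<Sum>k\<le>d. l ^ (d - k) * h k) + (\<Sum>k<d. e * (l ^ (d - Suc k) * g k))) \<in> J"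
      using FE[OF q] by blast
    define h' where "h' k = (if k \<le> d then h k else 0)" for k
    define g' where "g' k = (if k < d then g k else 0)" for k
    have "(\<Sum>k\<le>Suc d. l ^ (Suc d - k) * h' k) = (\<Sum>k\<le>d. l ^ (Suc d - k) * h k)"
      by (simp add: h'_def)
    also have "\<dots> = l * (\<Sum>k\<le>d. l ^ (d - k) * h k)"
      unfolding sum_distrib_left by (intro sum.cong) (auto simp: Suc_diff_le mult.assoc)
    finally have 1: "(\<Sum>k\<le>Suc d. l ^ (Suc d - k) * h' k) = l * (\<Sum>k\<le>d. l ^ (d - k) * h k)" .
    have "(\<Sum>k<Suc d. e * (l ^ (Suc d - Suc k) * g' k)) = (\<Sum>k<d. e * (l ^ (Suc d - Suc k) * g k))"
      by (simp add: g'_def)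
    also have "\<dots> = l * (\<Sum>k<d. e * (l ^ (d - Suc k) * g k))"
      unfolding sum_distrib_left
    proof (intro sum.cong refl)
      fix k assume "k \<in> {..<d}"
      then have "Suc d - Suc k = Suc (d - Suc k)" by auto
      then show "e * (l ^ (Suc d - Suc k) * g k) = l * (e * (l ^ (d - Suc k) * g k))"
        by (simp add: mult_ac)
    qed
    finally have 2: "(\<Sum>k<Suc d. e * (l ^ (Suc d - Suc k) * g' k)) = l * (\<Sum>k<d. e * (l ^ (d - Suc k) * g k))" .
    have "l * q - ((\<Sum>k\<le>Suc d. l ^ (Suc d - k) * h' k) + (\<Sum>k<Suc d. e * (l ^ (Suc d - Suc k) * g' k)))
       = l * (q - ((\<Sum>k\<le>d. l ^ (d - k) * h k) + (\<Sum>k<d. e * (l ^ (d - Suc k) * g k))))"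
      unfolding 1 2 by (simp only: ring_distribs)
    then show ?thesis by (rule FI) (auto simp: h'_def g'_def intro: P_0 h J_closed)
  qed
  have F_e: "e * q \<in> F (Suc d)" if q: "q \<in> F d" for q d
  proof -
    obtain h g where h: "\<And>k. h k \<in> P k" "\<And>k. g k \<in> P k"
      "q - ((\<Sum>k\<le>d. l ^ (d - k) * h k) + (\<Sum>k<d. e * (l ^ (d - Suc k) * g k))) \<in> J"
      using FE[OF q] by blast
    have 1: "(\<Sum>k<Suc d. e * (l ^ (Suc d - Suc k) * h k)) = e * (\<Sum>k\<le>d. l ^ (d - k) * h k)"
      unfolding sum_distrib_left by (intro sum.cong) auto
    have 2: "e * (\<Sum>k<d. e * (l ^ (d - Suc k) * g k)) = (\<Sum>k<d. l ^ (d - Suc k) * g k) * (e * e)"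
      unfolding sum_distrib_left sum_distrib_right by (intro sum.cong) (auto simp: mult_ac)
    \<comment> \<open>Multiplication by \<open>e\<close> moves the family \<open>h\<close> into the
      second sum and sends the old second sum into \<open>J\<close>, so the new families are 0 and
      \<open>h\<close>.\<close>
    have "e * q - ((\<Sum>k\<le>Suc d. l ^ (Suc d - k) * 0) + (\<Sum>k<Suc d. e * (l ^ (Suc d - Suc k) * h k)))
       = e * (q - ((\<Sum>k\<le>d. l ^ (d - k) * h k) + (\<Sum>k<d. e * (l ^ (d - Suc k) * g k))))
         + (\<Sum>k<d. l ^ (d - Suc k) * g k) * (e * e)"
      unfolding 1 2[symmetric] by (simp add: ring_distribs)
    then show ?thesis by (rule FI) (auto intro: P_0 h J_closed e_sq)
  qed
  have F_s: "s * q \<in> F (Suc d)" if q: "q \<in> F d" for q d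
  proof -
    have "s * q = l * q + mconst (- \<tau>) * (e * q)"
      by (simp add: s_eq mconst_uminus algebra_simps)
    then show ?thesis using F_add[OF F_l[OF q] F_scale[OF F_e[OF q]]] by metis
  qed
  have F_P: "q \<in> F k" if q: "q \<in> P k" for q k
  proof -
    define h where "h = (\<lambda>j. if j = k then q else 0)"
    have "(\<Sum>j\<le>k. l ^ (k - j) * h j) = (\<Sum>j\<le>k. if j = k then q else 0)"
      by (intro sum.cong) (auto simp: h_def)
    then have "q - ((\<Sum>j\<le>k. l ^ (k - j) * h j) + (\<Sum>j<k. e * (l ^ (k - Suc j) * 0))) = 0" by simp
    then show ?thesis by (rule FI) (use q P_0 in \<open>auto simp: h_def J_closed\<close>)
  qed
  have sq: "y i * y i - s * s \<in> J" if "i \<in> {1..n - 1}" for i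
    unfolding s_def using that n by (intro y_sq_diff) auto
  have sum_y: "(\<Sum>i = 1..n - 1. y i) - (mconst \<mu> * e - s) \<in> J"
  proof -
    have "{1..n} = insert n {1..n - 1}" using degenerate_pos by auto
    then have "(\<Sum>i = 1..n. y i) = s + (\<Sum>i = 1..n - 1. y i)"
      using degenerate_pos by (simp add: s_def)
    then have "(\<Sum>i = 1..n - 1. y i) - (mconst \<mu> * e - s) = 0"
      using sum_y_eq by (simp add: algebra_simps)
    then show ?thesis using J_closed(1) by metis
  qed
  interpret S: square_system J y "{1..n - 1}" "s * s" "mconst \<mu> * e - s"
    by unfold_locales (blast intro: finite_atLeastAtMost J_closed sq sum_y)+
  have pp_hom: "w \<in> homogeneous_part n k" if "S.pair_product k w V" for k w V
    using that
  proof (induction rule: S.pair_product.induct)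
    case (pair_product_Suc k w V a c)
    then have "a \<in> {1..n - 1}" "c \<in> {1..n - 1}" using S.pair_product_card by blast+
    then have "(y a - y c) * w \<in> homogeneous_part n (1 + k)"
      using pair_product_Suc by (intro hom_mult hom_diff y_hom) auto
    then show ?case by simp
  qed simp
  have even_m: "even (m k)" for k
    using degenerate_odd by (auto simp: m_def)
  have pp_P: "w \<in> P k" if pp: "S.pair_product k w V" for k w V
  proof -
    have c: "card V + 2 * k = n - 1" using S.pair_product_card[OF pp] by simp
    then have V: "card V = m k" "2 * k \<le> n - 1" by (auto simp: m_def)
    let ?m = "m k"
    obtain r where r: "Qp ?m (mconst \<mu> * e - s) (s * s) =
       mconst (A ?m) * s ^ Suc ?m + mconst (B ?m) * (e * s ^ ?m) + r * (e * e)" using B by blast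
    obtain r1 where r1: "s ^ Suc ?m = l ^ Suc ?m - mconst (of_nat (Suc ?m) * \<tau>) * (e * l ^ (Suc ?m - 1)) + r1 * (e * e)"
      using s_pow by blast
    obtain r2 where r2: "s ^ ?m = l ^ ?m - mconst (of_nat ?m * \<tau>) * (e * l ^ (?m - 1)) + r2 * (e * e)"
      using s_pow by blast
    have AD: "mconst (A ?m) * mconst (D ?m) = mconst (B ?m) - mconst (A ?m) * mconst (of_nat (Suc ?m) * \<tau>)"
      unfolding mconst_mult[symmetric] mconst_diff[symmetric] using A0[OF even_m[of k]]
      by (simp add: D_def mult.assoc)
    have "mconst (A ?m) * (l ^ Suc ?m * w + mconst (D ?m) * (e * (l ^ ?m * w))) =
       w * (mconst (A ?m) * l ^ Suc ?m) + (mconst (A ?m) * mconst (D ?m)) * (e * (l ^ ?m * w))"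
      by (simp only: ring_distribs mult_ac)
    also have "\<dots> = w * Qp ?m (mconst \<mu> * e - s) (s * s) -
       w * (mconst (A ?m) * r1 + r + mconst (B ?m) * (e * r2 - mconst (of_nat ?m * \<tau>) * l ^ (?m - 1))) * (e * e)"
      unfolding r r1 r2 AD by (simp add: algebra_simps)
    also have "\<dots> \<in> J"
    proof (rule J_closed(4))
      show "w * Qp ?m (mconst \<mu> * e - s) (s * s) \<in> J"
        using S.pair_product_Qp[OF pp] unfolding V(1) .
    qed (rule J_closed(3)[OF e_sq])
    finally have "l ^ Suc ?m * w + mconst (D ?m) * (e * (l ^ ?m * w)) \<in> J"
      by (rule J_scale_cancel[OF A0[OF even_m]])
    then show ?thesis using V pp_hom[OF pp] by (simp add: P_def)
  qed
  interpret S: square_family J y "{1..n - 1}" "s * s" "mconst \<mu> * e - s" F "{e, s}"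
  proof unfold_locales
    show F_diff: "a - c \<in> F d" if "a \<in> F d" "c \<in> F d" for a c d
      using scale_diff[OF F_scale F_add that] .
    show "a \<in> F d" if "of_nat (Suc c) * a \<in> F d" for a c d
      using of_nat_cancel_scale[OF F_scale that] .
    show "s * s * a \<in> F (Suc (Suc d))" if "a \<in> F d" for a d
      using F_s[OF F_s[OF that]] by (simp add: mult_ac)
    show "(mconst \<mu> * e - s) * a \<in> F (Suc d)" if "a \<in> F d" for a d
      using F_diff[OF F_scale[OF F_e[OF that], of \<mu>] F_s[OF that]] by (simp add: algebra_simps)
    show "x * a \<in> F (Suc d)" if "x \<in> {e, s}" "a \<in> F d" for x a d
      using that F_e F_s by blast
  qed (blast intro: F_add F_J F_P pp_P)+
  have gens: "prod_list ws \<in> F (length ws)" if "set ws \<subseteq> y ` {1..n - 1} \<union> {e, s}" for ws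
    using S.prod_list_mem_F[OF that, of "{}"] by simp
  have ygen: "y ` {1..n} \<subseteq> y ` {1..n - 1} \<union> {e, s}"
  proof
    fix z assume "z \<in> y ` {1..n}"
    then obtain i where i: "i \<in> {1..n}" "z = y i" by blast
    show "z \<in> y ` {1..n - 1} \<union> {e, s}"
      using i by (cases "i = n") (auto simp: s_def)
  qed
  have F0: "0 \<in> F d" for d using F_J J_closed by blast
  have hom_F: "p \<in> F d" if "p \<in> homogeneous_part n d" for p d
    using hom_mem_family[OF F_add F_scale F0 gens _ ygen that] by auto
  have rel0: "l ^ Suc (m k) * q + mconst (D (m k)) * (e * (l ^ m k * q)) \<in> J"
    if "q \<in> P k" "2 * k \<le> n - 1" for q k using that by (simp add: P_def)
  \<comment> \<open>Multiplying the relation in \<open>P k\<close> by \<open>e\<close> kills its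
    second term; multiplying it by \<open>l\<close> turns the second term into the one just shown to
    vanish. So \<open>e * l ^ Suc (m k)\<close> and \<open>l ^ Suc (Suc (m k))\<close> both
    annihilate \<open>q\<close>.\<close>
  have rel1: "e * (l ^ (c + Suc (m k)) * q) \<in> J" if "q \<in> P k" "2 * k \<le> n - 1" for q k c
  proof -
    have "e * (l ^ (c + Suc (m k)) * q) =
       (e * l ^ c) * (l ^ Suc (m k) * q + mconst (D (m k)) * (e * (l ^ m k * q)))
       - (l ^ c * mconst (D (m k)) * (l ^ m k * q)) * (e * e)"
      by (simp add: power_add algebra_simps)
    then show ?thesis using J_closed(4)[OF J_closed(3)[OF rel0[OF that]] J_closed(3)[OF e_sq]] by metis
  qed
  have rel2: "l ^ (c + Suc (Suc (m k))) * q \<in> J" if "q \<in> P k" "2 * k \<le> n - 1" for q k c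
  proof -
    have "l ^ (c + Suc (Suc (m k))) * q =
       (l ^ c * l) * (l ^ Suc (m k) * q + mconst (D (m k)) * (e * (l ^ m k * q)))
       - mconst (D (m k)) * (e * (l ^ (c + Suc (m k)) * q))"
      by (simp add: power_add algebra_simps)
    then show ?thesis using J_closed(4)[OF J_closed(3)[OF rel0[OF that]] J_closed(3)[OF rel1[OF that]]] by metis
  qed
  have "\<exists>q \<in> homogeneous_part n i. p - l ^ (n - 2 * i) * q \<in> J"
    if i': "2 * i \<le> n" and p: "p \<in> homogeneous_part n (n - i)" for i p
  proof -
    have i: "2 * i < n" using i' degenerate_odd by (cases "2 * i = n") auto
    obtain h g where h: "\<And>k. h k \<in> P k" "\<And>k. g k \<in> P k"
      "p - ((\<Sum>k\<le>n - i. l ^ (n - i - k) * h k) + (\<Sum>k<n - i. e * (l ^ (n - i - Suc k) * g k))) \<in> J"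
      using FE[OF hom_F[OF p]] by blast
    \<comment> \<open>The term with k = i of the second sum is one power of \<open>l\<close> short
      of \<open>n - 2 * i\<close>. The relation in \<open>P i\<close> replaces
      \<open>e * l ^ m i * g i\<close> by \<open>l ^ Suc (m i) * (c * g i)\<close>, which requires
      \<open>D (m i)\<close> to be invertible.\<close>
    define c where "c = mconst (- inverse (D (m i)))"
    define q1 where "q1 = (\<Sum>k\<le>i. l ^ (i - k) * h k)"
    define q2 where "q2 = (\<Sum>k<i. e * (l ^ (i - Suc k) * g k))"
    have Ph: "h k \<in> homogeneous_part n k" "g k \<in> homogeneous_part n k" for k
      using h(1,2)[of k] by (auto simp: P_def)
    have q1h: "q1 \<in> homogeneous_part n i" unfolding q1_def
    proof (intro hom_sum)
      fix k assume "k \<in> {..i}"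
      moreover have "l ^ (i - k) * h k \<in> homogeneous_part n ((i - k) * 1 + k)"
        by (intro hom_mult hom_power l_hom Ph)
      ultimately show "l ^ (i - k) * h k \<in> homogeneous_part n i" by simp
    qed
    have q2h: "q2 \<in> homogeneous_part n i" unfolding q2_def
    proof (intro hom_sum)
      fix k assume "k \<in> {..<i}"
      moreover have "e * (l ^ (i - Suc k) * g k) \<in> homogeneous_part n (1 + ((i - Suc k) * 1 + k))"
        by (intro hom_mult hom_power l_hom e_hom Ph)
      ultimately show "e * (l ^ (i - Suc k) * g k) \<in> homogeneous_part n i" by simp
    qed
    have qh: "q1 + q2 + c * g i \<in> homogeneous_part n i"
      unfolding c_def by (intro hom_add hom_scale q1h q2h Ph)
    \<comment> \<open>Terms with k below i, and the one with k = i in the first sum, contain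
      \<open>l ^ (n - 2 * i)\<close>; those above i vanish by \<open>rel2\<close> and
      \<open>rel1\<close>. Only k = i in the second sum is borderline.\<close>
    have split1: "{..n - i} = {..i} \<union> {i<..n - i}" and split2: "{..<n - i} = insert i ({..<i} \<union> {i<..<n - i})"
      using i by auto
    have s1: "(\<Sum>k\<le>n - i. l ^ (n - i - k) * h k) = l ^ (n - 2 * i) * q1 + (\<Sum>k\<in>{i<..n - i}. l ^ (n - i - k) * h k)"
    proof -
      have "(\<Sum>k\<le>i. l ^ (n - i - k) * h k) = l ^ (n - 2 * i) * q1"
        unfolding q1_def sum_distrib_left
      proof (intro sum.cong refl)
        fix k assume "k \<in> {..i}"
        then have "n - i - k = (n - 2 * i) + (i - k)" using i by auto
        then show "l ^ (n - i - k) * h k = l ^ (n - 2 * i) * (l ^ (i - k) * h k)"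
          by (simp add: power_add mult.assoc)
      qed
      then show ?thesis unfolding split1 by (subst sum.union_disjoint) auto
    qed
    have s2: "(\<Sum>k<n - i. e * (l ^ (n - i - Suc k) * g k)) = e * (l ^ (n - i - Suc i) * g i) +
       (l ^ (n - 2 * i) * q2 + (\<Sum>k\<in>{i<..<n - i}. e * (l ^ (n - i - Suc k) * g k)))"
    proof -
      have "(\<Sum>k<i. e * (l ^ (n - i - Suc k) * g k)) = l ^ (n - 2 * i) * q2"
        unfolding q2_def sum_distrib_left
      proof (intro sum.cong refl)
        fix k assume "k \<in> {..<i}"
        then have "n - i - Suc k = (n - 2 * i) + (i - Suc k)" using i by auto
        then show "e * (l ^ (n - i - Suc k) * g k) = l ^ (n - 2 * i) * (e * (l ^ (i - Suc k) * g k))"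
          by (simp add: power_add mult_ac)
      qed
      moreover have "(\<Sum>k\<in>{..<i} \<union> {i<..<n - i}. e * (l ^ (n - i - Suc k) * g k)) =
         (\<Sum>k<i. e * (l ^ (n - i - Suc k) * g k)) + (\<Sum>k\<in>{i<..<n - i}. e * (l ^ (n - i - Suc k) * g k))"
        by (rule sum.union_disjoint) auto
      ultimately show ?thesis unfolding split2 by (subst sum.insert) auto
    qed
    have r1: "(\<Sum>k\<in>{i<..n - i}. l ^ (n - i - k) * h k) \<in> J"
    proof (rule J_sum)
      fix k assume k: "k \<in> {i<..n - i}"
      show "l ^ (n - i - k) * h k \<in> J"
      proof (cases "2 * k \<le> n - 1")
        case True
        then have "n - i - k = (k - i - 1) + Suc (Suc (m k))" using k by (auto simp: m_def)
        then show ?thesis using rel2[OF h(1) True] by metis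
      next
        case False
        then have "h k = 0" using h(1)[of k] by (simp add: P_def)
        then show ?thesis by (simp add: J_closed)
      qed
    qed
    have r2: "(\<Sum>k\<in>{i<..<n - i}. e * (l ^ (n - i - Suc k) * g k)) \<in> J"
    proof (rule J_sum)
      fix k assume k: "k \<in> {i<..<n - i}"
      show "e * (l ^ (n - i - Suc k) * g k) \<in> J"
      proof (cases "2 * k \<le> n - 1")
        case True
        then have "n - i - Suc k = (k - i - 1) + Suc (m k)" using k by (auto simp: m_def)
        then show ?thesis using rel1[OF h(2) True] by metis
      next
        case False
        then have "g k = 0" using h(2)[of k] by (simp add: P_def)
        then show ?thesis by (simp add: J_closed)
      qed
    qed
    have mi: "n - i - Suc i = m i" "n - 2 * i = Suc (m i)" "2 * i \<le> n - 1" "m i \<le> n"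
      using i by (auto simp: m_def)
    have "D (m i) \<noteq> 0" using D0 even_m mi by blast
    then have cD: "c * mconst (D (m i)) = - 1"
      unfolding c_def mconst_mult[symmetric] by (simp add: mconst_uminus)
    have r3: "e * (l ^ (n - i - Suc i) * g i) - l ^ (n - 2 * i) * (c * g i) \<in> J"
    proof -
      have "- c * (l ^ Suc (m i) * g i + mconst (D (m i)) * (e * (l ^ m i * g i))) \<in> J"
        by (rule J_closed(3)[OF rel0[OF h(2) mi(3)]])
      moreover have "- c * (l ^ Suc (m i) * g i + mconst (D (m i)) * (e * (l ^ m i * g i))) =
        - (c * mconst (D (m i))) * (e * (l ^ m i * g i)) - l ^ Suc (m i) * (c * g i)"
        by (simp add: algebra_simps)
      ultimately show ?thesis unfolding mi(1,2) cD by simp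
    qed
    have "p - l ^ (n - 2 * i) * (q1 + q2 + c * g i) =
      (p - ((\<Sum>k\<le>n - i. l ^ (n - i - k) * h k) + (\<Sum>k<n - i. e * (l ^ (n - i - Suc k) * g k))))
      + ((\<Sum>k\<in>{i<..n - i}. l ^ (n - i - k) * h k) + ((\<Sum>k\<in>{i<..<n - i}. e * (l ^ (n - i - Suc k) * g k))
         + (e * (l ^ (n - i - Suc i) * g i) - l ^ (n - 2 * i) * (c * g i))))"
      unfolding s1 s2 by (simp add: ring_distribs)
    also have "\<dots> \<in> J" by (intro J_closed(2) h r1 r2 r3)
    finally show ?thesis using qh by blast
  qed
  then show ?thesis using l_hom by blast
qed

end

end

section \<open>Equivariant families of quadrics\<close>

text \<open>Once the tails are matched by \<open>\<sigma>\<close>, the transposition of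
  \<open>\<sigma> x\<close> and \<open>y\<close> corrects the head and fixes the remaining targets.
  It serves to move up to three distinct indices to standard position.\<close>

lemma permutation_map_list:
  assumes "distinct xs" "distinct ys" "length xs = length ys" "set xs \<subseteq> S" "set ys \<subseteq> S"
  shows "\<exists>\<sigma>. \<sigma> permutes S \<and> map \<sigma> xs = ys"
  using assms
proof (induction xs ys rule: list_induct2')
  case 1 show ?case by (intro exI[of _ id] conjI permutes_id) simp
next
  case (4 x xs y ys)
  then obtain \<sigma> where s: "\<sigma> permutes S" "map \<sigma> xs = ys" by auto
  let ?t = "Transposition.transpose (\<sigma> x) y"
  have "\<sigma> x \<in> S" using 4 permutes_in_image[OF s(1)] by simp
  then have t: "?t permutes S" using 4 by (intro permutes_swap_id) auto
  have "\<sigma> x \<notin> set ys"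
    using 4 s(2)[symmetric] permutes_inj[OF s(1)] by (auto dest: injD)
  then have "map ?t ys = ys" using 4 by (intro map_idI) (auto simp: Transposition.transpose_def)
  then have "map (?t \<circ> \<sigma>) (x # xs) = y # ys" using s(2) by (simp add: map_map[symmetric] del: map_map)
  with permutes_compose[OF s(1) t] show ?case by (intro exI[of _ "?t \<circ> \<sigma>"] conjI)
qed auto

abbreviation "var2 i j \<equiv> Poly_Mapping.single i (1::nat) + Poly_Mapping.single j 1"

lemma var2_eq_iff:
  "(var2 a b :: nat \<Rightarrow>\<^sub>0 nat) = var2 k l \<longleftrightarrow> (a = k \<and> b = l) \<or> (a = l \<and> b = k)"
proof
  assume eq: "(var2 a b :: nat \<Rightarrow>\<^sub>0 nat) = var2 k l"
  have c: "(if a = i then 1 else 0) + (if b = i then 1 else 0) = (if k = i then 1 else 0) + (if l = i then 1 else (0::nat))" for i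
    using arg_cong[OF eq, of "\<lambda>m. Poly_Mapping.lookup m i"]
    by (simp only: lookup_add lookup_single when_def)
  show "(a = k \<and> b = l) \<or> (a = l \<and> b = k)"
  proof (cases "a = k")
    case True
    with c[of l] have "b = l" by (simp split: if_split_asm)
    with True show ?thesis by simp
  next
    case False
    with c[of k] have "b = k" by (simp split: if_split_asm)
    moreover from False c[of a] have "l = a" by (simp split: if_split_asm)
    ultimately show ?thesis by simp
  qed
qed (auto simp: add.commute)

lemma mons_2: assumes "m \<in> mons n 2" obtains k l where "k \<in> {1..n}" "l \<in> {1..n}" "m = var2 k l"
proof -
  obtain k m' where 1: "k \<in> {1..n}" "m' \<in> mons n 1" "m = m' + Poly_Mapping.single k 1"
    using mons_Suc[of m n 1] assms unfolding numeral_2_eq_2 One_nat_def by blast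
  obtain l m'' where 2: "l \<in> {1..n}" "m'' \<in> mons n 0" "m' = m'' + Poly_Mapping.single l 1"
    using mons_Suc[of m' n 0] 1 unfolding One_nat_def by blast
  show ?thesis using that[of l k] 1 2 by (simp add: mons_0)
qed

lemma mvar_mult: "mvar a * mvar b = Poly_Mapping.single (var2 a b) 1"
  by (simp add: mvar_def mult_single)

lemma sum_sum_delta:
  assumes "finite S" "finite T" "k \<in> S" "l \<in> T"
  shows "(\<Sum>a\<in>S. \<Sum>b\<in>T. if a = k then if b = l then c else 0 else 0) = c"
proof -
  have "(\<Sum>a\<in>S. \<Sum>b\<in>T. if a = k then if b = l then c else 0 else 0) = (\<Sum>a\<in>S. if a = k then c else 0)"
    using assms by (intro sum.cong refl) simp
  then show ?thesis using assms by simp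
qed

text \<open>Entries of the symmetric matrix of a quadratic form: a mixed monomial arises from both
  orders of its factors, so its coefficient is halved.\<close>

definition qcoeff :: "'a::field_char_0 mpoly \<Rightarrow> nat \<Rightarrow> nat \<Rightarrow> 'a" where
  "qcoeff p a b = (if a = b then 1 else 1 / 2) * Poly_Mapping.lookup p (var2 a b)"

lemma qcoeff_commute: "qcoeff p a b = qcoeff p b a"
  by (simp add: qcoeff_def add.commute)

lemma quadratic_form:
  assumes p: "p \<in> homogeneous_part n 2"
  shows "p = (\<Sum>a = 1..n. \<Sum>b = 1..n. mconst (qcoeff p a b) * (mvar a * mvar b))"
proof (rule poly_mapping_eqI)
  fix m
  let ?q = "\<Sum>a = 1..n. \<Sum>b = 1..n. mconst (qcoeff p a b) * (mvar a * mvar b)"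
  have q: "?q \<in> homogeneous_part n 2"
  proof (intro hom_sum hom_scale)
    fix a b assume "a \<in> {1..n}" "b \<in> {1..n}"
    then have "mvar a * mvar b \<in> homogeneous_part n (1 + 1)" by (intro hom_mult hom_mvar)
    then show "mvar a * mvar b \<in> homogeneous_part n 2" by (simp only: one_add_one)
  qed
  show "Poly_Mapping.lookup p m = Poly_Mapping.lookup ?q m"
  proof (cases "m \<in> mons n 2")
    case False
    show ?thesis
      unfolding p[unfolded homogeneous_part_lookup, rule_format, OF False]
        q[unfolded homogeneous_part_lookup, rule_format, OF False] ..
  next
    case True
    then obtain k l where kl: "k \<in> {1..n}" "l \<in> {1..n}" "m = var2 k l" by (rule mons_2)
    have "Poly_Mapping.lookup ?q m = (\<Sum>a = 1..n. \<Sum>b = 1..n. if (a = k \<and> b = l) \<or> (a = l \<and> b = k) then qcoeff p a b else 0)"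
      unfolding lookup_sum mvar_mult lookup_mconst_mult kl(3) lookup_single var2_eq_iff
      by (intro sum.cong refl) (simp add: when_def)
    also have "\<dots> = (\<Sum>a = 1..n. \<Sum>b = 1..n. (if a = k then if b = l then qcoeff p k l else 0 else 0)
        + (if a = l then if b = k then (if k = l then 0 else qcoeff p k l) else 0 else 0))"
      by (intro sum.cong refl) (auto simp: qcoeff_commute)
    also have "\<dots> = qcoeff p k l + (if k = l then 0 else qcoeff p k l)"
      unfolding sum.distrib using kl by (simp only: sum_sum_delta finite_atLeastAtMost)
    also have "\<dots> = Poly_Mapping.lookup p m" by (simp add: qcoeff_def kl)
    finally show ?thesis by simp
  qed
qed

lemma prod_single: "(\<Prod>i\<in>S. Poly_Mapping.single (g i) (1::'a::comm_semiring_1)) = Poly_Mapping.single (\<Sum>i\<in>S. g i) 1"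
  by (induction S rule: infinite_finite_induct) (auto simp: mult_single)

lemma mvar_power: "(mvar i :: 'a::comm_ring_1 mpoly) ^ k = Poly_Mapping.single (Poly_Mapping.single i k) 1"
proof (induction k)
  case (Suc k)
  have "(mvar i :: 'a mpoly) ^ Suc k = Poly_Mapping.single (Poly_Mapping.single i 1 + Poly_Mapping.single i k) 1"
    unfolding power_Suc Suc by (simp add: mvar_def mult_single)
  then show ?case by (simp add: single_add[symmetric])
qed simp

text \<open>The substitution permutes monomials, \<open>perm\<close> being its action on exponent
  vectors. Distinct monomials of degree 2 stay distinct, so a single term contributes to the
  coefficient.\<close>

lemma lookup_msubst_permute:
  fixes p :: "'a::comm_ring_1 mpoly"
  assumes \<sigma>: "\<sigma> permutes {1..n}" and p: "p \<in> homogeneous_part n 2" and ab: "a \<in> {1..n}" "b \<in> {1..n}"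
  shows "Poly_Mapping.lookup (msubst n (\<lambda>j. mvar (\<sigma> j)) p) (var2 (\<sigma> a) (\<sigma> b)) = Poly_Mapping.lookup p (var2 a b)"
proof -
  define perm where "perm m = (\<Sum>i = 1..n. Poly_Mapping.single (\<sigma> i) (Poly_Mapping.lookup m i))" for m :: "nat \<Rightarrow>\<^sub>0 nat"
  have pv: "perm (Poly_Mapping.single k 1) = Poly_Mapping.single (\<sigma> k) 1" if "k \<in> {1..n}" for k
  proof -
    have "perm (Poly_Mapping.single k 1) = (\<Sum>i = 1..n. if i = k then Poly_Mapping.single (\<sigma> k) 1 else 0)"
      unfolding perm_def by (intro sum.cong refl) (auto simp: lookup_single when_def)
    then show ?thesis using that by simp
  qed
  have padd: "perm (m + m') = perm m + perm m'" for m m'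
    by (simp add: perm_def lookup_add single_add sum.distrib)
  have pvar2: "perm (var2 k l) = var2 (\<sigma> k) (\<sigma> l)" if "k \<in> {1..n}" "l \<in> {1..n}" for k l
    using that by (simp add: padd pv[simplified])
  have "msubst n (\<lambda>j. mvar (\<sigma> j)) p = (\<Sum>m\<in>Poly_Mapping.keys p. Poly_Mapping.single (perm m) (Poly_Mapping.lookup p m))"
    unfolding msubst_def mvar_power prod_single mconst_mult_single perm_def by simp
  then have "Poly_Mapping.lookup (msubst n (\<lambda>j. mvar (\<sigma> j)) p) (var2 (\<sigma> a) (\<sigma> b)) =
    (\<Sum>m\<in>Poly_Mapping.keys p. if perm m = perm (var2 a b) then Poly_Mapping.lookup p m else 0)"
    using pvar2[OF ab] by (simp add: lookup_sum lookup_single when_def)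
  also have "\<dots> = (\<Sum>m\<in>Poly_Mapping.keys p. if m = var2 a b then Poly_Mapping.lookup p m else 0)"
  proof (intro sum.cong refl)
    fix m assume "m \<in> Poly_Mapping.keys p"
    then have "m \<in> mons n 2" using p by (auto simp: homogeneous_part_iff)
    then obtain k l where kl: "k \<in> {1..n}" "l \<in> {1..n}" "m = var2 k l" by (rule mons_2)
    have "perm m = perm (var2 a b) \<longleftrightarrow> m = var2 a b"
      unfolding kl(3) pvar2[OF kl(1,2)] pvar2[OF ab] var2_eq_iff using permutes_inj[OF \<sigma>] by (auto dest: injD)
    then show "(if perm m = perm (var2 a b) then Poly_Mapping.lookup p m else 0) = (if m = var2 a b then Poly_Mapping.lookup p m else 0)"
      by simp
  qed
  also have "\<dots> = Poly_Mapping.lookup p (var2 a b)"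
    by (simp add: in_keys_iff)
  finally show ?thesis .
qed

text \<open>Up to exchanging a and b, the triples (i, a, b) form at most four orbits: all equal;
  exactly one of a, b equal to i; a = b different from i; all distinct. The last clause exploits the
  freedom in \<open>D\<close> when there are no three distinct indices.\<close>

lemma equivariant_coeffs:
  fixes c :: "nat \<Rightarrow> nat \<Rightarrow> nat \<Rightarrow> 'a::field_char_0"
  assumes inv: "\<And>\<sigma> i a b. \<sigma> permutes {1..n} \<Longrightarrow> i \<in> {1..n} \<Longrightarrow> a \<in> {1..n} \<Longrightarrow> b \<in> {1..n} \<Longrightarrow>
      c (\<sigma> i) (\<sigma> a) (\<sigma> b) = c i a b"
    and comm: "\<And>i a b. c i a b = c i b a"
  shows "\<exists>A B C D. (\<forall>i\<in>{1..n}. \<forall>a\<in>{1..n}. \<forall>b\<in>{1..n}. c i a b =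
      (if a = i \<and> b = i then A else if a = i \<or> b = i then B else if a = b then C else D)) \<and>
      (n \<le> 2 \<longrightarrow> A - C - 2 * B + 2 * D \<noteq> 0)"
proof -
  define A B C where "A = c 1 1 1" and "B = c 1 1 2" and "C = c 1 2 2"
  \<comment> \<open>For n at most 2 this value makes the expression in the last clause equal to
    1.\<close>
  define D where "D = (if n \<le> 2 then (1 - A + C + 2 * B) / 2 else c 1 2 3)"
  have diag: "c i i i = A" if "i \<in> {1..n}" for i
  proof -
    have n: "1 \<in> {1..n}" using that by auto
    have "\<exists>\<sigma>. \<sigma> permutes {1..n} \<and> map \<sigma> [1] = [i]"
      using that n by (intro permutation_map_list) auto
    then obtain \<sigma> where \<sigma>: "\<sigma> permutes {1..n}" "map \<sigma> [1] = [i]" by (elim exE conjE)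
    then show ?thesis using inv[OF \<sigma>(1), of 1 1 1] that by (simp add: A_def)
  qed
  have two: "c i i a = B \<and> c i a a = C" if "i \<in> {1..n}" "a \<in> {1..n}" "a \<noteq> i" for i a
  proof -
    have n: "1 \<in> {1..n}" "2 \<in> {1..n}" using that by auto
    have "\<exists>\<sigma>. \<sigma> permutes {1..n} \<and> map \<sigma> [1, 2] = [i, a]"
      using that n by (intro permutation_map_list) auto
    then obtain \<sigma> where \<sigma>: "\<sigma> permutes {1..n}" "map \<sigma> [1, 2] = [i, a]" by (elim exE conjE)
    then show ?thesis using inv[OF \<sigma>(1) n(1,1,2)] inv[OF \<sigma>(1) n(1,2,2)] by (simp add: B_def C_def)
  qed
  have three: "c i a b = D" if "i \<in> {1..n}" "a \<in> {1..n}" "b \<in> {1..n}" "a \<noteq> i" "b \<noteq> i" "a \<noteq> b" for i a b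
  proof -
    have n: "1 \<in> {1..n}" "2 \<in> {1..n}" "3 \<in> {1..n}" using that by auto
    have "\<exists>\<sigma>. \<sigma> permutes {1..n} \<and> map \<sigma> [1, 2, 3] = [i, a, b]"
      using that n by (intro permutation_map_list) auto
    then obtain \<sigma> where \<sigma>: "\<sigma> permutes {1..n}" "map \<sigma> [1, 2, 3] = [i, a, b]" by (elim exE conjE)
    then show ?thesis using inv[OF \<sigma>(1) n] n by (simp add: D_def)
  qed
  have "2 * D = 1 - A + C + 2 * B" if "n \<le> 2" using that by (simp add: D_def)
  then have "n \<le> 2 \<longrightarrow> A - C - 2 * B + 2 * D \<noteq> 0" by simp
  moreover have "c i a b = (if a = i \<and> b = i then A else if a = i \<or> b = i then B else if a = b then C else D)"
    if "i \<in> {1..n}" "a \<in> {1..n}" "b \<in> {1..n}" for i a b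
    using diag[of i] two[of i a] two[of i b] three[of i a b] comm[of i a b] that by auto
  ultimately show ?thesis by blast
qed

lemma quadric_normal_form:
  fixes f :: "nat \<Rightarrow> 'a::field_char_0 mpoly"
  assumes quadrics: "\<And>i. i \<in> {1..n} \<Longrightarrow> f i \<in> homogeneous_part n 2"
    and equivariant: "\<And>\<sigma> i. \<sigma> permutes {1..n} \<Longrightarrow> i \<in> {1..n} \<Longrightarrow> msubst n (\<lambda>j. mvar (\<sigma> j)) (f i) = f (\<sigma> i)"
    and e: "e = (\<Sum>i = 1..n. mvar i)"
  shows "\<exists>\<alpha> \<beta> \<gamma> \<delta>. (\<forall>i\<in>{1..n}. f i = mconst \<alpha> * (mvar i * mvar i) + mconst \<beta> * (mvar i * e)
      + mconst \<gamma> * (\<Sum>j = 1..n. mvar j * mvar j) + mconst \<delta> * (e * e)) \<and> (n \<le> 2 \<longrightarrow> \<alpha> \<noteq> 0)"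
proof -
  have inv: "qcoeff (f (\<sigma> i)) (\<sigma> a) (\<sigma> b) = qcoeff (f i) a b"
    if "\<sigma> permutes {1..n}" "i \<in> {1..n}" "a \<in> {1..n}" "b \<in> {1..n}" for \<sigma> i a b
  proof -
    have "Poly_Mapping.lookup (f (\<sigma> i)) (var2 (\<sigma> a) (\<sigma> b)) = Poly_Mapping.lookup (f i) (var2 a b)"
      using lookup_msubst_permute[OF that(1) quadrics[OF that(2)] that(3,4)] equivariant[OF that(1,2)] by simp
    then show ?thesis using injD[OF permutes_inj[OF that(1)], of a b] by (auto simp: qcoeff_def)
  qed
  obtain A B C D where c: "\<And>i a b. i \<in> {1..n} \<Longrightarrow> a \<in> {1..n} \<Longrightarrow> b \<in> {1..n} \<Longrightarrow> qcoeff (f i) a b =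
      (if a = i \<and> b = i then A else if a = i \<or> b = i then B else if a = b then C else D)"
    and nz: "n \<le> 2 \<longrightarrow> A - C - 2 * B + 2 * D \<noteq> 0"
    using equivariant_coeffs[of n "\<lambda>i. qcoeff (f i)", OF inv qcoeff_commute] by blast
  \<comment> \<open>The matrix of \<open>f i\<close> is \<open>D\<close> everywhere, plus
    \<open>C - D\<close> on the diagonal, plus \<open>B - D\<close> on row i and on column i;
    \<open>?\<alpha>\<close> is the remaining correction at the entry (i, i).\<close>
  let ?\<alpha> = "A - C - 2 * B + 2 * D"
  have "f i = mconst ?\<alpha> * (mvar i * mvar i) + mconst (2 * (B - D)) * (mvar i * e)
      + mconst (C - D) * (\<Sum>j = 1..n. mvar j * mvar j) + mconst D * (e * e)" if i: "i \<in> {1..n}" for i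
  proof -
    have "f i = (\<Sum>a = 1..n. \<Sum>b = 1..n. mconst (qcoeff (f i) a b) * (mvar a * mvar b))"
      by (rule quadratic_form[OF quadrics[OF i]])
    also have "\<dots> = (\<Sum>a = 1..n. \<Sum>b = 1..n. mconst D * (mvar a * mvar b)
       + ((if b = a then mconst (C - D) * (mvar a * mvar b) else 0)
       + ((if a = i then mconst (B - D) * (mvar a * mvar b) else 0)
       + ((if b = i then mconst (B - D) * (mvar a * mvar b) else 0)
       + (if a = i then if b = i then mconst ?\<alpha> * (mvar a * mvar b) else 0 else 0)))))"
    proof (intro sum.cong refl)
      fix a b assume "a \<in> {1..n}" "b \<in> {1..n}"
      then show "mconst (qcoeff (f i) a b) * (mvar a * mvar b) = mconst D * (mvar a * mvar b)
       + ((if b = a then mconst (C - D) * (mvar a * mvar b) else 0)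
       + ((if a = i then mconst (B - D) * (mvar a * mvar b) else 0)
       + ((if b = i then mconst (B - D) * (mvar a * mvar b) else 0)
       + (if a = i then if b = i then mconst ?\<alpha> * (mvar a * mvar b) else 0 else 0))))"
        using i by (auto simp: c mconst_add mconst_diff mconst_mult mconst_numeral algebra_simps)
    qed
    also have "\<dots> = mconst D * (e * e) + (mconst (C - D) * (\<Sum>j = 1..n. mvar j * mvar j)
       + (mconst (B - D) * (mvar i * e) + (mconst (B - D) * (mvar i * e) + mconst ?\<alpha> * (mvar i * mvar i))))"
    proof -
      have 1: "(\<Sum>a = 1..n. \<Sum>b = 1..n. mconst D * (mvar a * mvar b)) = mconst D * (e * e)"
        unfolding e sum_product unfolding sum_distrib_left ..
      have 2: "(\<Sum>a = 1..n. \<Sum>b = 1..n. if b = a then mconst (C - D) * (mvar a * mvar b) else 0) =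
          mconst (C - D) * (\<Sum>j = 1..n. mvar j * mvar j)"
        by (simp add: sum_distrib_left)
      have 3: "(\<Sum>a = 1..n. \<Sum>b = 1..n. if a = i then mconst (B - D) * (mvar a * mvar b) else 0) = mconst (B - D) * (mvar i * e)"
      proof -
        have "(\<Sum>a = 1..n. \<Sum>b = 1..n. if a = i then mconst (B - D) * (mvar a * mvar b) else 0) =
           (\<Sum>a = 1..n. if a = i then mconst (B - D) * (mvar i * e) else 0)"
          by (intro sum.cong refl) (simp add: e sum_distrib_left)
        then show ?thesis using i by simp
      qed
      have 4: "(\<Sum>a = 1..n. \<Sum>b = 1..n. if b = i then mconst (B - D) * (mvar a * mvar b) else 0) = mconst (B - D) * (mvar i * e)"
        using i by (simp add: e sum_distrib_left mult.commute)
      have 5: "(\<Sum>a = 1..n. \<Sum>b = 1..n. if a = i then if b = i then mconst ?\<alpha> * (mvar a * mvar b) else 0 else 0) = mconst ?\<alpha> * (mvar i * mvar i)"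
      proof -
        have "(\<Sum>a = 1..n. \<Sum>b = 1..n. if a = i then if b = i then mconst ?\<alpha> * (mvar a * mvar b) else 0 else 0) =
           (\<Sum>a = 1..n. \<Sum>b = 1..n. if a = i then if b = i then mconst ?\<alpha> * (mvar i * mvar i) else 0 else 0)"
          by (intro sum.cong refl) simp
        then show ?thesis using i by (simp only: sum_sum_delta finite_atLeastAtMost)
      qed
      show ?thesis unfolding sum.distrib 1 2 3 4 5 ..
    qed
    moreover have "mconst (2 * (B - D)) = mconst (B - D) + mconst (B - D)"
      by (simp only: mult_2 mconst_add)
    ultimately show ?thesis by (simp only: ring_distribs add_ac)
  qed
  then show ?thesis using nz by blast
qed

section \<open>The quotient algebra\<close>

lemma carrier_zero [simp]: "0 \<in> carrier (poly_algebra n)" by (simp add: poly_algebra_def)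
lemma carrier_one [simp]: "1 \<in> carrier (poly_algebra n)" using hom_1 by (rule hom_carrier)
lemma carrier_mconst [simp]: "mconst a \<in> carrier (poly_algebra n)" using hom_mconst by (rule hom_carrier)
lemma carrier_add [intro]: "p \<in> carrier (poly_algebra n) \<Longrightarrow> q \<in> carrier (poly_algebra n) \<Longrightarrow> p + q \<in> carrier (poly_algebra n)"
  unfolding carrier_poly_iff by (simp add: lookup_add)
lemma carrier_diff [intro]: "p \<in> carrier (poly_algebra n) \<Longrightarrow> q \<in> carrier (poly_algebra n) \<Longrightarrow> p - q \<in> carrier (poly_algebra n)"
  unfolding carrier_poly_iff by (simp add: lookup_minus)
lemma carrier_mult [intro]:
  assumes "p \<in> carrier (poly_algebra n)" "q \<in> carrier (poly_algebra n)"
  shows "p * q \<in> carrier (poly_algebra n)"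
  unfolding poly_algebra_def
proof (simp, intro ballI)
  fix m assume "m \<in> Poly_Mapping.keys (p * q)"
  then obtain a b where "m = a + b" "a \<in> Poly_Mapping.keys p" "b \<in> Poly_Mapping.keys q"
    using keys_mult by blast
  moreover have "Poly_Mapping.keys (a + b) \<subseteq> Poly_Mapping.keys a \<union> Poly_Mapping.keys b" for a b :: "nat \<Rightarrow>\<^sub>0 nat"
    by (rule keys_add)
  ultimately show "Poly_Mapping.keys m \<subseteq> {Suc 0..n}"
    using assms unfolding poly_algebra_def by fastforce
qed
lemma carrier_sum [intro]: "(\<And>i. i \<in> S \<Longrightarrow> p i \<in> carrier (poly_algebra n)) \<Longrightarrow> sum p S \<in> carrier (poly_algebra n)"
  by (induction S rule: infinite_finite_induct) auto
lemma carrier_power [intro]: "p \<in> carrier (poly_algebra n) \<Longrightarrow> p ^ k \<in> carrier (poly_algebra n)"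
  by (induction k) auto

lemma poly_algebra_ops [simp]:
  "monoid.mult (poly_algebra n) = (*)" "monoid.one (poly_algebra n) = 1" "ring.zero (poly_algebra n) = 0"
  "ring.add (poly_algebra n) = (+)" "module.smult (poly_algebra n) = (\<lambda>a p. mconst a * p)"
  by (simp_all add: poly_algebra_def)

lemma cring_poly_algebra: "cring (poly_algebra n :: ('a::comm_ring_1, 'a mpoly) module)"
proof (rule cringI)
  show "abelian_group (poly_algebra n :: ('a, 'a mpoly) module)"
  proof (rule abelian_groupI)
    fix x :: "'a mpoly" assume "x \<in> carrier (poly_algebra n)"
    then show "\<exists>y\<in>carrier (poly_algebra n). y \<oplus>\<^bsub>poly_algebra n\<^esub> x = \<zero>\<^bsub>poly_algebra n\<^esub>"
      using carrier_diff[OF carrier_zero] by (intro bexI[of _ "0 - x"]) auto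
  qed (auto simp: add_ac)
  show "comm_monoid (poly_algebra n :: ('a, 'a mpoly) module)"
    by (rule comm_monoidI) (auto simp: mult_ac)
qed (auto simp: ring_distribs)

lemma ideal_closed:
  assumes "ideal I (poly_algebra n :: ('a::comm_ring_1, 'a mpoly) module)"
  shows "0 \<in> I" "\<And>p q. p \<in> I \<Longrightarrow> q \<in> I \<Longrightarrow> p + q \<in> I"
    "\<And>p q. p \<in> I \<Longrightarrow> q \<in> carrier (poly_algebra n) \<Longrightarrow> q * p \<in> I"
  using additive_subgroup.zero_closed[OF ideal.axioms(1)[OF assms]]
    additive_subgroup.a_closed[OF ideal.axioms(1)[OF assms]] ideal.I_l_closed[OF assms] by simp_all

lemma gen_ideal_is_ideal:
  "ideal (gen_ideal f k \<inter> carrier (poly_algebra n)) (poly_algebra n :: ('a::comm_ring_1, 'a mpoly) module)"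
proof (rule idealI)
  let ?R = "poly_algebra n :: ('a, 'a mpoly) module"
  interpret R: cring ?R by (rule cring_poly_algebra)
  show "ring ?R" by unfold_locales
  show "subgroup (gen_ideal f k \<inter> carrier ?R) (add_monoid ?R)"
  proof (rule R.add.subgroupI)
    fix a assume a: "a \<in> gen_ideal f k \<inter> carrier ?R"
    have "0 - a \<in> gen_ideal f k \<inter> carrier ?R"
      using a carrier_diff[OF carrier_zero] gen_ideal_diff[OF gen_ideal_zero] by blast
    moreover have "\<ominus>\<^bsub>?R\<^esub> a = 0 - a"
      using a calculation by (intro R.minus_equality) auto
    ultimately show "\<ominus>\<^bsub>?R\<^esub> a \<in> gen_ideal f k \<inter> carrier ?R" by simp
  qed (auto intro: gen_ideal_add, use gen_ideal_zero carrier_zero in blast)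
next
  fix a x :: "'a mpoly"
  assume a: "a \<in> gen_ideal f k \<inter> carrier (poly_algebra n)" and x: "x \<in> carrier (poly_algebra n)"
  then have "x * a \<in> gen_ideal f k \<inter> carrier (poly_algebra n)"
    using gen_ideal_mult carrier_mult by blast
  then show "x \<otimes>\<^bsub>poly_algebra n\<^esub> a \<in> gen_ideal f k \<inter> carrier (poly_algebra n)"
    "a \<otimes>\<^bsub>poly_algebra n\<^esub> x \<in> gen_ideal f k \<inter> carrier (poly_algebra n)"
    by (simp_all add: mult.commute)
qed

text \<open>The nontrivial inclusion removes foreign variables from the coefficients: an element of
  the carrier is the sum of its homogeneous parts, and each part is a combination with coefficients
  \<open>proj n e (g i)\<close>.\<close>

lemma genideal_eq:
  fixes f :: "nat \<Rightarrow> 'a::comm_ring_1 mpoly"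
  assumes f: "\<And>i. i \<in> {1..k} \<Longrightarrow> f i \<in> homogeneous_part n 2"
  shows "Idl\<^bsub>poly_algebra n\<^esub> (f ` {1..k}) = gen_ideal f k \<inter> carrier (poly_algebra n)"
proof
  let ?R = "poly_algebra n :: ('a, 'a mpoly) module"
  interpret R: cring ?R by (rule cring_poly_algebra)
  have fC: "f ` {1..k} \<subseteq> carrier ?R" using f hom_carrier by blast
  have "f ` {1..k} \<subseteq> gen_ideal f k \<inter> carrier ?R" using fC gen_ideal_gen by blast
  then show "Idl\<^bsub>?R\<^esub> (f ` {1..k}) \<subseteq> gen_ideal f k \<inter> carrier ?R"
    by (rule R.genideal_minimal[OF gen_ideal_is_ideal])
  define K where "K = Idl\<^bsub>?R\<^esub> (f ` {1..k})"
  have "ideal K ?R" unfolding K_def by (rule R.genideal_ideal[OF fC])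
  note K_closed = ideal_closed[OF this]
  have K_gen: "f i \<in> K" if "i \<in> {1..k}" for i using R.genideal_self[OF fC] that unfolding K_def by blast
  have K_sum: "(\<And>i. i \<in> S \<Longrightarrow> p i \<in> K) \<Longrightarrow> sum p S \<in> K" for p :: "nat \<Rightarrow> 'a mpoly" and S
    by (induction S rule: infinite_finite_induct) (auto intro: K_closed)
  show "gen_ideal f k \<inter> carrier ?R \<subseteq> Idl\<^bsub>?R\<^esub> (f ` {1..k})"
    unfolding K_def[symmetric]
  proof
    fix p assume p: "p \<in> gen_ideal f k \<inter> carrier ?R"
    then obtain g where g: "p = (\<Sum>i = 1..k. g i * f i)" by (auto simp: gen_ideal_def)
    have pd: "proj n d p \<in> K" for d
    proof (cases "d < 2")
      case True
      then have "proj n d p = 0" unfolding g proj_sum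
        by (intro sum.neutral ballI proj_mult_low[OF f]) auto
      then show ?thesis using K_closed(1) by simp
    next
      case False
      then obtain e where d: "d = e + 2" using le_Suc_ex[of 2 d] by (auto simp: add.commute)
      have "proj n d p = (\<Sum>i = 1..k. proj n e (g i) * f i)" unfolding g proj_sum d
        by (intro sum.cong refl proj_mult[OF f])
      then show ?thesis using K_closed(3)[OF K_gen hom_carrier[OF proj_hom]] by (auto intro: K_sum)
    qed
    obtain N where N: "p = (\<Sum>d\<le>N. proj n d p)" using p carrier_decomp by blast
    show "p \<in> K" by (subst N, rule K_sum, rule pd)
  qed
qed

text \<open>Congruences are tested in \<open>J\<close>, the ideal of the whole type; for differences
  of elements of \<open>C\<close> this agrees with membership in \<open>I\<close>.\<close>

locale poly_quotient =
  fixes n :: nat and f :: "nat \<Rightarrow> 'a::field_char_0 mpoly"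
    and C :: "'a mpoly set" and J I :: "'a mpoly set" and R :: "('a, 'a mpoly) module"
    and A :: "('a, 'a mpoly set) module" and G :: "nat \<Rightarrow> 'a mpoly set set"
    and cl :: "'a mpoly \<Rightarrow> 'a mpoly set"
  defines "R \<equiv> poly_algebra n" and "C \<equiv> carrier R" and "J \<equiv> gen_ideal f n" and "I \<equiv> J \<inter> C"
    and "A \<equiv> quot_algebra R I" and "G \<equiv> quot_grading R (homogeneous_part n) I"
    and "cl \<equiv> \<lambda>p. I +>\<^bsub>R\<^esub> p"
  assumes f: "\<And>i. i \<in> {1..n} \<Longrightarrow> f i \<in> homogeneous_part n 2"
begin

lemma ideal_I: "ideal I R"
  unfolding I_def J_def C_def R_def by (rule gen_ideal_is_ideal)

lemma homC: "p \<in> homogeneous_part n d \<Longrightarrow> p \<in> C" unfolding C_def R_def by (rule hom_carrier)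

lemma C_closed: "0 \<in> C" "1 \<in> C" "mconst a \<in> C"
  "p \<in> C \<Longrightarrow> q \<in> C \<Longrightarrow> p + q \<in> C"
  "p \<in> C \<Longrightarrow> q \<in> C \<Longrightarrow> p - q \<in> C"
  "p \<in> C \<Longrightarrow> q \<in> C \<Longrightarrow> p * q \<in> C"
  "(\<And>i. i \<in> S \<Longrightarrow> h i \<in> C) \<Longrightarrow> sum h S \<in> C"
  "p \<in> C \<Longrightarrow> p ^ k \<in> C"
  unfolding C_def R_def by (auto simp: carrier_mult carrier_power carrier_diff)

lemmas J_closed = gen_ideal_zero[of f n, folded J_def] gen_ideal_add[of _ f n, folded J_def]
  gen_ideal_mult[of _ f n, folded J_def] gen_ideal_diff[of _ f n, folded J_def]

lemma J_sum: "(\<And>i. i \<in> S \<Longrightarrow> p i \<in> J) \<Longrightarrow> sum p S \<in> J"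
  by (induction S rule: infinite_finite_induct) (auto intro: J_closed)

lemma cl_eq: assumes "p \<in> C" "q \<in> C" shows "cl p = cl q \<longleftrightarrow> p - q \<in> J"
proof -
  have cl: "cl p = (\<lambda>h. h + p) ` I" for p
    unfolding cl_def a_r_coset_def' by (auto simp: R_def)
  have mem: "h \<in> cl p \<longleftrightarrow> h - p \<in> I" for h p
    unfolding cl by (auto intro: image_eqI[of _ _ "h - p"])
  show ?thesis
  proof
    assume eq: "cl p = cl q"
    have "p \<in> cl p" unfolding mem using J_closed(1) C_closed(1) by (simp add: I_def)
    then show "p - q \<in> J" unfolding eq mem by (simp add: I_def)
  next
    assume pq: "p - q \<in> J"
    then have pqI: "p - q \<in> I" "q - p \<in> I"
      using assms C_closed(5) J_closed(4)[OF J_closed(1) pq] by (auto simp: I_def)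
    have I_add: "a \<in> I \<Longrightarrow> b \<in> I \<Longrightarrow> a + b \<in> I" for a b
      using J_closed(2) C_closed(4) by (simp add: I_def)
    show "cl p = cl q"
    proof (intro equalityI subsetI)
      show "h \<in> cl q" if "h \<in> cl p" for h
        using I_add[OF that[unfolded mem] pqI(1)] by (simp add: mem)
      show "h \<in> cl p" if "h \<in> cl q" for h
        using I_add[OF that[unfolded mem] pqI(2)] by (simp add: mem)
    qed
  qed
qed

lemma carrier_A: "carrier A = cl ` C"
  by (auto simp: A_def quot_algebra_def FactRing_def A_RCOSETS_def RCOSETS_def cl_def C_def a_r_coset_def)

lemma A_add: "p \<in> C \<Longrightarrow> q \<in> C \<Longrightarrow> cl p \<oplus>\<^bsub>A\<^esub> cl q = cl (p + q)"
  using ideal.a_rcos_sum[OF ideal_I, of p q]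
  by (simp add: A_def quot_algebra_def FactRing_def cl_def C_def R_def)

lemma A_mult: "p \<in> C \<Longrightarrow> q \<in> C \<Longrightarrow> cl p \<otimes>\<^bsub>A\<^esub> cl q = cl (p * q)"
  using ideal.rcoset_mult_add[OF ideal_I, of p q]
  by (simp add: A_def quot_algebra_def FactRing_def cl_def C_def R_def)

lemma A_one: "\<one>\<^bsub>A\<^esub> = cl 1"
  by (simp add: A_def quot_algebra_def FactRing_def cl_def R_def)

lemma A_zero: "\<zero>\<^bsub>A\<^esub> = cl 0"
  by (simp add: A_def quot_algebra_def FactRing_def cl_def R_def a_r_coset_def')

lemma A_smult: "p \<in> C \<Longrightarrow> a \<odot>\<^bsub>A\<^esub> cl p = cl (mconst a * p)"
  using ideal.rcoset_mult_add[OF ideal_I, of "mconst a" p] C_closed(3)[of a]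
  by (simp add: A_def quot_algebra_def FactRing_def cl_def C_def R_def)

lemma G_eq: "G d = cl ` homogeneous_part n d"
  by (simp add: G_def quot_grading_def cl_def)

lemmas A_simps = A_add A_mult A_one A_zero A_smult

lemma cring_A: "cring A"
proof (rule cringI)
  show "abelian_group A"
  proof (rule abelian_groupI)
    fix x assume "x \<in> carrier A"
    then obtain p where "p \<in> C" "x = cl p" by (auto simp: carrier_A)
    then show "\<exists>y\<in>carrier A. y \<oplus>\<^bsub>A\<^esub> x = \<zero>\<^bsub>A\<^esub>"
      using C_closed(5)[OF C_closed(1)] by (intro bexI[of _ "cl (0 - p)"]) (auto simp: A_simps carrier_A)
  qed (auto simp: A_simps carrier_A C_closed add_ac)
  show "comm_monoid A"
    by (rule comm_monoidI) (auto simp: A_simps carrier_A C_closed mult_ac)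
qed (auto simp: A_simps carrier_A C_closed ring_distribs)

lemma algebra_A: "algebra ring_of_type_algebra A"
  by (rule algebraI[OF cring_from_type_algebra cring_A])
    (auto simp: A_simps carrier_A C_closed ring_of_type_algebra_def mconst_add mconst_mult ring_distribs mult_ac)

lemma A_finsum:
  assumes "finite S" "\<And>i. i \<in> S \<Longrightarrow> p i \<in> C"
  shows "finsum A (\<lambda>i. cl (p i)) S = cl (\<Sum>i\<in>S. p i)"
proof -
  interpret A: cring A by (rule cring_A)
  show ?thesis using assms
  proof (induction S rule: finite_induct)
    case (insert i S)
    then have "finsum A (\<lambda>i. cl (p i)) (insert i S) = cl (p i) \<oplus>\<^bsub>A\<^esub> finsum A (\<lambda>i. cl (p i)) S"
      by (intro A.finsum_insert) (auto simp: carrier_A)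
    then show ?case using insert by (simp add: A_add C_closed)
  qed (simp add: A_zero)
qed

lemma submodule_G: "submodule (G i) ring_of_type_algebra A"
proof -
  interpret A: algebra ring_of_type_algebra A by (rule algebra_A)
  show ?thesis
  proof (rule A.submoduleI)
    show "G i \<subseteq> carrier A" using homC by (auto simp: G_eq carrier_A)
    show "\<zero>\<^bsub>A\<^esub> \<in> G i" by (auto simp: G_eq A_zero)
    fix a assume "a \<in> G i"
    then obtain p where p: "p \<in> homogeneous_part n i" "a = cl p" by (auto simp: G_eq)
    have "0 - p \<in> homogeneous_part n i" using hom_diff[OF hom_0 p(1)] .
    moreover have "\<ominus>\<^bsub>A\<^esub> a = cl (0 - p)"
      by (rule A.minus_equality) (use p calculation homC in \<open>auto simp: A_simps carrier_A\<close>)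
    ultimately show "\<ominus>\<^bsub>A\<^esub> a \<in> G i" by (auto simp: G_eq)
  next
    fix a b assume "a \<in> G i" "b \<in> G i"
    then show "a \<oplus>\<^bsub>A\<^esub> b \<in> G i" using homC by (auto simp: G_eq A_add)
  next
    fix a :: 'a and x assume "x \<in> G i"
    then show "a \<odot>\<^bsub>A\<^esub> x \<in> G i" using homC by (auto simp: G_eq A_smult)
  qed
qed

lemma proj_J: "p \<in> J \<Longrightarrow> proj n d p \<in> J"
  unfolding J_def by (rule proj_gen_ideal[OF f])

lemma cl_zero_iff: "p \<in> C \<Longrightarrow> cl p = cl 0 \<longleftrightarrow> p \<in> J"
  using cl_eq[of p 0] C_closed(1) by simp

text \<open>Existence takes the classes of the homogeneous parts; uniqueness rests on
  \<open>proj_J\<close>, the homogeneity of the ideal.\<close>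

lemma graded_A: "graded_vector_space ring_of_type_algebra A G"
  unfolding graded_vector_space_def
proof (intro conjI allI ballI submodule_G field_from_type_algebra)
  show "Module.module ring_of_type_algebra A"
    using algebra_A by (simp add: algebra_def)
next
  fix v assume "v \<in> carrier A"
  then obtain p where p: "p \<in> C" "v = cl p" by (auto simp: carrier_A)
  let ?Q = "\<lambda>u. (\<forall>i. u i \<in> G i) \<and> finite {i. u i \<noteq> \<zero>\<^bsub>A\<^esub>} \<and> v = finsum A u {i. u i \<noteq> \<zero>\<^bsub>A\<^esub>}"
  have pC: "proj n i q \<in> C" for i q by (rule homC[OF proj_hom])
  show "\<exists>!u. ?Q u"
  proof (rule ex1I[of _ "\<lambda>i. cl (proj n i p)"])
    obtain N where N: "p = (\<Sum>d\<le>N. proj n d p)" "\<And>d. d > N \<Longrightarrow> proj n d p = 0"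
      using carrier_decomp[of p n] p(1) unfolding C_def R_def by blast
    let ?S = "{i. cl (proj n i p) \<noteq> \<zero>\<^bsub>A\<^esub>}"
    have sub: "?S \<subseteq> {..N}" using N(2) by (auto simp: A_zero not_less[symmetric])
    then have fin: "finite ?S" by (rule finite_subset) simp
    have "p - (\<Sum>d\<in>?S. proj n d p) = (\<Sum>d\<in>{..N} - ?S. proj n d p)"
      using N(1) sum.subset_diff[OF sub finite_atMost, of "\<lambda>d. proj n d p"] by (metis add_diff_cancel_right')
    also have "\<dots> \<in> J" by (rule J_sum) (use cl_zero_iff[OF pC] in \<open>auto simp: A_zero\<close>)
    finally have J: "p - (\<Sum>d\<in>?S. proj n d p) \<in> J" .
    have "(\<Sum>d\<in>?S. proj n d p) \<in> C" by (rule C_closed(7)) (rule pC)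
    then have "v = cl (\<Sum>d\<in>?S. proj n d p)" using cl_eq[OF p(1)] J p(2) by blast
    then have "v = finsum A (\<lambda>i. cl (proj n i p)) ?S"
      using A_finsum[OF fin, of "\<lambda>i. proj n i p"] pC by simp
    then show "?Q (\<lambda>i. cl (proj n i p))" using fin by (auto simp: G_eq)
  next
    fix u assume u: "?Q u"
    then have "\<forall>i. \<exists>q. q \<in> homogeneous_part n i \<and> u i = cl q" by (auto simp: G_eq)
    then obtain q where q: "\<And>i. q i \<in> homogeneous_part n i" "\<And>i. u i = cl (q i)" by metis
    let ?S = "{i. u i \<noteq> \<zero>\<^bsub>A\<^esub>}"
    have fin: "finite ?S" using u by blast
    have u_eq: "u = (\<lambda>i. cl (q i))" using q(2) by blast
    have "v = finsum A u ?S" using u by blast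
    also have "\<dots> = cl (\<Sum>i\<in>?S. q i)"
      using A_finsum[OF fin, of q] homC[OF q(1)] unfolding u_eq by blast
    finally have v_eq: "v = cl (\<Sum>i\<in>?S. q i)" .
    have "(\<Sum>i\<in>?S. q i) \<in> C" by (rule C_closed(7)) (rule homC[OF q(1)])
    then have J: "p - (\<Sum>i\<in>?S. q i) \<in> J" using cl_eq[OF p(1)] v_eq p(2) by blast
    have "u i = cl (proj n i p)" for i
    proof -
      have "proj n i (p - (\<Sum>i\<in>?S. q i)) = proj n i p - (\<Sum>j\<in>?S. if j = i then q i else 0)"
        unfolding proj_diff proj_sum
        by (intro arg_cong2[of _ _ _ _ minus] sum.cong refl) (simp add: proj_id[OF q(1)] proj_other[OF q(1)])
      also have "\<dots> = proj n i p - (if i \<in> ?S then q i else 0)"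
        using fin by (simp only: sum.delta)
      finally have d: "proj n i p - (if i \<in> ?S then q i else 0) \<in> J"
        using proj_J[OF J, of i] by simp
      show ?thesis
      proof (cases "i \<in> ?S")
        case True
        then have "proj n i p - q i \<in> J" using d by simp
        then have "cl (proj n i p) = cl (q i)" using cl_eq[OF pC homC[OF q(1)]] by blast
        then show ?thesis using q(2)[of i] by simp
      next
        case False
        then show ?thesis using d cl_zero_iff[OF pC, of i p] by (simp add: A_zero)
      qed
    qed
    then show "u = (\<lambda>i. cl (proj n i p))" by blast
  qed
qed

context
  assumes top: "\<And>d. n < d \<Longrightarrow> homogeneous_part n d \<subseteq> J"
begin

lemma finite_dim_A: "finite_dim_space ring_of_type_algebra A"
  unfolding finite_dim_space_def
proof (intro exI conjI ballI)
  define M where "M = (\<Union>d\<le>n. mons n d)"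
  define s :: "(nat \<Rightarrow>\<^sub>0 nat) \<Rightarrow> 'a mpoly" where "s m = Poly_Mapping.single m 1" for m
  let ?B = "(\<lambda>m. cl (s m)) ` M"
  have finM: "finite M" by (simp add: M_def)
  have sC: "s m \<in> C" if "m \<in> M" for m
    using that single_mem_hom[of m n] homC unfolding M_def s_def by blast
  show "?B \<subseteq> carrier A" using sC by (auto simp: carrier_A)
  show "finite ?B" using finM by simp
  fix v assume "v \<in> carrier A"
  then obtain p where p: "p \<in> C" "v = cl p" by (auto simp: carrier_A)
  \<comment> \<open>Different monomials may have the same class, while coefficients are indexed by
    classes; so the coefficients over each class are added up, and \<open>\<rho>\<close> picks one
    representative.\<close>
  define a where "a b = (\<Sum>m\<in>{m \<in> M. cl (s m) = b}. Poly_Mapping.lookup p m)" for b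
  define \<rho> where "\<rho> b = s (SOME m. m \<in> M \<and> cl (s m) = b)" for b
  have \<rho>: "\<rho> b \<in> C \<and> cl (\<rho> b) = b" if b: "b \<in> ?B" for b
  proof -
    have "\<exists>m. m \<in> M \<and> cl (s m) = b" using b by auto
    from someI_ex[OF this] show ?thesis unfolding \<rho>_def using sC by blast
  qed
  have "p - (\<Sum>m\<in>M. mconst (Poly_Mapping.lookup p m) * s m) \<in> J"
  proof -
    obtain N where N: "p = (\<Sum>d\<le>N. proj n d p)" "\<And>d. d > N \<Longrightarrow> proj n d p = 0"
      using carrier_decomp[of p n] p(1) unfolding C_def R_def by blast
    have "p = (\<Sum>d\<le>n + N. proj n d p)"
      by (subst N(1), rule sum.mono_neutral_left) (auto intro: N(2))
    also have "{..n + N} = {..n} \<union> {n<..n + N}" by auto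
    also have "(\<Sum>d\<in>{..n} \<union> {n<..n + N}. proj n d p) = (\<Sum>d\<le>n. proj n d p) + (\<Sum>d\<in>{n<..n + N}. proj n d p)"
      by (rule sum.union_disjoint) auto
    finally have p_eq: "p = (\<Sum>d\<le>n. proj n d p) + (\<Sum>d\<in>{n<..n + N}. proj n d p)" .
    have M_eq: "(\<Sum>d\<le>n. proj n d p) = (\<Sum>m\<in>M. mconst (Poly_Mapping.lookup p m) * s m)"
    proof (rule poly_mapping_eqI)
      fix m
      have "Poly_Mapping.lookup (\<Sum>d\<le>n. proj n d p) m = (if m \<in> M then Poly_Mapping.lookup p m else 0)"
      proof (cases "m \<in> M")
        case True
        then obtain d where d: "d \<le> n" "m \<in> mons n d" by (auto simp: M_def)
        then have "Poly_Mapping.lookup (\<Sum>d\<le>n. proj n d p) m = (\<Sum>d'\<le>n. if d' = d then Poly_Mapping.lookup p m else 0)"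
          unfolding lookup_sum lookup_proj by (intro sum.cong refl) (auto dest: mons_deg_unique)
        then show ?thesis using True d by simp
      next
        case False
        then show ?thesis unfolding lookup_sum lookup_proj by (auto simp: M_def intro: sum.neutral)
      qed
      then show "Poly_Mapping.lookup (\<Sum>d\<le>n. proj n d p) m =
          Poly_Mapping.lookup (\<Sum>m\<in>M. mconst (Poly_Mapping.lookup p m) * s m) m"
        by (simp add: s_def mconst_mult_single lookup_sum_single[OF finM])
    qed
    have "(\<Sum>d\<in>{n<..n + N}. proj n d p) \<in> J"
      using top proj_hom by (intro J_sum) (auto simp: subset_iff)
    moreover have "p - (\<Sum>m\<in>M. mconst (Poly_Mapping.lookup p m) * s m) = (\<Sum>d\<in>{n<..n + N}. proj n d p)"
      using arg_cong[OF p_eq[unfolded M_eq], of "\<lambda>q. q - (\<Sum>m\<in>M. mconst (Poly_Mapping.lookup p m) * s m)"]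
      by (simp only: add_diff_cancel_left')
    ultimately show ?thesis by simp
  qed
  moreover have "(\<Sum>m\<in>M. mconst (Poly_Mapping.lookup p m) * s m) - (\<Sum>b\<in>?B. mconst (a b) * \<rho> b) \<in> J"
  proof -
    have mc_sum: "mconst (sum h S) = (\<Sum>m\<in>S. mconst (h m))" for h :: "(nat \<Rightarrow>\<^sub>0 nat) \<Rightarrow> 'a" and S
      by (induction S rule: infinite_finite_induct) (auto simp: mconst_add)
    have "(\<Sum>m\<in>M. mconst (Poly_Mapping.lookup p m) * s m) - (\<Sum>b\<in>?B. mconst (a b) * \<rho> b) =
      (\<Sum>b\<in>?B. \<Sum>m\<in>{m \<in> M. cl (s m) = b}. mconst (Poly_Mapping.lookup p m) * (s m - \<rho> b))"
      unfolding sum.image_gen[OF finM, of _ "\<lambda>m. cl (s m)"] sum_subtractf[symmetric]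
      by (intro sum.cong refl) (simp add: a_def mc_sum sum_distrib_right right_diff_distrib sum_subtractf)
    also have "\<dots> \<in> J"
    proof (intro J_sum J_closed(3))
      fix b m assume "b \<in> ?B" "m \<in> {m \<in> M. cl (s m) = b}"
      then have "s m \<in> C" "\<rho> b \<in> C" "cl (s m) = cl (\<rho> b)" using sC \<rho> by auto
      then show "s m - \<rho> b \<in> J" using cl_eq by blast
    qed
    finally show ?thesis .
  qed
  ultimately have "p - (\<Sum>b\<in>?B. mconst (a b) * \<rho> b) \<in> J"
    using J_closed(2) by fastforce
  moreover have \<rho>C: "mconst (a b) * \<rho> b \<in> C" if "b \<in> ?B" for b
    using \<rho>[OF that] C_closed by blast
  moreover have "(\<Sum>b\<in>?B. mconst (a b) * \<rho> b) \<in> C" by (rule C_closed(7)) (rule \<rho>C)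
  ultimately have "v = cl (\<Sum>b\<in>?B. mconst (a b) * \<rho> b)"
    using cl_eq[OF p(1)] p(2) by blast
  also have "\<dots> = finsum A (\<lambda>b. cl (mconst (a b) * \<rho> b)) ?B"
    using A_finsum[OF _ \<rho>C, of ?B] finM by simp
  also have "\<dots> = finsum A (\<lambda>b. a b \<odot>\<^bsub>A\<^esub> b) ?B"
  proof -
    interpret A: cring A by (rule cring_A)
    have eq: "cl (mconst (a b) * \<rho> b) = a b \<odot>\<^bsub>A\<^esub> b" if "b \<in> ?B" for b
      using \<rho>[OF that] A_smult[of "\<rho> b" "a b"] by simp
    show ?thesis
    proof (rule A.finsum_cong')
      show "(\<lambda>b. a b \<odot>\<^bsub>A\<^esub> b) \<in> ?B \<rightarrow> carrier A"
        using eq[symmetric] \<rho>C by (auto simp: carrier_A)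
    qed (use eq in auto)
  qed
  finally show "\<exists>a\<in>?B \<rightarrow> carrier ring_of_type_algebra. v = finsum A (\<lambda>b. a b \<odot>\<^bsub>A\<^esub> b) ?B"
    by (intro bexI[of _ a]) (auto simp: ring_of_type_algebra_def)
qed

lemma artinian_A: "graded_artinian_algebra ring_of_type_algebra A G"
  unfolding graded_artinian_algebra_def
proof (intro conjI allI ballI algebra_A graded_A finite_dim_A)
  fix i j a b assume "a \<in> G i" "b \<in> G j"
  then show "a \<otimes>\<^bsub>A\<^esub> b \<in> G (i + j)" using homC by (auto simp: G_eq A_mult)
next
  have eq: "a \<odot>\<^bsub>A\<^esub> \<one>\<^bsub>A\<^esub> = cl (mconst a)" for a
    using A_smult[OF C_closed(2)] by (simp add: A_one)
  have inj: "x = y" if "cl (mconst x) = cl (mconst y)" for x y :: 'a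
  proof -
    have J: "mconst (x - y) \<in> J" using that cl_eq C_closed(3) by (simp add: mconst_diff)
    have "mconst (x - y) = 0"
      by (rule gen_ideal_low[OF f J[unfolded J_def] hom_mconst]) simp_all
    then have "Poly_Mapping.lookup (mconst (x - y)) 0 = 0" by simp
    then show ?thesis by (simp add: mconst_def)
  qed
  have "p \<in> range mconst" if "p \<in> homogeneous_part n 0" for p :: "'a mpoly"
  proof -
    have "p = mconst (Poly_Mapping.lookup p 0)"
      using that by (intro poly_mapping_eqI) (auto simp: homogeneous_part_lookup mons_0 mconst_def lookup_single when_def)
    then show ?thesis by blast
  qed
  then have "homogeneous_part n 0 = range (mconst :: 'a \<Rightarrow> _)" by auto
  then show "bij_betw (\<lambda>a. a \<odot>\<^bsub>A\<^esub> \<one>\<^bsub>A\<^esub>) (carrier ring_of_type_algebra) (G 0)"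
    unfolding eq G_eq bij_betw_def ring_of_type_algebra_def by (auto intro!: inj_onI inj)
qed

lemma strong_Lefschetz_elementI:
  assumes l: "l \<in> homogeneous_part n 1"
    and inj: "\<And>i p. 2 * i \<le> n \<Longrightarrow> p \<in> homogeneous_part n i \<Longrightarrow> l ^ (n - 2 * i) * p \<in> J \<Longrightarrow> p \<in> J"
    and surj: "\<And>i p. 2 * i \<le> n \<Longrightarrow> p \<in> homogeneous_part n (n - i) \<Longrightarrow>
      \<exists>q\<in>homogeneous_part n i. p - l ^ (n - 2 * i) * q \<in> J"
  shows "strong_Lefschetz_element ring_of_type_algebra A G (cl l)"
  unfolding strong_Lefschetz_element_def strong_Lefschetz_endo_def
proof (intro conjI artinian_A graded_A finite_dim_A)
  let ?L = "\<lambda>a. cl l \<otimes>\<^bsub>A\<^esub> a"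
  have lC: "l \<in> C" using homC l by blast
  have L: "?L (cl p) = cl (l * p)" if "p \<in> C" for p using A_mult lC that by blast
  show "cl l \<in> G 1" using l by (simp add: G_eq)
  show "linear_endo ring_of_type_algebra A ?L"
    unfolding linear_endo_def using lC
    by (auto simp: carrier_A A_simps C_closed ring_distribs mult_ac)
  have lh: "l * p \<in> homogeneous_part n (Suc i)" if "p \<in> homogeneous_part n i" for p i
    using hom_mult[OF l that] by simp
  show "\<forall>i. ?L ` G i \<subseteq> G (Suc i)"
    using lh homC L by (auto simp: G_eq)
  have Lk: "(?L ^^ k) (cl p) = cl (l ^ k * p)" if "p \<in> C" for p k
    using that lC by (induction k) (auto simp: L C_closed mult.assoc)
  have lk: "l ^ (n - 2 * i) * p \<in> homogeneous_part n (n - i)" if "2 * i \<le> n" "p \<in> homogeneous_part n i" for p i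
    by (rule hom_power_mult[OF l that(2,1)])
  show "\<exists>c. (\<forall>i\<ge>c + 1. G i = {\<zero>\<^bsub>A\<^esub>}) \<and> (\<forall>i\<le>c div 2. bij_betw (?L ^^ (c - 2 * i)) (G i) (G (c - i)))"
  proof (intro exI[of _ n] conjI allI impI)
    fix i assume i: "n + 1 \<le> i"
    have "cl p = cl 0" if "p \<in> homogeneous_part n i" for p
      using top[of i] i that cl_zero_iff[OF homC[OF that]] by auto
    then show "G i = {\<zero>\<^bsub>A\<^esub>}" unfolding G_eq A_zero using hom_0 by blast
  next
    fix i assume "i \<le> n div 2"
    then have i: "2 * i \<le> n" by simp
    show "bij_betw (?L ^^ (n - 2 * i)) (G i) (G (n - i))"
      unfolding bij_betw_def
    proof
      show "inj_on (?L ^^ (n - 2 * i)) (G i)"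
      proof (rule inj_onI)
        fix a b assume "a \<in> G i" "b \<in> G i" and eq: "(?L ^^ (n - 2 * i)) a = (?L ^^ (n - 2 * i)) b"
        then obtain p q where pq: "p \<in> homogeneous_part n i" "q \<in> homogeneous_part n i" "a = cl p" "b = cl q"
          by (auto simp: G_eq)
        have "l ^ (n - 2 * i) * p - l ^ (n - 2 * i) * q \<in> J"
          using eq Lk homC pq homC[OF lk[OF i]] by (simp add: cl_eq)
        then have "l ^ (n - 2 * i) * (p - q) \<in> J" by (simp add: right_diff_distrib)
        then have "p - q \<in> J" using inj[OF i hom_diff[OF pq(1,2)]] by blast
        then show "a = b" using pq cl_eq homC by blast
      qed
    next
      show "(?L ^^ (n - 2 * i)) ` G i = G (n - i)"
      proof (intro equalityI subsetI)
        fix b assume "b \<in> (?L ^^ (n - 2 * i)) ` G i"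
        then obtain p where p: "p \<in> homogeneous_part n i" "b = (?L ^^ (n - 2 * i)) (cl p)" by (auto simp: G_eq)
        then have "b = cl (l ^ (n - 2 * i) * p)" using Lk[OF homC[OF p(1)]] by simp
        then show "b \<in> G (n - i)" using lk[OF i p(1)] by (simp add: G_eq)
      next
        fix b assume "b \<in> G (n - i)"
        then obtain p where p: "p \<in> homogeneous_part n (n - i)" "b = cl p" by (auto simp: G_eq)
        then obtain q where q: "q \<in> homogeneous_part n i" "p - l ^ (n - 2 * i) * q \<in> J" using surj[OF i] by blast
        have "b = cl (l ^ (n - 2 * i) * q)" using p q cl_eq[OF homC[OF p(1)] homC[OF lk[OF i q(1)]]] by simp
        also have "\<dots> = (?L ^^ (n - 2 * i)) (cl q)" using Lk[OF homC[OF q(1)]] by simp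
        finally show "b \<in> (?L ^^ (n - 2 * i)) ` G i" using q(1) by (auto simp: G_eq)
      qed
    qed
  qed
qed

end

section \<open>Consequences of regularity: dimensions, vanishing above degree n, and
  injectivity\<close>

context
  assumes reg: "\<And>k g. k < n \<Longrightarrow> g \<in> C \<Longrightarrow> f (Suc k) * g \<in> gen_ideal f k \<Longrightarrow> g \<in> gen_ideal f k"
begin

lemma hasdim_J: "mp.hasdim (J \<inter> homogeneous_part n d) (card (nonsquarefree n n d))"
  unfolding J_def by (rule hasdim_gen_ideal[OF f]) (use reg in \<open>auto simp: C_def R_def\<close>)

text \<open>The binomial coefficient vanishes for \<open>d\<close> above \<open>n\<close>, so
  \<open>J\<close> already has full dimension in that degree.\<close>

lemma hom_above_subset: assumes "n < d" shows "homogeneous_part n d \<subseteq> J"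
proof -
  have "card (mons n d) - card (nonsquarefree n n d) = 0" using card_squarefree[of n d] assms by simp
  moreover have "card (nonsquarefree n n d) \<le> card (mons n d)" by (rule card_mono) (simp_all add: nonsquarefree_sub)
  ultimately have "card (mons n d) = card (nonsquarefree n n d)" by simp
  then have "mp.hasdim (J \<inter> homogeneous_part n d) (card (mons n d))" using hasdim_J[of d] by simp
  then have "J \<inter> homogeneous_part n d = homogeneous_part n d"
    by (rule mp.hasdim_eq_subset[OF hasdim_hom]) simp
  then show ?thesis by blast
qed

text \<open>The graded pieces of the quotient in degrees i and n - i have equal dimension by
  symmetry of binomial coefficients.\<close>

lemma surjective_imp_injective:
  assumes l: "l \<in> homogeneous_part n 1" and i: "2 * i \<le> n"
    and surj: "\<And>p. p \<in> homogeneous_part n (n - i) \<Longrightarrow> \<exists>q\<in>homogeneous_part n i. p - l ^ (n - 2 * i) * q \<in> J"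
    and p: "p \<in> homogeneous_part n i" "l ^ (n - 2 * i) * p \<in> J"
  shows "p \<in> J"
proof -
  let ?\<phi> = "\<lambda>p. l ^ (n - 2 * i) * p"
  have lk: "?\<phi> p \<in> homogeneous_part n (n - i)" if "p \<in> homogeneous_part n i" for p
    by (rule hom_power_mult[OF l that i])
  have "p \<in> J \<inter> homogeneous_part n i"
  proof (rule mp.hasdim_quotient_inj[OF linear_mult[of "l ^ (n - 2 * i)"] hasdim_J hasdim_hom hasdim_J[of "n - i"] hasdim_hom])
    show "card (mons n i) - card (nonsquarefree n n i) = card (mons n (n - i)) - card (nonsquarefree n n (n - i))"
      unfolding card_squarefree using i by (intro binomial_symmetric) simp
    show "\<exists>w\<in>homogeneous_part n i. v - ?\<phi> w \<in> J \<inter> homogeneous_part n (n - i)" if v: "v \<in> homogeneous_part n (n - i)" for v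
    proof -
      obtain q where "q \<in> homogeneous_part n i" "v - ?\<phi> q \<in> J" using surj[OF v] by blast
      then show ?thesis using hom_diff[OF v lk] by blast
    qed
    show "?\<phi> ` (J \<inter> homogeneous_part n i) \<subseteq> J \<inter> homogeneous_part n (n - i)"
      using lk J_closed(3) by blast
    show "?\<phi> ` homogeneous_part n i \<subseteq> homogeneous_part n (n - i)" using lk by blast
    show "?\<phi> p \<in> J \<inter> homogeneous_part n (n - i)" using lk p by blast
  qed (use p in auto)
  then show ?thesis by blast
qed

lemma surjective_imp_strong_Lefschetz:
  assumes l: "l \<in> homogeneous_part n 1"
    and surj: "\<And>i p. 2 * i \<le> n \<Longrightarrow> p \<in> homogeneous_part n (n - i) \<Longrightarrow>
      \<exists>q\<in>homogeneous_part n i. p - l ^ (n - 2 * i) * q \<in> J"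
  shows "strong_Lefschetz_element ring_of_type_algebra A G (cl l)"
proof (rule strong_Lefschetz_elementI[OF hom_above_subset l _ surj])
  show "p \<in> J" if "2 * i \<le> n" "p \<in> homogeneous_part n i" "l ^ (n - 2 * i) * p \<in> J" for i p
    using surjective_imp_injective[OF l that(1) surj[OF that(1)] that(2,3)] .
qed

end

end

section \<open>Completing the square and the final case distinction\<close>

lemma complete_square:
  fixes b \<alpha> \<gamma> \<delta> :: "'a::comm_ring_1"
  assumes e: "e = (\<Sum>i = 1..n. mvar i)" and y: "\<And>i. y i = mvar i + mconst b * e"
  shows "mconst \<alpha> * (mvar i * mvar i) + mconst (2 * \<alpha> * b) * (mvar i * e)
      + mconst \<gamma> * (\<Sum>j = 1..n. mvar j * mvar j) + mconst \<delta> * (e * e) =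
    mconst \<alpha> * (y i * y i) + mconst \<gamma> * (\<Sum>j = 1..n. y j * y j)
      + mconst (\<delta> - \<alpha> * b * b - \<gamma> * (2 * b + of_nat n * b * b)) * (e * e)"
proof -
  define B where "B = mconst b"
  have "(\<Sum>j = 1..n. y j * y j) = (\<Sum>j = 1..n. mvar j * mvar j + 2 * B * e * mvar j + B * B * (e * e))"
    unfolding y B_def by (intro sum.cong refl) (simp add: algebra_simps)
  also have "\<dots> = (\<Sum>j = 1..n. mvar j * mvar j) + 2 * B * e * e + of_nat n * (B * B * (e * e))"
    unfolding sum.distrib sum_distrib_left[symmetric] e[symmetric] by simp
  finally have S: "(\<Sum>j = 1..n. y j * y j) = (\<Sum>j = 1..n. mvar j * mvar j) + 2 * B * e * e + of_nat n * (B * B * (e * e))" .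
  have m: "mconst (2 * \<alpha> * b) = 2 * mconst \<alpha> * B"
    "mconst (\<delta> - \<alpha> * b * b - \<gamma> * (2 * b + of_nat n * b * b)) =
      mconst \<delta> - mconst \<alpha> * B * B - mconst \<gamma> * (2 * B + of_nat n * B * B)"
    by (simp_all only: mconst_diff mconst_mult mconst_add mconst_numeral mconst_of_nat B_def)
  show ?thesis unfolding S m unfolding y B_def[symmetric] by (simp add: algebra_simps)
qed

lemma mvar_inject: "(mvar i :: 'a::comm_ring_1 mpoly) = mvar j \<longleftrightarrow> i = j"
proof
  assume "(mvar i :: 'a mpoly) = mvar j"
  then have "Poly_Mapping.keys (mvar i :: 'a mpoly) = Poly_Mapping.keys (mvar j :: 'a mpoly)" by simp
  then have "Poly_Mapping.single i (1::nat) = Poly_Mapping.single j 1" by (simp add: mvar_def)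
  then have "Poly_Mapping.keys (Poly_Mapping.single i (1::nat)) = Poly_Mapping.keys (Poly_Mapping.single j (1::nat))" by (rule arg_cong)
  then show "i = j" by simp
qed simp

theorem theorem10:
  fixes n :: nat
    and f :: "nat \<Rightarrow> 'a::field_char_0 mpoly"
    and R :: "('a, 'a mpoly) module"
    and I :: "'a mpoly set"
    and A :: "('a, 'a mpoly set) module"
    and G :: "nat \<Rightarrow> 'a mpoly set set"
    and e1 :: "'a mpoly"
  assumes R: "R = poly_algebra n"
    and quadrics: "\<And>i. i \<in> {1..n} \<Longrightarrow> f i \<in> homogeneous_part n 2"
    and regular: "regular_sequence R (map f [1..<Suc n])"
    and equivariant: "\<And>\<sigma> i. \<sigma> permutes {1..n} \<Longrightarrow> i \<in> {1..n} \<Longrightarrow>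
          msubst n (\<lambda>j. mvar (\<sigma> j)) (f i) = f (\<sigma> i)"
    and I: "I = Idl\<^bsub>R\<^esub> (f ` {1..n})"
    and A: "A = quot_algebra R I"
    and G: "G = quot_grading R (homogeneous_part n) I"
    and e1: "e1 = (\<Sum>i = 1..n. mvar i)"
  shows "strong_Lefschetz_property ring_of_type_algebra A G \<and>
         (e1 ^ 2 \<notin> I \<longrightarrow> strong_Lefschetz_element ring_of_type_algebra A G (I +>\<^bsub>R\<^esub> e1))"
proof -
  \<comment> \<open>The list in \<open>regular_sequence\<close> is indexed from 0 and the quadrics
    from 1; \<open>genideal_eq\<close> translates the generated ideals.\<close>
  have reg: "g \<in> gen_ideal f k" if k: "k < n" and g: "g \<in> carrier R" and fg: "f (Suc k) * g \<in> gen_ideal f k" for k g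
  proof -
    have fk: "f i \<in> homogeneous_part n 2" if "i \<in> {1..k}" for i using quadrics that k by simp
    have take: "set (take k (map f [1..<Suc n])) = f ` {1..k}"
      using k by (simp add: take_map take_upt atLeastLessThanSuc_atLeastAtMost[symmetric] del: upt_Suc)
    have nth: "map f [1..<Suc n] ! k = f (Suc k)" using k by (simp del: upt_Suc)
    have Idl: "Idl\<^bsub>R\<^esub> (f ` {1..k}) = gen_ideal f k \<inter> carrier R"
      unfolding R by (rule genideal_eq[OF fk])
    have "f (Suc k) * g \<in> carrier R"
      using hom_carrier[OF quadrics[of "Suc k"]] k g unfolding R by (intro carrier_mult) auto
    then have "map f [1..<Suc n] ! k \<otimes>\<^bsub>R\<^esub> g \<in> Idl\<^bsub>R\<^esub> (set (take k (map f [1..<Suc n])))"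
      unfolding take nth Idl using fg by (simp add: R)
    moreover have "k < length (map f [1..<Suc n])" using k by simp
    ultimately have "g \<in> Idl\<^bsub>R\<^esub> (set (take k (map f [1..<Suc n])))"
      using regular g unfolding regular_sequence_def by blast
    then show ?thesis unfolding take Idl by simp
  qed
  obtain \<alpha> \<beta> \<gamma> \<delta> where f_eq: "\<And>i. i \<in> {1..n} \<Longrightarrow> f i = mconst \<alpha> * (mvar i * mvar i) + mconst \<beta> * (mvar i * e1)
      + mconst \<gamma> * (\<Sum>j = 1..n. mvar j * mvar j) + mconst \<delta> * (e1 * e1)" and small: "n \<le> 2 \<Longrightarrow> \<alpha> \<noteq> 0"
    using quadric_normal_form[OF quadrics equivariant e1] by blast
  text \<open>If \<open>\<alpha> = 0\<close>, then \<open>f\<^sub>1 - f\<^sub>2\<close> and \<open>f\<^sub>1 - f\<^sub>3\<close> have the common factor \<open>e\<^sub>1\<close>.\<close>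
  have \<alpha>: "\<alpha> \<noteq> 0"
  proof
    assume \<alpha>: "\<alpha> = 0"
    then have n: "2 < n" using small by (cases "n \<le> 2") auto
    let ?d = "mvar 1 - mvar 2 :: 'a mpoly"
    have F: "f 2 = f 1 - mconst \<beta> * (?d * e1)" "f 3 = f 1 - mconst \<beta> * ((mvar 1 - mvar 3) * e1)"
      using n f_eq[of 1] f_eq[of 2] f_eq[of 3] by (simp_all add: \<alpha> algebra_simps)
    \<comment> \<open>Cross-multiplying the two differences cancels the common factor. Regularity
      then puts the linear form \<open>?d\<close> into the ideal of \<open>f 1\<close> and
      \<open>f 2\<close>, which is impossible by degree.\<close>
    have "f 3 * ?d = ?d * f 1 - (mvar 1 - mvar 3) * (f 1 - f 2)"
      unfolding F by (simp add: algebra_simps)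
    moreover have "f 1 \<in> gen_ideal f 2" "f 2 \<in> gen_ideal f 2" by (auto intro: gen_ideal_gen)
    ultimately have "f (Suc 2) * ?d \<in> gen_ideal f 2"
      by (simp add: gen_ideal_diff gen_ideal_mult)
    moreover have d: "?d \<in> homogeneous_part n 1" using n by (intro hom_diff hom_mvar) auto
    ultimately have dI: "?d \<in> gen_ideal f 2" using reg[of 2 ?d] n hom_carrier[OF d] unfolding R by simp
    have "?d = 0" by (rule gen_ideal_low[OF _ dI d]) (use quadrics n in auto)
    then show False using mvar_inject[of 1 2, where 'a = 'a] by simp
  qed
  \<comment> \<open>This shift makes the square of \<open>y i\<close> absorb the mixed term
    \<open>mvar i * e1\<close>.\<close>
  define b where "b = \<beta> / (2 * \<alpha>)"
  have \<beta>: "\<beta> = 2 * \<alpha> * b" using \<alpha> by (simp add: b_def)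
  define \<delta>' where "\<delta>' = \<delta> - \<alpha> * b * b - \<gamma> * (2 * b + of_nat n * b * b)"
  define y where "y = (\<lambda>i. mvar i + mconst b * e1)"
  have I_eq: "I = gen_ideal f n \<inter> carrier R"
    unfolding I R by (rule genideal_eq[OF quadrics])
  interpret Q: poly_quotient n f "carrier R" "gen_ideal f n" I R A G "\<lambda>p. I +>\<^bsub>R\<^esub> p"
    by unfold_locales (simp_all only: R I_eq A G quadrics)
  have top: "homogeneous_part n (Suc n) \<subseteq> gen_ideal f n"
    by (rule Q.hom_above_subset[OF reg]) simp_all
  have f_y: "f i = mconst \<alpha> * (y i * y i) + mconst \<gamma> * (\<Sum>j = 1..n. y j * y j) + mconst \<delta>' * (e1 * e1)"
    if "i \<in> {1..n}" for i
    using complete_square[OF e1, of y b \<alpha> i \<gamma> \<delta>] f_eq[OF that]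
    unfolding \<beta> \<delta>'_def by (simp add: y_def)
  \<comment> \<open>If the sum vanished, the last quadric would lie in the ideal of the others, and
    regularity applied to \<open>g = 1\<close> would make that ideal contain 1.\<close>
  have sum_f: "(\<Sum>i = 1..n. f i) \<noteq> 0" if n: "0 < n"
  proof
    obtain k where k: "n = Suc k" using n gr0_implies_Suc by blast
    assume "(\<Sum>i = 1..n. f i) = 0"
    then have "(\<Sum>i = 1..k. f i) + f (Suc k) = 0" by (simp add: k)
    then have "f (Suc k) * 1 = - 1 * (\<Sum>i = 1..k. f i)" by (simp add: eq_neg_iff_add_eq_0 add.commute)
    moreover have "(\<Sum>i = 1..k. f i) \<in> gen_ideal f k"
      unfolding gen_ideal_def by (rule range_eqI[of _ _ "\<lambda>_. 1"]) simp
    ultimately have "f (Suc k) * 1 \<in> gen_ideal f k" using gen_ideal_mult by metis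
    then have 1: "1 \<in> gen_ideal f k" using reg[of k 1] k by (simp add: R)
    have "(1 :: 'a mpoly) = 0" by (rule gen_ideal_low[OF _ 1 hom_1[of n]]) (use quadrics k in auto)
    then show False by simp
  qed
  interpret S: symmetric_quadrics n f b \<alpha> \<gamma> \<delta>' e1 y "gen_ideal f n"
    by (unfold_locales, rule f_y[unfolded y_def e1], assumption, rule \<alpha>, rule top, rule sum_f, assumption,
      simp_all only: e1 y_def)
  note SL = Q.surjective_imp_strong_Lefschetz[OF reg]
  have e1_hom: "e1 \<in> homogeneous_part n 1" unfolding e1 by (intro hom_sum hom_mvar)
  show ?thesis
  proof (cases "\<alpha> + of_nat n * \<gamma> = 0")
    case False
    have "strong_Lefschetz_element ring_of_type_algebra A G (I +>\<^bsub>R\<^esub> e1)"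
      using SL[OF _ _ _ e1_hom] S.surjective_e[OF False] by blast
    then show ?thesis unfolding strong_Lefschetz_property_def by blast
  next
    case True
    obtain l where l: "l \<in> homogeneous_part n 1"
      and surj: "\<And>i p. 2 * i \<le> n \<Longrightarrow> p \<in> homogeneous_part n (n - i) \<Longrightarrow>
        \<exists>q\<in>homogeneous_part n i. p - l ^ (n - 2 * i) * q \<in> gen_ideal f n"
      using S.surjective_generic[OF True] by blast
    have "strong_Lefschetz_element ring_of_type_algebra A G (I +>\<^bsub>R\<^esub> l)"
      using SL[OF _ _ _ l surj] by blast
    \<comment> \<open>The second claim thus holds vacuously in the degenerate case.\<close>
    moreover have "e1 ^ 2 \<in> I"
      using S.e_sq[OF True] hom_carrier[OF e1_hom] unfolding I_eq R power2_eq_square by (simp add: carrier_mult)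
    ultimately show ?thesis unfolding strong_Lefschetz_property_def by blast
  qed
qed

end
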